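(* Let $A$ be an integral domain and let $\Gamma$ be a nonzero torsionless grading monoid. Then $Cl(A[\Gamma])=Cl(A)$, i.e. the canonical homomorphism $\phi: Cl(A)\to Cl(A[\Gamma])$, $[J]\mapsto[J[\Gamma]]$, is an isomorphism, if and only if $A$ and $\Gamma$ are integrally closed and $Cl(\Gamma)=0$.
   Context: A torsionless grading monoid is a commutative cancellative monoid $\Gamma$, written additively, whose quotient group $G=\langle\Gamma\rangle$ is torsion-free. $\Gamma$ is integrally closed if $g\in G$ and $ng\in\Gamma$ for some integer $n\ge1$ imply $g\in\Gamma$. $A[\Gamma]$ is the semigroup ring; for a fractional ideal $J$ of $A$, $J[\Gamma]=JA[\Gamma]$. Domains: for nonzero fractional ideals $I,J$ of a domain $D$ with quotient field $L$, $(I:J)=\{x\in L: xJ\subset I\}$, $I^{-1}=(D:I)$, $I_v=(I^{-1})^{-1}$, $I_t=\bigcup\{F_v : F\subset I \text{ a nonzero finitely generated fractional ideal}\}$. $I$ is a $t$-ideal if $I_t=I$, and a $t$-ideal is $t$-invertible if it is invertible under $(I,J)\mapsto(IJ)_t$ (equivalently $(II^{-1})_t=D$). $Cl(D)$ is the group of $t$-invertible fractional $t$-ideals under $t$-multiplication modulo nonzero principal fractional ideals. Semigroups: a fractional ideal of $\Gamma$ is a nonempty $Y\subset G$ with $Y+\Gamma\subset Y$ and $\gamma+Y\subset\Gamma$ for some $\gamma\in\Gamma$. Put $(Y:Z)=\{g\in G: g+Z\subset Y\}$, $Y^{-1}=(\Gamma:Y)$, $Y_v=(Y^{-1})^{-1}$,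 $Y_t=\bigcup\{(F+\Gamma)_v : F\subset Y \text{ finite nonempty}\}$; $Y$ is a $t$-ideal if $Y_t=Y$, and a $t$-ideal is $t$-invertible if it is invertible under $(Y,Z)\mapsto(Y+Z)_t$ (equivalently $(Y+Y^{-1})_t=\Gamma$). $Cl(\Gamma)$ is the group of $t$-invertible fractional $t$-ideals of $\Gamma$ under this operation modulo its subgroup of principal fractional ideals $\alpha+\Gamma$, $\alpha\in G$. *)

theory Defs
  imports
    "HOL-Library.Poly_Mapping"
    "HOL-Library.Set_Algebras"
    "HOL-Computational_Algebra.Polynomial_Factorial"
    "HOL-Algebra.Elementary_Groups"
begin

section \<open>Torsionless grading monoids\<close>

text \<open>
  A cancellative commutative monoid \<open>\<Gamma>\<close> is given as a submonoid of its quotient group, which is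
  the whole type \<open>'g\<close>.  The \<open>n\<close>-fold multiple of \<open>x\<close> is written \<open>\<Sum>i<n. x\<close>.
\<close>

class torsion_free_ab_group_add = ab_group_add +
  assumes torsion_free: "0 < (n::nat) \<Longrightarrow> (\<Sum>i<n. x) = 0 \<Longrightarrow> x = 0"

definition torsionless_grading_monoid :: "'g::torsion_free_ab_group_add set \<Rightarrow> bool" where
  "torsionless_grading_monoid \<Gamma> \<longleftrightarrow>
     0 \<in> \<Gamma> \<and> (\<forall>\<alpha>\<in>\<Gamma>. \<forall>\<beta>\<in>\<Gamma>. \<alpha> + \<beta> \<in> \<Gamma>) \<and>
     (\<forall>g. \<exists>\<alpha>\<in>\<Gamma>. \<exists>\<beta>\<in>\<Gamma>. g = \<alpha> - \<beta>)"

definition integrally_closed_monoid :: "'g::torsion_free_ab_group_add set \<Rightarrow> bool" where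
  "integrally_closed_monoid \<Gamma> \<longleftrightarrow> (\<forall>g. \<forall>n\<ge>(1::nat). (\<Sum>i<n. g) \<in> \<Gamma> \<longrightarrow> g \<in> \<Gamma>)"

subsection \<open>Ideals of a monoid and its class group\<close>

definition monoid_frac_ideal :: "'g::ab_group_add set \<Rightarrow> 'g set \<Rightarrow> bool" where
  "monoid_frac_ideal \<Gamma> Y \<longleftrightarrow>
     Y \<noteq> {} \<and> Y + \<Gamma> \<subseteq> Y \<and> (\<exists>\<gamma>\<in>\<Gamma>. \<gamma> +o Y \<subseteq> \<Gamma>)"

definition monoid_colon :: "'g::ab_group_add set \<Rightarrow> 'g set \<Rightarrow> 'g set" where
  "monoid_colon Y Z = {g. g +o Z \<subseteq> Y}"

definition monoid_v :: "'g::ab_group_add set \<Rightarrow> 'g set \<Rightarrow> 'g set" where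
  "monoid_v \<Gamma> Y = monoid_colon \<Gamma> (monoid_colon \<Gamma> Y)"

definition monoid_t :: "'g::ab_group_add set \<Rightarrow> 'g set \<Rightarrow> 'g set" where
  "monoid_t \<Gamma> Y = \<Union>{monoid_v \<Gamma> (F + \<Gamma>) | F. finite F \<and> F \<noteq> {} \<and> F \<subseteq> Y}"

definition monoid_t_ideal :: "'g::ab_group_add set \<Rightarrow> 'g set \<Rightarrow> bool" where
  "monoid_t_ideal \<Gamma> Y \<longleftrightarrow> monoid_frac_ideal \<Gamma> Y \<and> monoid_t \<Gamma> Y = Y"

definition monoid_t_group :: "'g::ab_group_add set \<Rightarrow> 'g set monoid" where
  "monoid_t_group \<Gamma> =
     \<lparr>carrier = {Y. monoid_t_ideal \<Gamma> Y \<and> (\<exists>Z. monoid_t_ideal \<Gamma> Z \<and> monoid_t \<Gamma> (Y + Z) = \<Gamma>)},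
      mult = \<lambda>Y Z. monoid_t \<Gamma> (Y + Z),
      one = \<Gamma>\<rparr>"

definition monoid_class_group :: "'g::ab_group_add set \<Rightarrow> 'g set set monoid" where
  "monoid_class_group \<Gamma> = monoid_t_group \<Gamma> Mod {\<alpha> +o \<Gamma> | \<alpha>. True}"


section \<open>Ideals of a domain and its class group\<close>

text \<open>
  A domain is given as a subring \<open>D\<close> of a field type \<open>'l\<close> that is its quotient field.
\<close>

definition submodule_span :: "'l::field set \<Rightarrow> 'l set \<Rightarrow> 'l set" where
  "submodule_span D S =
     \<Inter>{M. S \<subseteq> M \<and> 0 \<in> M \<and> (\<forall>x\<in>M. \<forall>y\<in>M. x + y \<in> M) \<and> (\<forall>d\<in>D. \<forall>x\<in>M. d * x \<in> M)}"

text \<open>All fractional ideals considered are nonzero.\<close>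

definition frac_ideal :: "'l::field set \<Rightarrow> 'l set \<Rightarrow> bool" where
  "frac_ideal D I \<longleftrightarrow>
     I \<noteq> {0} \<and> 0 \<in> I \<and> (\<forall>x\<in>I. \<forall>y\<in>I. x + y \<in> I) \<and> (\<forall>d\<in>D. \<forall>x\<in>I. d * x \<in> I) \<and>
     (\<exists>d\<in>D. d \<noteq> 0 \<and> d *o I \<subseteq> D)"

definition ideal_mult :: "'l::field set \<Rightarrow> 'l set \<Rightarrow> 'l set \<Rightarrow> 'l set" where
  "ideal_mult D I J = submodule_span D (I * J)"

definition ideal_colon :: "'l::field set \<Rightarrow> 'l set \<Rightarrow> 'l set" where
  "ideal_colon I J = {x. x *o J \<subseteq> I}"

definition ideal_v :: "'l::field set \<Rightarrow> 'l set \<Rightarrow> 'l set" where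
  "ideal_v D I = ideal_colon D (ideal_colon D I)"

definition fin_gen :: "'l::field set \<Rightarrow> 'l set \<Rightarrow> bool" where
  "fin_gen D F \<longleftrightarrow> (\<exists>S. finite S \<and> F = submodule_span D S)"

definition ideal_t :: "'l::field set \<Rightarrow> 'l set \<Rightarrow> 'l set" where
  "ideal_t D I = \<Union>{ideal_v D F | F. frac_ideal D F \<and> fin_gen D F \<and> F \<subseteq> I}"

definition t_ideal :: "'l::field set \<Rightarrow> 'l set \<Rightarrow> bool" where
  "t_ideal D I \<longleftrightarrow> frac_ideal D I \<and> ideal_t D I = I"

definition t_ideal_group :: "'l::field set \<Rightarrow> 'l set monoid" where
  "t_ideal_group D =
     \<lparr>carrier = {I. t_ideal D I \<and> (\<exists>J. t_ideal D J \<and> ideal_t D (ideal_mult D I J) = D)},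
      mult = \<lambda>I J. ideal_t D (ideal_mult D I J),
      one = D\<rparr>"

definition principal_ideals :: "'l::field set \<Rightarrow> 'l set set" where
  "principal_ideals D = {x *o D | x. x \<noteq> 0}"

definition class_group :: "'l::field set \<Rightarrow> 'l set set monoid" where
  "class_group D = t_ideal_group D Mod principal_ideals D"

definition ideal_class :: "'l::field set \<Rightarrow> 'l set \<Rightarrow> 'l set set" where
  "ideal_class D I = principal_ideals D #>\<^bsub>t_ideal_group D\<^esub> I"

definition integrally_closed_domain :: "'l::field set \<Rightarrow> bool" where
  "integrally_closed_domain D \<longleftrightarrow>
     (\<forall>x. (\<exists>p. lead_coeff p = 1 \<and> (\<forall>i. coeff p i \<in> D) \<and> poly p x = 0) \<longrightarrow> x \<in> D)"


section \<open>Group rings of torsion-free groups are domains\<close>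

text \<open>
  A torsion-free abelian group has a total positive cone \<open>P\<close>; since \<open>'g\<close> itself carries no order,
  the instances of \<^typ>\<open>'g \<Rightarrow>\<^sub>0 'a\<close> for ordered exponents do not apply, and the instance \<open>idom\<close> is set
  up for a copy of that type.
\<close>

lemma multiple_add:
  fixes x :: "'g::comm_monoid_add"
  shows "(\<Sum>i<(m + n :: nat). x) = (\<Sum>i<m. x) + (\<Sum>i<n. x)"
  by (induction n) (simp_all add: ac_simps)

lemma multiple_mult:
  fixes x :: "'g::comm_monoid_add"
  shows "(\<Sum>i<(m * n :: nat). x) = (\<Sum>j<m. \<Sum>i<n. x)"
  by (induction m) (simp_all add: multiple_add ac_simps)

lemma multiple_uminus:
  fixes x :: "'g::ab_group_add"
  shows "(\<Sum>i<(n::nat). - x) = - (\<Sum>i<n. x)"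
  by (simp add: sum_negf)

lemma total_cone_exists:
  obtains P :: "'g::torsion_free_ab_group_add set"
  where "0 \<in> P" "\<And>x y. x \<in> P \<Longrightarrow> y \<in> P \<Longrightarrow> x + y \<in> P"
    "\<And>x. x \<in> P \<Longrightarrow> - x \<in> P \<Longrightarrow> x = 0" "\<And>x. x \<in> P \<or> - x \<in> P"
proof -
  define cone where "cone P \<longleftrightarrow> 0 \<in> P \<and> (\<forall>x\<in>P. \<forall>y\<in>P. x + y \<in> P) \<and> (\<forall>x. x \<in> P \<and> - x \<in> P \<longrightarrow> x = 0)"
    for P :: "'g set"
  have ex: "\<exists>M\<in>{P. cone P}. \<forall>X\<in>{P. cone P}. M \<subseteq> X \<longrightarrow> X = M"
  proof (rule subset_Zorn_nonempty)
    show "{P. cone P} \<noteq> {}"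
      by (auto simp: cone_def intro!: exI[of _ "{0}"])
  next
    fix C :: "'g set set"
    assume C: "C \<noteq> {}" "subset.chain {P. cone P} C"
    have cones: "cone P" if "P \<in> C" for P
      using C(2) that by (auto simp: subset_chain_def)
    have common: "\<exists>P\<in>C. x \<in> P \<and> y \<in> P" if "x \<in> \<Union>C" "y \<in> \<Union>C" for x y
    proof -
      from that obtain P Q where PQ: "P \<in> C" "Q \<in> C" "x \<in> P" "y \<in> Q" by blast
      then have "P \<subseteq> Q \<or> Q \<subseteq> P"
        using C(2) by (auto simp: subset_chain_def)
      then show ?thesis using PQ by blast
    qed
    show "\<Union>C \<in> {P. cone P}"
      unfolding mem_Collect_eq cone_def
    proof (intro conjI ballI allI impI)
      show "0 \<in> \<Union>C" using C(1) cones unfolding cone_def by blast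
    next
      fix x y assume "x \<in> \<Union>C" "y \<in> \<Union>C"
      then obtain P where "P \<in> C" "x \<in> P" "y \<in> P" using common by blast
      then show "x + y \<in> \<Union>C" using cones unfolding cone_def by blast
    next
      fix x assume "x \<in> \<Union>C \<and> - x \<in> \<Union>C"
      then obtain P where "P \<in> C" "x \<in> P" "- x \<in> P" using common by blast
      then show "x = 0" using cones unfolding cone_def by blast
    qed
  qed
  obtain P where P: "cone P" and max: "\<And>X. cone X \<Longrightarrow> P \<subseteq> X \<Longrightarrow> X = P"
    using ex by auto
  have P0: "0 \<in> P" and Padd: "\<And>x y. x \<in> P \<Longrightarrow> y \<in> P \<Longrightarrow> x + y \<in> P"
    and Pneg: "\<And>x. x \<in> P \<Longrightarrow> - x \<in> P \<Longrightarrow> x = 0"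
    using P unfolding cone_def by blast+
  have Pmult: "(\<Sum>i<n. x) \<in> P" if "x \<in> P" for x and n :: nat
    using that by (induction n) (auto simp: P0 Padd)
  have key: "\<exists>n>0::nat. - (\<Sum>i<n. x) \<in> P" if x: "x \<notin> P" for x
  proof -
    define Q where "Q = {p + (\<Sum>i<n. x) | p (n::nat). p \<in> P}"
    have "x \<in> Q"
      unfolding Q_def mem_Collect_eq by (intro exI[of _ 0] exI[of _ "Suc 0"]) (simp add: P0)
    moreover have PQ: "P \<subseteq> Q"
    proof
      fix p assume "p \<in> P"
      then show "p \<in> Q"
        unfolding Q_def mem_Collect_eq by (intro exI[of _ p] exI[of _ "0::nat"]) simp
    qed
    ultimately have "\<not> cone Q" using x max by blast
    moreover have "u + w \<in> Q" if "u \<in> Q" "w \<in> Q" for u w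
    proof -
      from that obtain p q :: 'g and n m :: nat where "u = p + (\<Sum>i<n. x)" "w = q + (\<Sum>i<m. x)" "p \<in> P" "q \<in> P"
        unfolding Q_def by blast
      then have "u + w = (p + q) + (\<Sum>i<n + m. x)" "p + q \<in> P"
        unfolding multiple_add by (simp_all add: ac_simps Padd)
      then show ?thesis unfolding Q_def by blast
    qed
    ultimately obtain z where z: "z \<in> Q" "- z \<in> Q" "z \<noteq> 0"
      using P0 PQ unfolding cone_def by blast
    then obtain p q :: 'g and n m :: nat where z1: "z = p + (\<Sum>i<n. x)" and z2: "- z = q + (\<Sum>i<m. x)"
      and pq: "p \<in> P" "q \<in> P" unfolding Q_def by blast
    have "(p + q) + (\<Sum>i<n + m. x) = z + - z"
      unfolding z1[symmetric] multiple_add by (subst z2, subst z1) (simp add: ac_simps)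
    also have "z + - z = 0" by simp
    finally have "p + q = - (\<Sum>i<n + m. x)" by (simp only: eq_neg_iff_add_eq_0)
    then have eq: "- (\<Sum>i<n + m. x) = p + q" by simp
    have "n + m \<noteq> 0"
    proof
      assume "n + m = 0"
      then have "z = p" "- z = q" using z1 z2 by simp_all
      then show False using Pneg pq z(3) by blast
    qed
    then show ?thesis using eq Padd pq by (metis gr0I)
  qed
  have "x \<in> P \<or> - x \<in> P" for x
  proof (rule ccontr)
    assume "\<not> ?thesis"
    then obtain n m :: nat where n: "n > 0" "- (\<Sum>i<n. x) \<in> P" and m: "m > 0" "- (\<Sum>i<m. - x) \<in> P"
      using key[of x] key[of "- x"] by blast
    have "- (\<Sum>i<m * n. x) \<in> P"
      using Pmult[OF n(2), of m] by (simp add: multiple_mult multiple_uminus)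
    moreover have "(\<Sum>i<m. x) \<in> P" using m(2) by (simp add: multiple_uminus)
    then have "(\<Sum>i<n * m. x) \<in> P"
      using Pmult[of _ n] by (simp only: multiple_mult)
    ultimately have "(\<Sum>i<n * m. x) = 0" using Pneg by (simp add: mult.commute)
    then have "x = 0" using torsion_free[of "n * m" x] n(1) m(1) by simp
    with \<open>\<not> (x \<in> P \<or> - x \<in> P)\<close> P0 show False by simp
  qed
  then show thesis using that P0 Padd Pneg by simp
qed

lemma cone_greatest:
  fixes P :: "'g::ab_group_add set"
  assumes P: "0 \<in> P" "\<And>x y. x \<in> P \<Longrightarrow> y \<in> P \<Longrightarrow> x + y \<in> P" "\<And>x. x \<in> P \<or> - x \<in> P"
  assumes "finite F" "F \<noteq> {}"
  shows "\<exists>m\<in>F. \<forall>x\<in>F. m - x \<in> P"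
  using assms(4,5)
proof (induction F rule: finite_ne_induct)
  case (singleton x)
  then show ?case using P(1) by simp
next
  case (insert y F)
  then obtain m where m: "m \<in> F" "\<forall>x\<in>F. m - x \<in> P" by blast
  from P(3)[of "m - y"] show ?case
  proof
    assume "m - y \<in> P"
    then show ?thesis using m by blast
  next
    assume ym: "- (m - y) \<in> P"
    have "y - x \<in> P" if "x \<in> F" for x
      using P(2)[OF ym m(2)[rule_format, OF that]] by (simp add: algebra_simps)
    then show ?thesis using P(1) by auto
  qed
qed

lemma poly_mapping_no_zero_divisors:
  fixes f g :: "'g::torsion_free_ab_group_add \<Rightarrow>\<^sub>0 'a::idom"
  assumes f: "f \<noteq> 0" and g: "g \<noteq> 0"
  shows "f * g \<noteq> 0"
proof -
  obtain P :: "'g set" where P: "0 \<in> P" "\<And>x y. x \<in> P \<Longrightarrow> y \<in> P \<Longrightarrow> x + y \<in> P"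
    "\<And>x. x \<in> P \<Longrightarrow> - x \<in> P \<Longrightarrow> x = 0" "\<And>x. x \<in> P \<or> - x \<in> P"
  proof (rule total_cone_exists)
    fix P :: "'g set"
    assume "0 \<in> P" "\<And>x y. x \<in> P \<Longrightarrow> y \<in> P \<Longrightarrow> x + y \<in> P"
      "\<And>x. x \<in> P \<Longrightarrow> - x \<in> P \<Longrightarrow> x = 0" "\<And>x. x \<in> P \<or> - x \<in> P"
    then show thesis by (rule that)
  qed
  have top: "\<exists>m\<in>Poly_Mapping.keys h. \<forall>x\<in>Poly_Mapping.keys h. m - x \<in> P" if "h \<noteq> 0" for h :: "'g \<Rightarrow>\<^sub>0 'a"
    using that P by (intro cone_greatest) auto
  obtain a where a: "a \<in> Poly_Mapping.keys f" "\<And>x. x \<in> Poly_Mapping.keys f \<Longrightarrow> a - x \<in> P"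
    using top[OF f] by blast
  obtain b where b: "b \<in> Poly_Mapping.keys g" "\<And>x. x \<in> Poly_Mapping.keys g \<Longrightarrow> b - x \<in> P"
    using top[OF g] by blast
  define c d where "c = Poly_Mapping.lookup f a" and "d = Poly_Mapping.lookup g b"
  define f' g' where "f' = f - Poly_Mapping.single a c" and "g' = g - Poly_Mapping.single b d"
  have f'k: "x \<in> Poly_Mapping.keys f \<and> x \<noteq> a" if "x \<in> Poly_Mapping.keys f'" for x
    using that by (auto simp: f'_def c_def in_keys_iff lookup_minus lookup_single when_def split: if_splits)
  have g'k: "x \<in> Poly_Mapping.keys g \<and> x \<noteq> b" if "x \<in> Poly_Mapping.keys g'" for x
    using that by (auto simp: g'_def d_def in_keys_iff lookup_minus lookup_single when_def split: if_splits)
  have unique: "x = a \<and> y = b"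
    if "x \<in> Poly_Mapping.keys f" "y \<in> Poly_Mapping.keys g" "x + y = a + b" for x y
  proof -
    have "a - x = - (b - y)" using that(3) by (simp add: algebra_simps)
    then have "a - x = 0" using P(3) a(2)[OF that(1)] b(2)[OF that(2)] by (metis minus_minus)
    then show ?thesis using that(3) by simp
  qed
  have fg: "f * g = Poly_Mapping.single (a + b) (c * d) + (Poly_Mapping.single a c * g' + f' * g)"
  proof -
    have "x * y = u * w + (u * (y - w) + (x - u) * y)" for x y u w :: "'g \<Rightarrow>\<^sub>0 'a"
      by (simp add: algebra_simps)
    then show ?thesis unfolding f'_def g'_def mult_single[symmetric] .
  qed
  have "a + b \<notin> Poly_Mapping.keys (f' * g)"
  proof
    assume "a + b \<in> Poly_Mapping.keys (f' * g)"
    then obtain x y where "a + b = x + y" "x \<in> Poly_Mapping.keys f'" "y \<in> Poly_Mapping.keys g"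
      using keys_mult[of f' g] by auto
    then show False using f'k[of x] unique[of x y] by simp
  qed
  moreover have "a + b \<notin> Poly_Mapping.keys (Poly_Mapping.single a c * g')"
  proof
    assume "a + b \<in> Poly_Mapping.keys (Poly_Mapping.single a c * g')"
    then obtain y where "a + b = a + y" "y \<in> Poly_Mapping.keys g'"
      using keys_mult[of "Poly_Mapping.single a c" g'] by (auto split: if_splits)
    then show False using g'k[of y] by simp
  qed
  ultimately have "Poly_Mapping.lookup (f * g) (a + b) = c * d"
    unfolding fg by (simp add: lookup_add in_keys_iff)
  moreover have "c * d \<noteq> 0" using a(1) b(1) by (simp add: c_def d_def in_keys_iff)
  ultimately show ?thesis by auto
qed

typedef (overloaded) ('a, 'g) group_ring = "UNIV :: ('g \<Rightarrow>\<^sub>0 'a::zero) set"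
  morphisms group_ring_coeffs Abs_group_ring ..

setup_lifting type_definition_group_ring

instantiation group_ring :: (comm_ring_1, comm_monoid_add) comm_ring_1
begin

lift_definition zero_group_ring :: "('a, 'b) group_ring" is 0 .
lift_definition one_group_ring :: "('a, 'b) group_ring" is 1 .
lift_definition plus_group_ring :: "('a, 'b) group_ring \<Rightarrow> ('a, 'b) group_ring \<Rightarrow> ('a, 'b) group_ring" is "(+)" .
lift_definition minus_group_ring :: "('a, 'b) group_ring \<Rightarrow> ('a, 'b) group_ring \<Rightarrow> ('a, 'b) group_ring" is "(-)" .
lift_definition uminus_group_ring :: "('a, 'b) group_ring \<Rightarrow> ('a, 'b) group_ring" is uminus .
lift_definition times_group_ring :: "('a, 'b) group_ring \<Rightarrow> ('a, 'b) group_ring \<Rightarrow> ('a, 'b) group_ring" is "(*)" .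

instance
  by intro_classes (transfer; simp add: algebra_simps)+

end

instance group_ring :: (idom, torsion_free_ab_group_add) idom
  by intro_classes (transfer, rule poly_mapping_no_zero_divisors)


section \<open>Semigroup rings and the canonical homomorphism\<close>

text \<open>The element \<open>a X\<^sup>g\<close> of the group ring.\<close>

lift_definition group_ring_monom :: "'a::zero \<Rightarrow> 'g \<Rightarrow> ('a, 'g) group_ring"
  is "\<lambda>a g. Poly_Mapping.single g a" .

text \<open>
  The domain \<open>A\<close> is the type \<open>'a\<close>, seen as a subring of its quotient field.  As \<open>'g\<close> is the quotient
  group of \<open>\<Gamma>\<close>, the quotient field of the group ring of \<open>'g\<close> is also that of \<open>A[\<Gamma>]\<close>
  (\<open>semigroup_ring_quotient_field\<close> below).
\<close>

definition base_ring :: "'a::idom fract set" where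
  "base_ring = range to_fract"

definition semigroup_ring ::
    "'g::torsion_free_ab_group_add set \<Rightarrow> ('a::idom, 'g) group_ring fract set" where
  "semigroup_ring \<Gamma> = to_fract ` {f. Poly_Mapping.keys (group_ring_coeffs f) \<subseteq> \<Gamma>}"

lemma group_ring_monom_0: "group_ring_monom a g = 0 \<longleftrightarrow> a = 0"
  by transfer (metis lookup_single_eq lookup_zero single_zero)

lemma group_ring_monom_mult:
  "group_ring_monom a g * group_ring_monom b h = group_ring_monom (a * b) (g + h)"
  by transfer (simp add: mult_single)

text \<open>The embedding of quotient fields induced by \<open>A \<subseteq> A[\<Gamma>]\<close>.\<close>

definition fract_embed ::
    "'a::idom fract \<Rightarrow> ('a, 'g::torsion_free_ab_group_add) group_ring fract" where
  "fract_embed x =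
     (THE y. \<exists>a b. b \<noteq> 0 \<and> x = Fract a b \<and> y = Fract (group_ring_monom a 0) (group_ring_monom b 0))"

lemma fract_embed_Fract:
  assumes "b \<noteq> 0"
  shows "fract_embed (Fract a b) = Fract (group_ring_monom a 0) (group_ring_monom b 0)"
  unfolding fract_embed_def
proof (rule the_equality)
  fix y
  assume "\<exists>a' b'. b' \<noteq> 0 \<and> Fract a b = Fract a' b' \<and>
            y = Fract (group_ring_monom a' 0) (group_ring_monom b' 0)"
  then obtain a' b' where "b' \<noteq> 0" "a * b' = a' * b"
    and y: "y = Fract (group_ring_monom a' 0) (group_ring_monom b' 0)"
    using assms by (auto simp: eq_fract)
  then show "y = Fract (group_ring_monom a 0) (group_ring_monom b 0)"
    using assms by (simp add: eq_fract group_ring_monom_0 group_ring_monom_mult)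
qed (intro exI[of _ a] exI[of _ b] conjI refl assms)

text \<open>\<open>J[\<Gamma>] = J A[\<Gamma>]\<close>\<close>

definition ideal_extension ::
    "'g::torsion_free_ab_group_add set \<Rightarrow> 'a::idom fract set \<Rightarrow> ('a, 'g) group_ring fract set" where
  "ideal_extension \<Gamma> J = ideal_mult (semigroup_ring \<Gamma>) (fract_embed ` J) (semigroup_ring \<Gamma>)"

text \<open>
  The value at a class is the common class of the extensions of all its members
  (see \<open>canonical_map_ideal_class\<close> below).
\<close>

definition canonical_map ::
    "'g::torsion_free_ab_group_add set \<Rightarrow> 'a::idom fract set set \<Rightarrow> ('a, 'g) group_ring fract set set" where
  "canonical_map \<Gamma> X =
     the_elem ((\<lambda>J. ideal_class (semigroup_ring \<Gamma>) (ideal_extension \<Gamma> J)) ` X)"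

subsection \<open>Consistency of the definitions\<close>

definition subring_with_quotient_field :: "'l::field set \<Rightarrow> bool" where
  "subring_with_quotient_field D \<longleftrightarrow>
     1 \<in> D \<and> (\<forall>x\<in>D. \<forall>y\<in>D. x - y \<in> D \<and> x * y \<in> D) \<and>
     (\<forall>x. \<exists>a\<in>D. \<exists>b\<in>D. b \<noteq> 0 \<and> x = a / b)"

lemma base_ring_quotient_field: "subring_with_quotient_field (base_ring :: 'a::idom fract set)"
  unfolding subring_with_quotient_field_def
proof (intro conjI allI ballI)
  show "1 \<in> (base_ring :: 'a fract set)"
    unfolding base_ring_def by (metis rangeI to_fract_1)
next
  fix x y :: "'a fract" assume "x \<in> base_ring" "y \<in> base_ring"
  then obtain a b where "x = to_fract a" "y = to_fract b" unfolding base_ring_def by blast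
  then show "x - y \<in> base_ring" "x * y \<in> base_ring"
    unfolding base_ring_def by (simp_all flip: to_fract_diff to_fract_mult)
next
  fix x :: "'a fract"
  obtain a b where "x = Fract a b" "b \<noteq> 0" by (cases x)
  then show "\<exists>a\<in>base_ring. \<exists>b\<in>base_ring. b \<noteq> 0 \<and> x = a / b"
    unfolding base_ring_def by (auto simp: Fract_conv_to_fract)
qed

lemma grading_monoid_common_shift:
  assumes \<Gamma>: "torsionless_grading_monoid \<Gamma>" and "finite F"
  shows "\<exists>\<gamma>\<in>\<Gamma>. \<forall>x\<in>F. \<gamma> + x \<in> \<Gamma>"
  using assms(2)
proof induction
  case empty
  then show ?case using \<Gamma> by (auto simp: torsionless_grading_monoid_def)
next
  case (insert y F)
  then obtain \<gamma> where \<gamma>: "\<gamma> \<in> \<Gamma>" "\<And>x. x \<in> F \<Longrightarrow> \<gamma> + x \<in> \<Gamma>" by blast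
  obtain \<alpha> \<beta> where \<alpha>\<beta>: "\<alpha> \<in> \<Gamma>" "\<beta> \<in> \<Gamma>" "y = \<alpha> - \<beta>"
    using \<Gamma> unfolding torsionless_grading_monoid_def by blast
  have add: "u + w \<in> \<Gamma>" if "u \<in> \<Gamma>" "w \<in> \<Gamma>" for u w
    using \<Gamma> that unfolding torsionless_grading_monoid_def by blast
  have "\<gamma> + \<beta> + x \<in> \<Gamma>" if "x \<in> insert y F" for x
  proof (cases "x = y")
    case True
    then have "\<gamma> + \<beta> + x = \<gamma> + \<alpha>" using \<alpha>\<beta>(3) by simp
    then show ?thesis using add[OF \<gamma>(1) \<alpha>\<beta>(1)] by (simp only:)
  next
    case False
    then have "\<gamma> + \<beta> + x = (\<gamma> + x) + \<beta>" "\<gamma> + x \<in> \<Gamma>"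
      using \<gamma>(2)[of x] that by (simp_all add: add.assoc add.commute[of \<beta>])
    then show ?thesis using add[of "\<gamma> + x" \<beta>] \<alpha>\<beta>(2) by (simp only:)
  qed
  then show ?case using add \<gamma> \<alpha>\<beta> by blast
qed

lemma group_ring_keys_diff:
  "Poly_Mapping.keys (group_ring_coeffs (f - g)) \<subseteq>
     Poly_Mapping.keys (group_ring_coeffs f) \<union> Poly_Mapping.keys (group_ring_coeffs g)"
  by transfer (rule keys_diff)

lemma group_ring_keys_mult:
  "Poly_Mapping.keys (group_ring_coeffs (f * g)) \<subseteq>
     {a + b | a b. a \<in> Poly_Mapping.keys (group_ring_coeffs f) \<and> b \<in> Poly_Mapping.keys (group_ring_coeffs g)}"
  by transfer (rule keys_mult)

lemma group_ring_keys_monom: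
  "Poly_Mapping.keys (group_ring_coeffs (group_ring_monom a g)) \<subseteq> {g}"
  by transfer simp

lemma group_ring_keys_one:
  "Poly_Mapping.keys (group_ring_coeffs (1 :: ('a::comm_ring_1, 'g::comm_monoid_add) group_ring)) \<subseteq> {0}"
  by transfer simp

lemma semigroup_ring_quotient_field:
  assumes \<Gamma>: "torsionless_grading_monoid (\<Gamma> :: 'g::torsion_free_ab_group_add set)"
  shows "subring_with_quotient_field (semigroup_ring \<Gamma> :: ('a::idom, 'g) group_ring fract set)"
    (is "subring_with_quotient_field ?E")
  unfolding subring_with_quotient_field_def
proof (intro conjI allI ballI)
  define K where "K = {f :: ('a, 'g) group_ring. Poly_Mapping.keys (group_ring_coeffs f) \<subseteq> \<Gamma>}"
  have E: "?E = to_fract ` K" by (simp add: semigroup_ring_def K_def)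
  have add: "u + w \<in> \<Gamma>" if "u \<in> \<Gamma>" "w \<in> \<Gamma>" for u w
    using \<Gamma> that unfolding torsionless_grading_monoid_def by blast
  have "1 \<in> K"
    using group_ring_keys_one \<Gamma> unfolding K_def torsionless_grading_monoid_def by blast
  then show "1 \<in> ?E" unfolding E by (metis imageI to_fract_1)
  {
    fix x y assume "x \<in> ?E" "y \<in> ?E"
    then obtain f g where fg: "x = to_fract f" "y = to_fract g" "f \<in> K" "g \<in> K" unfolding E by blast
    have "f - g \<in> K" using group_ring_keys_diff[of f g] fg unfolding K_def by blast
    then show "x - y \<in> ?E" unfolding E fg by (simp flip: to_fract_diff)
    have "f * g \<in> K" using group_ring_keys_mult[of f g] fg add unfolding K_def by blast
    then show "x * y \<in> ?E" unfolding E fg by (simp flip: to_fract_mult)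
  }
  fix x :: "('a, 'g) group_ring fract"
  obtain f g where fg: "x = Fract f g" "g \<noteq> 0" by (cases x)
  obtain \<gamma> where \<gamma>: "\<And>k. k \<in> Poly_Mapping.keys (group_ring_coeffs f) \<union>
      Poly_Mapping.keys (group_ring_coeffs g) \<Longrightarrow> \<gamma> + k \<in> \<Gamma>"
    using grading_monoid_common_shift[OF \<Gamma>, of "Poly_Mapping.keys (group_ring_coeffs f) \<union>
      Poly_Mapping.keys (group_ring_coeffs g)"] by auto
  define m :: "('a, 'g) group_ring" where "m = group_ring_monom 1 \<gamma>"
  have m: "m \<noteq> 0" by (simp add: m_def group_ring_monom_0)
  have "m * f \<in> K"
    using group_ring_keys_mult[of m f] group_ring_keys_monom[of "1 :: 'a" \<gamma>] \<gamma>
    unfolding K_def m_def by blast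
  moreover have "m * g \<in> K"
    using group_ring_keys_mult[of m g] group_ring_keys_monom[of "1 :: 'a" \<gamma>] \<gamma>
    unfolding K_def m_def by blast
  moreover have "x = to_fract (m * f) / to_fract (m * g)"
    using m by (simp add: fg(1) Fract_conv_to_fract)
  moreover have "to_fract (m * g) \<noteq> 0" using m fg(2) by simp
  ultimately show "\<exists>a\<in>?E. \<exists>b\<in>?E. b \<noteq> 0 \<and> x = a / b" unfolding E by blast
qed

lemma fract_embed_mult: "fract_embed (x * y) = fract_embed x * fract_embed y"
  by (cases x; cases y) (simp add: fract_embed_Fract group_ring_monom_mult)

lemma fract_embed_0: "fract_embed x = 0 \<longleftrightarrow> x = 0"
  by (cases x)
    (auto simp: fract_embed_Fract Zero_fract_def eq_fract group_ring_monom_0)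

lemma submodule_span_scale_subset:
  assumes "x \<noteq> 0"
  shows "submodule_span D (x *o S) \<subseteq> x *o submodule_span D S"
proof -
  let ?M = "submodule_span D S"
  have "S \<subseteq> ?M" "0 \<in> ?M" "\<And>u w. u \<in> ?M \<Longrightarrow> w \<in> ?M \<Longrightarrow> u + w \<in> ?M"
    "\<And>d u. d \<in> D \<Longrightarrow> u \<in> ?M \<Longrightarrow> d * u \<in> ?M"
    unfolding submodule_span_def by blast+
  then have "x *o S \<subseteq> x *o ?M" "0 \<in> x *o ?M" "\<forall>u\<in>x *o ?M. \<forall>w\<in>x *o ?M. u + w \<in> x *o ?M"
    "\<forall>d\<in>D. \<forall>u\<in>x *o ?M. d * u \<in> x *o ?M"
    unfolding elt_set_times_def
    by (blast, force, simp, metis distrib_left, simp, metis mult.left_commute)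
  then show ?thesis unfolding submodule_span_def[of D "x *o S"] by blast
qed

lemma scale_inverse:
  assumes "(x :: 'l::field) \<noteq> 0"
  shows "inverse x *o (x *o S) = S" "x *o (inverse x *o S) = S"
  using assms by (simp_all add: set_times_rearrange2)

lemma submodule_span_scale:
  assumes "x \<noteq> 0"
  shows "submodule_span D (x *o S) = x *o submodule_span D S"
proof
  have "submodule_span D S \<subseteq> inverse x *o submodule_span D (x *o S)"
    using submodule_span_scale_subset[of "inverse x" D "x *o S"] assms by (simp add: scale_inverse)
  then have "x *o submodule_span D S \<subseteq> x *o (inverse x *o submodule_span D (x *o S))"
    by (rule set_times_mono)
  then show "x *o submodule_span D S \<subseteq> submodule_span D (x *o S)"
    using assms by (simp add: scale_inverse)
qed (rule submodule_span_scale_subset[OF assms])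

lemma ideal_mult_scale:
  assumes "x \<noteq> 0"
  shows "ideal_mult D (x *o I) J = x *o ideal_mult D I J"
proof -
  have "(x *o I) * J = x *o (I * J)"
    by (simp add: set_times_rearrange3)
  then show ?thesis unfolding ideal_mult_def by (simp add: submodule_span_scale assms)
qed

lemma mult_scale_swap:
  fixes x y :: "'l::comm_monoid_mult"
  shows "(x *o I) * (y *o J) = ((x * y) *o I) * J"
  by (metis set_times_rearrange set_times_rearrange3)

lemma ideal_class_eq:
  "ideal_class D I = {ideal_t D (ideal_mult D (x *o D) I) | x. x \<noteq> 0}"
  unfolding ideal_class_def r_coset_def principal_ideals_def t_ideal_group_def by auto

lemma ideal_class_scale:
  assumes "y \<noteq> 0"
  shows "ideal_class D (y *o I) = ideal_class D I"
proof -
  have "ideal_mult D (x *o D) (y *o I) = ideal_mult D ((x * y) *o D) I" for x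
    unfolding ideal_mult_def by (simp add: mult_scale_swap)
  then have "ideal_class D (y *o I) = {ideal_t D (ideal_mult D ((x * y) *o D) I) | x. x \<noteq> 0}"
    unfolding ideal_class_eq by simp
  also have "\<dots> = ideal_class D I"
    unfolding ideal_class_eq
  proof safe
    fix x :: 'a assume "x \<noteq> 0"
    then show "\<exists>z. ideal_t D (ideal_mult D ((x * y) *o D) I) = ideal_t D (ideal_mult D (z *o D) I) \<and> z \<noteq> 0"
      using assms by (intro exI[of _ "x * y"]) simp
  next
    fix z :: 'a assume "z \<noteq> 0"
    then show "\<exists>x. ideal_t D (ideal_mult D (z *o D) I) = ideal_t D (ideal_mult D ((x * y) *o D) I) \<and> x \<noteq> 0"
      using assms by (intro exI[of _ "z / y"]) simp
  qed
  finally show ?thesis .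
qed

lemma ideal_colon_scale:
  assumes "x \<noteq> 0"
  shows "ideal_colon D (x *o I) = inverse x *o ideal_colon D I"
proof -
  have "z \<in> ideal_colon D (x *o I) \<longleftrightarrow> z \<in> inverse x *o ideal_colon D I" for z
  proof -
    have "z \<in> inverse x *o ideal_colon D I \<longleftrightarrow> (\<exists>w\<in>ideal_colon D I. z = inverse x * w)"
      unfolding elt_set_times_def by blast
    also have "\<dots> \<longleftrightarrow> x * z \<in> ideal_colon D I"
      using assms by (auto simp: field_simps intro!: bexI[of _ "x * z"])
    also have "\<dots> \<longleftrightarrow> z \<in> ideal_colon D (x *o I)"
      unfolding ideal_colon_def by (simp add: set_times_rearrange2 mult.commute)
    finally show ?thesis by simp
  qed
  then show ?thesis by blast
qed

lemma ideal_v_scale: "x \<noteq> 0 \<Longrightarrow> ideal_v D (x *o I) = x *o ideal_v D I"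
  by (simp add: ideal_v_def ideal_colon_scale)

lemma frac_ideal_scale:
  assumes D: "subring_with_quotient_field D" and x: "x \<noteq> 0" and I: "frac_ideal D I"
  shows "frac_ideal D (x *o I)"
proof -
  obtain a b where ab: "a \<in> D" "b \<in> D" "b \<noteq> 0" "x = a / b"
    using D unfolding subring_with_quotient_field_def by blast
  have mult: "u * w \<in> D" if "u \<in> D" "w \<in> D" for u w
    using D that unfolding subring_with_quotient_field_def by blast
  obtain d where d: "d \<in> D" "d \<noteq> 0" "d *o I \<subseteq> D" using I unfolding frac_ideal_def by blast
  have "(d * b) *o (x *o I) \<subseteq> D"
  proof
    fix z assume "z \<in> (d * b) *o (x *o I)"
    then obtain i where i: "i \<in> I" "z = d * b * (x * i)" unfolding elt_set_times_def by blast
    have "z = a * (d * i)" using ab by (simp add: i)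
    moreover have "d * i \<in> D" using d(3) i(1) unfolding elt_set_times_def by blast
    ultimately show "z \<in> D" using mult ab by simp
  qed
  moreover have "d * b \<in> D" "d * b \<noteq> 0" using mult d ab by auto
  moreover have "x *o I \<noteq> {0}"
  proof
    assume "x *o I = {0}"
    then have "inverse x *o (x *o I) = {0}" by (simp add: elt_set_times_def)
    then show False using I x by (simp add: scale_inverse frac_ideal_def)
  qed
  moreover have "0 \<in> x *o I" using I by (force simp: frac_ideal_def elt_set_times_def)
  moreover have "\<forall>u\<in>x *o I. \<forall>w\<in>x *o I. u + w \<in> x *o I"
    using I unfolding frac_ideal_def elt_set_times_def by simp (metis distrib_left)
  moreover have "\<forall>d\<in>D. \<forall>u\<in>x *o I. d * u \<in> x *o I"
    using I unfolding frac_ideal_def elt_set_times_def by simp (metis mult.left_commute)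
  ultimately show ?thesis unfolding frac_ideal_def by blast
qed

lemma fin_gen_scale:
  assumes "x \<noteq> 0" "fin_gen D F"
  shows "fin_gen D (x *o F)"
proof -
  obtain S where S: "finite S" "F = submodule_span D S" using assms(2) unfolding fin_gen_def by blast
  have "x *o S = (\<lambda>y. x * y) ` S" unfolding elt_set_times_def by blast
  then have "finite (x *o S)" using S(1) by simp
  then show ?thesis unfolding fin_gen_def S(2) submodule_span_scale[OF assms(1), symmetric] by blast
qed

lemma ideal_t_scale_subset:
  assumes D: "subring_with_quotient_field D" and x: "x \<noteq> 0"
  shows "x *o ideal_t D I \<subseteq> ideal_t D (x *o I)"
proof
  fix z assume "z \<in> x *o ideal_t D I"
  then obtain F w where F: "frac_ideal D F" "fin_gen D F" "F \<subseteq> I" "w \<in> ideal_v D F" "z = x * w"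
    unfolding ideal_t_def elt_set_times_def by blast
  have "z \<in> ideal_v D (x *o F)" using F(4,5) x by (auto simp: ideal_v_scale)
  moreover have "x *o F \<subseteq> x *o I" using F(3) by (rule set_times_mono)
  ultimately show "z \<in> ideal_t D (x *o I)"
    unfolding ideal_t_def using frac_ideal_scale[OF D x F(1)] fin_gen_scale[OF x F(2)] by blast
qed

lemma ideal_t_scale:
  assumes D: "subring_with_quotient_field D" and x: "x \<noteq> 0"
  shows "ideal_t D (x *o I) = x *o ideal_t D I"
proof
  have "inverse x *o ideal_t D (x *o I) \<subseteq> ideal_t D I"
    using ideal_t_scale_subset[OF D, of "inverse x" "x *o I"] x by (simp add: scale_inverse)
  then have "x *o (inverse x *o ideal_t D (x *o I)) \<subseteq> x *o ideal_t D I" by (rule set_times_mono)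
  then show "ideal_t D (x *o I) \<subseteq> x *o ideal_t D I" using x by (simp add: scale_inverse)
qed (rule ideal_t_scale_subset[OF D x])

lemma ideal_class_t_ideal:
  assumes D: "subring_with_quotient_field D" and J: "t_ideal D J"
  shows "ideal_class D J = {x *o J | x. x \<noteq> 0}"
proof -
  have fJ: "frac_ideal D J" and tJ: "ideal_t D J = J" using J by (simp_all add: t_ideal_def)
  have "1 \<in> D" using D by (simp add: subring_with_quotient_field_def)
  have "D * J = J"
  proof
    show "D * J \<subseteq> J" using fJ by (auto simp: frac_ideal_def elim!: set_times_elim)
    show "J \<subseteq> D * J" using set_times_intro[OF \<open>1 \<in> D\<close>] by fastforce
  qed
  moreover have "submodule_span D J = J"
    using fJ unfolding frac_ideal_def submodule_span_def by blast
  ultimately have "ideal_mult D D J = J" by (simp add: ideal_mult_def)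
  then have "ideal_t D (ideal_mult D (x *o D) J) = x *o J" if "x \<noteq> 0" for x
    using that tJ by (simp add: ideal_mult_scale ideal_t_scale[OF D])
  then show ?thesis unfolding ideal_class_eq by metis
qed

theorem canonical_map_ideal_class:
  fixes \<Gamma> :: "'g::torsion_free_ab_group_add set" and J :: "'a::idom fract set"
  assumes J: "J \<in> carrier (t_ideal_group base_ring)"
  shows "canonical_map \<Gamma> (ideal_class base_ring J) =
           ideal_class (semigroup_ring \<Gamma>) (ideal_extension \<Gamma> J)"
proof -
  let ?c = "\<lambda>J :: 'a fract set. ideal_class (semigroup_ring \<Gamma>) (ideal_extension \<Gamma> J)"
  have cls: "ideal_class base_ring J = {x *o J | x. x \<noteq> 0}"
    using J by (simp add: ideal_class_t_ideal[OF base_ring_quotient_field] t_ideal_group_def)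
  have "?c (x *o J) = ?c J" if x: "x \<noteq> 0" for x
  proof -
    let ?y = "fract_embed x :: ('a, 'g) group_ring fract"
    have y: "?y \<noteq> 0" using x by (simp add: fract_embed_0)
    have "fract_embed ` (x *o J) = ?y *o (fract_embed ` J)"
      unfolding elt_set_times_def by (force simp: fract_embed_mult)
    then have "ideal_extension \<Gamma> (x *o J) = ?y *o ideal_extension \<Gamma> J"
      unfolding ideal_extension_def by (simp add: ideal_mult_scale y)
    then show ?thesis by (simp add: ideal_class_scale y)
  qed
  moreover have "ideal_class base_ring J \<noteq> {}"
    unfolding cls by (auto intro: exI[of _ 1])
  ultimately show ?thesis
    unfolding canonical_map_def by (intro the_elem_image_unique) (auto simp: cls)
qed

end

theory Submission
  imports Defs
begin

text \<open>
  Let \<open>R = A[\<Gamma>]\<close>, let \<open>K\<close> be the quotient field of \<open>A\<close>, \<open>G\<close> the quotient group of \<open>\<Gamma>\<close>, and \<open>L\<close> the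
  quotient field of \<open>R\<close>, so that \<open>R \<subseteq> K[G] \<subseteq> L\<close>.

  The map \<open>J \<mapsto> J[\<Gamma>]\<close> always induces an injective homomorphism of class groups. Whether an element
  of \<open>K[G]\<close> multiplies a monomial into \<open>R\<close> is decided separately by its coefficients and its
  exponents, so that \<open>(R : J[Y]) = (A : J)[(\<Gamma> : Y)]\<close>, and the \<open>t\<close>-operation of \<open>R\<close> maps \<open>J[Y]\<close> to
  \<open>J\<^sub>t[Y\<^sub>t]\<close> (lemmas \<open>colon_homogeneous\<close> and \<open>t_homogeneous\<close>). If \<open>J'[Y'] = x J[Y]\<close>, then \<open>x\<close> is a
  unit of \<open>K[G]\<close>; as \<open>G\<close> can be ordered, \<open>x\<close> is a monomial, and the equation splits into
  \<open>J' = u J\<close> and \<open>Y' = h + Y\<close> (\<open>scale_graded_eq_graded\<close>). So the canonical homomorphism is an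
  isomorphism if and only if every \<open>t\<close>-invertible \<open>t\<close>-ideal of \<open>R\<close> has the form \<open>x J[\<Gamma>]\<close>
  (\<open>all_extended\<close>).

  Let \<open>A\<close> and \<open>\<Gamma>\<close> be integrally closed, and let \<open>I = F\<^sub>v\<close> be \<open>t\<close>-invertible, \<open>F\<close> finite. The group
  algebra \<open>K[G]\<close> is a GCD domain, since it is a free module over each of the Laurent polynomial
  rings of which it is the union (\<open>gcd_domain_group_algebra\<close>). After division by a greatest common
  divisor of \<open>F\<close>, the ideal \<open>(R : F)\<close> lies in \<open>K[G]\<close>. By Kronecker's theorem, \<open>f g \<in> R\<close> implies
  that all products of a homogeneous component of \<open>f\<close> with one of \<open>g\<close> lie in \<open>R\<close>: valuation rings
  containing \<open>A\<close> show it for the coefficients, total cones containing \<open>\<Gamma>\<close> for the exponents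
  (\<open>kronecker_semigroup_ring\<close>). Hence \<open>(R : F)\<close> is unchanged when \<open>F\<close> is replaced by the set of
  the homogeneous components of its elements. So \<open>I = x J[Y]\<close> with \<open>J\<close> and \<open>Y\<close> \<open>t\<close>-invertible, and
  if \<open>Cl(\<Gamma>) = 0\<close>, then \<open>Y\<close> is principal and \<open>I\<close> is extended up to a factor.

  Conversely, let every \<open>t\<close>-invertible \<open>t\<close>-ideal of \<open>R\<close> be extended up to a factor. For a
  \<open>t\<close>-invertible \<open>Y\<close> this applies to \<open>A[Y]\<close>, so that \<open>Y\<close> is principal. For integral closedness,
  let \<open>f q \<in> R\<close> with \<open>f, q \<in> K[G]\<close>, and let \<open>s\<close> be a monomial with \<open>s q \<in> R\<close>. When
  \<open>{y \<in> R. y s / f \<in> R}\<close> is \<open>t\<close>-invertible, it must be \<open>f J[\<Gamma>]\<close> up to a monomial, and as it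
  contains \<open>f q\<close>, each homogeneous component of \<open>q\<close> multiplies \<open>f\<close> into \<open>R\<close>
  (\<open>all_extended_factor\<close>). If \<open>u\<close> is a root of a monic polynomial \<open>p = (X - u) q\<close> over \<open>A\<close>, this
  is applied to \<open>p(X\<^sup>\<gamma>) = (X\<^sup>\<gamma> - u) q(X\<^sup>\<gamma>)\<close> and yields \<open>u \<in> A\<close>; if \<open>n g \<in> \<Gamma>\<close>, it is applied to
  \<open>X\<^bsup>n g\<^esup> - 1 = (X\<^sup>g - 1) (1 + X\<^sup>g + \<dots> + X\<^bsup>(n - 1) g\<^esup>)\<close> and yields \<open>g \<in> \<Gamma>\<close>.
\<close>

section \<open>Subrings of a field and their fractions\<close>

definition subring :: "'k::field set \<Rightarrow> bool" where
  "subring B \<longleftrightarrow> 1 \<in> B \<and> (\<forall>x\<in>B. \<forall>y\<in>B. x - y \<in> B \<and> x * y \<in> B)"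

lemma subringD:
  assumes "subring B"
  shows "1 \<in> B" "0 \<in> B" "x \<in> B \<Longrightarrow> y \<in> B \<Longrightarrow> x - y \<in> B" "x \<in> B \<Longrightarrow> y \<in> B \<Longrightarrow> x * y \<in> B"
    "x \<in> B \<Longrightarrow> - x \<in> B" "x \<in> B \<Longrightarrow> y \<in> B \<Longrightarrow> x + y \<in> B"
proof -
  show one: "1 \<in> B" and diff: "\<And>x y. x \<in> B \<Longrightarrow> y \<in> B \<Longrightarrow> x - y \<in> B"
    and "x \<in> B \<Longrightarrow> y \<in> B \<Longrightarrow> x * y \<in> B"
    using assms by (auto simp: subring_def)
  show zero: "0 \<in> B" using diff[OF one one] by simp
  show neg: "\<And>x. x \<in> B \<Longrightarrow> - x \<in> B" using diff[OF zero] by fastforce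
  show "x \<in> B \<Longrightarrow> y \<in> B \<Longrightarrow> x + y \<in> B" using diff[of x "- y"] neg[of y] by simp
qed

lemma subring_sum: "subring B \<Longrightarrow> (\<And>i. i \<in> I \<Longrightarrow> f i \<in> B) \<Longrightarrow> sum f I \<in> B"
  by (induction I rule: infinite_finite_induct) (auto simp: subringD)

definition fractions :: "'l::field set \<Rightarrow> 'l set" where
  "fractions D = {a / b | a b. a \<in> D \<and> b \<in> D \<and> b \<noteq> 0}"

lemma fractionsE:
  assumes "x \<in> fractions D" obtains a b where "a \<in> D" "b \<in> D" "b \<noteq> 0" "x = a / b"
  using assms unfolding fractions_def by blast

lemma fractionsI: "a \<in> D \<Longrightarrow> b \<in> D \<Longrightarrow> b \<noteq> 0 \<Longrightarrow> a / b \<in> fractions D"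
  unfolding fractions_def by blast

lemma subring_subset_fractions: "subring D \<Longrightarrow> D \<subseteq> fractions D"
  using fractionsI[of _ D 1] subringD(1) by fastforce

lemma subring_fractions:
  assumes "subring D" shows "subring (fractions D)"
  unfolding subring_def
proof (intro conjI ballI)
  show "1 \<in> fractions D" using subring_subset_fractions[OF assms] subringD(1)[OF assms] by blast
next
  fix x y assume x: "x \<in> fractions D" and y: "y \<in> fractions D"
  obtain a b where ab: "a \<in> D" "b \<in> D" "b \<noteq> 0" "x = a / b" using x by (rule fractionsE)
  obtain c d where cd: "c \<in> D" "d \<in> D" "d \<noteq> 0" "y = c / d" using y by (rule fractionsE)
  have "x - y = (a * d - c * b) / (b * d)" using ab cd by (simp add: field_simps)
  also have "\<dots> \<in> fractions D" by (intro fractionsI subringD[OF assms]) (use ab cd in auto)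
  finally show "x - y \<in> fractions D" .
  have "x * y = (a * c) / (b * d)" using ab cd by simp
  also have "\<dots> \<in> fractions D" by (intro fractionsI subringD[OF assms]) (use ab cd in auto)
  finally show "x * y \<in> fractions D" .
qed

lemma inverse_in_fractions:
  assumes "subring D" "x \<in> fractions D" shows "inverse x \<in> fractions D"
proof (cases "x = 0")
  case True
  then show ?thesis using assms by simp
next
  case False
  obtain a b where "a \<in> D" "b \<in> D" "b \<noteq> 0" "x = a / b" using assms(2) by (rule fractionsE)
  then show ?thesis using False fractionsI[of b D a] by auto
qed

lemma divide_in_fractions:
  "subring D \<Longrightarrow> x \<in> fractions D \<Longrightarrow> y \<in> fractions D \<Longrightarrow> x / y \<in> fractions D"
  unfolding divide_inverse by (intro subringD(4)[OF subring_fractions] inverse_in_fractions)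

lemma fractions_common_denominator:
  assumes D: "subring D" and "finite S" "S \<subseteq> fractions D"
  obtains m where "m \<in> D" "m \<noteq> 0" "\<And>s. s \<in> S \<Longrightarrow> m * s \<in> D"
proof -
  have "\<exists>m\<in>D. m \<noteq> 0 \<and> (\<forall>s\<in>S. m * s \<in> D)"
    using assms(2,3)
  proof (induction S)
    case empty
    then show ?case using subringD(1)[OF D] by (intro bexI[of _ 1]) auto
  next
    case (insert x S)
    then obtain m where m: "m \<in> D" "m \<noteq> 0" "\<forall>s\<in>S. m * s \<in> D" by auto
    obtain a b where ab: "a \<in> D" "b \<in> D" "b \<noteq> 0" "x = a / b"
      using insert.prems by (auto elim: fractionsE)
    have "m * b * s \<in> D" if "s \<in> insert x S" for s
    proof (cases "s = x")
      case True
      then show ?thesis using ab m subringD(4)[OF D] by simp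
    next
      case False
      then have "b * (m * s) \<in> D" using that m ab subringD(4)[OF D] by auto
      then show ?thesis by (simp add: ac_simps)
    qed
    then show ?case using m ab subringD(4)[OF D] by (intro bexI[of _ "m * b"]) auto
  qed
  then show thesis using that by blast
qed

section \<open>Divisorial closure and the t-operation\<close>

text \<open>
  The operations \<open>(D : _)\<close>, \<open>v\<close> and \<open>t\<close> of domains and of monoids depend only on the
  multiplication, and they do not change when a set is replaced by the fractional ideal that it
  generates; so they are treated together, for arbitrary sets. The non-invertible elements form
  the set \<open>Z\<close>: it is \<open>{0}\<close> for the multiplication of a field and \<open>{}\<close> for the addition of a group.
\<close>

locale divisor_system =
  fixes mul :: "'a \<Rightarrow> 'a \<Rightarrow> 'a" (infixl "\<star>" 70) and e :: 'a and Z D :: "'a set"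
  assumes assoc: "(x \<star> y) \<star> z = x \<star> (y \<star> z)"
    and comm: "x \<star> y = y \<star> x"
    and unit: "e \<star> x = x"
    and null: "x \<star> y \<in> Z \<longleftrightarrow> x \<in> Z \<or> y \<in> Z"
    and inverse_exists: "x \<notin> Z \<Longrightarrow> \<exists>y. x \<star> y = e"
    and e_not_null: "e \<notin> Z"
    and e_in: "e \<in> D"
    and mul_in: "x \<in> D \<Longrightarrow> y \<in> D \<Longrightarrow> x \<star> y \<in> D"
begin

definition colon :: "'a set \<Rightarrow> 'a set" where
  "colon S = {x. \<forall>s\<in>S. x \<star> s \<in> D}"

definition v :: "'a set \<Rightarrow> 'a set" where
  "v S = colon (colon S)"

text \<open>
  The sets \<open>F \<subseteq> Z\<close> are left out, as only nonzero fractional ideals are considered: when \<open>D\<close> is a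
  field, the divisorial closure of \<open>{0}\<close> is all of \<open>D\<close>.
\<close>

definition t :: "'a set \<Rightarrow> 'a set" where
  "t S = \<Union>{v F | F. finite F \<and> F \<subseteq> S \<and> \<not> F \<subseteq> Z}"

definition prod :: "'a set \<Rightarrow> 'a set \<Rightarrow> 'a set" where
  "prod S T = {x \<star> y | x y. x \<in> S \<and> y \<in> T}"

abbreviation scale :: "'a \<Rightarrow> 'a set \<Rightarrow> 'a set" where
  "scale a S \<equiv> (\<lambda>x. a \<star> x) ` S"

definition t_invertible :: "'a set \<Rightarrow> bool" where
  "t_invertible I \<longleftrightarrow> t I = I \<and> (\<exists>J. t J = J \<and> t (prod I J) = D)"

lemma left_comm: "x \<star> (y \<star> z) = y \<star> (x \<star> z)"
  by (metis assoc comm)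

lemmas mul_ac = assoc comm left_comm

lemma unit_right: "x \<star> e = x"
  by (metis comm unit)

lemma colonI: "(\<And>s. s \<in> S \<Longrightarrow> x \<star> s \<in> D) \<Longrightarrow> x \<in> colon S"
  and colonD: "x \<in> colon S \<Longrightarrow> s \<in> S \<Longrightarrow> x \<star> s \<in> D"
  by (simp_all add: colon_def)

lemma colon_anti: "S \<subseteq> T \<Longrightarrow> colon T \<subseteq> colon S"
  by (auto simp: colon_def)

lemma v_extensive: "S \<subseteq> v S"
  unfolding v_def colon_def using comm by fastforce

lemma v_mono: "S \<subseteq> T \<Longrightarrow> v S \<subseteq> v T"
  unfolding v_def by (intro colon_anti)

lemma colon_v: "colon (v S) = colon S"
  using v_extensive[of "colon S"] colon_anti[OF v_extensive[of S]]
    by (simp add: v_def subset_antisym)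

lemma v_idem: "v (v S) = v S"
  by (simp add: v_def[of "v S"] colon_v) (simp add: v_def)

lemma v_least: "S \<subseteq> v T \<Longrightarrow> v S \<subseteq> v T"
  using v_mono v_idem by blast

lemma v_colon: "v (colon S) = colon S"
  by (metis colon_v v_def)

lemma v_cong: "colon S = colon T \<Longrightarrow> v S = v T"
  by (simp add: v_def)

lemma colon_mult: "x \<in> colon S \<Longrightarrow> d \<in> D \<Longrightarrow> x \<star> d \<in> colon S"
proof (rule colonI)
  fix s assume "x \<in> colon S" "d \<in> D" "s \<in> S"
  then have "d \<star> (x \<star> s) \<in> D" by (intro mul_in colonD)
  then show "x \<star> d \<star> s \<in> D" by (simp add: mul_ac)
qed

lemma v_mult: "x \<in> v S \<Longrightarrow> d \<in> D \<Longrightarrow> x \<star> d \<in> v S"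
  unfolding v_def by (rule colon_mult)

lemma colon_D: "colon D = D"
  unfolding colon_def using mul_in e_in unit_right by fastforce

lemma v_D: "v D = D"
  by (simp add: v_def colon_D)

lemma prodI: "x \<in> S \<Longrightarrow> y \<in> T \<Longrightarrow> x \<star> y \<in> prod S T"
  by (auto simp: prod_def)

lemma prod_mono: "S \<subseteq> S' \<Longrightarrow> T \<subseteq> T' \<Longrightarrow> prod S T \<subseteq> prod S' T'"
  by (auto simp: prod_def)

lemma prod_comm: "prod S T = prod T S"
  unfolding prod_def using comm by blast

lemma prod_assoc: "prod (prod S T) U = prod S (prod T U)"
proof (intro subset_antisym subsetI)
  fix w assume "w \<in> prod (prod S T) U"
  then obtain x y z where "w = (x \<star> y) \<star> z" "x \<in> S" "y \<in> T" "z \<in> U" by (auto simp: prod_def)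
  then show "w \<in> prod S (prod T U)" by (simp add: assoc prodI)
next
  fix w assume "w \<in> prod S (prod T U)"
  then obtain x y z where "w = x \<star> (y \<star> z)" "x \<in> S" "y \<in> T" "z \<in> U" by (auto simp: prod_def)
  then show "w \<in> prod (prod S T) U" by (simp add: assoc[symmetric] prodI)
qed

lemma prod_left_comm: "prod S (prod T U) = prod T (prod S U)"
  by (metis prod_assoc prod_comm)

lemma scale_eq_prod: "scale a S = prod {a} S"
  by (auto simp: prod_def)

lemma prod_scale: "prod (scale a S) (scale b T) = scale (a \<star> b) (prod S T)"
proof -
  have "prod {a} {b} = {a \<star> b}" by (auto simp: prod_def)
  then show ?thesis unfolding scale_eq_prod by (metis prod_assoc prod_left_comm)
qed

lemma prod_v_subset: "prod (v S) T \<subseteq> v (prod S T)"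
proof
  fix x assume "x \<in> prod (v S) T"
  then obtain a b where ab: "x = a \<star> b" "a \<in> v S" "b \<in> T" by (auto simp: prod_def)
  show "x \<in> v (prod S T)"
    unfolding v_def
  proof (rule colonI)
    fix z assume z: "z \<in> colon (prod S T)"
    have "b \<star> z \<in> colon S"
    proof (rule colonI)
      fix s assume "s \<in> S"
      then have "z \<star> (s \<star> b) \<in> D" using z ab by (intro colonD[OF z] prodI)
      then show "b \<star> z \<star> s \<in> D" by (simp add: mul_ac)
    qed
    then have "a \<star> (b \<star> z) \<in> D" using ab(2) colonD unfolding v_def by blast
    then show "x \<star> z \<in> D" by (simp add: ab assoc)
  qed
qed

lemma t_mono: "S \<subseteq> T \<Longrightarrow> t S \<subseteq> t T"
  unfolding t_def by blast

lemma tI: "x \<in> v F \<Longrightarrow> finite F \<Longrightarrow> F \<subseteq> S \<Longrightarrow> \<not> F \<subseteq> Z \<Longrightarrow> x \<in> t S"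
  unfolding t_def by blast

lemma tE:
  assumes "x \<in> t S"
  obtains F where "finite F" "F \<subseteq> S" "\<not> F \<subseteq> Z" "x \<in> v F"
  using assms unfolding t_def by blast

lemma t_null: "S \<subseteq> Z \<Longrightarrow> t S = {}"
  unfolding t_def by blast

lemma t_extensive: "\<not> S \<subseteq> Z \<Longrightarrow> S \<subseteq> t S"
proof
  fix x assume "\<not> S \<subseteq> Z" "x \<in> S"
  then obtain s where s: "s \<in> S" "s \<notin> Z" by blast
  show "x \<in> t S"
    using s \<open>x \<in> S\<close> v_extensive[of "{x, s}"] by (intro tI[of x "{x, s}"]) auto
qed

lemma t_subset_v: "t S \<subseteq> v S"
  unfolding t_def using v_mono by blast

lemma t_finite: "finite F \<Longrightarrow> \<not> F \<subseteq> Z \<Longrightarrow> t F = v F"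
  using t_subset_v tI by blast

lemma t_v: "\<not> v S \<subseteq> Z \<Longrightarrow> t (v S) = v S"
  using t_extensive[of "v S"] t_subset_v[of "v S"] v_idem by blast

text \<open>
  The sets \<open>v F'\<close>, for finite \<open>F' \<subseteq> S\<close>, form a directed family with union \<open>t S\<close>.
\<close>

lemma finite_subset_t:
  assumes "finite F" "F \<subseteq> t S" "\<not> S \<subseteq> Z"
  obtains F' where "finite F'" "F' \<subseteq> S" "\<not> F' \<subseteq> Z" "F \<subseteq> v F'"
proof -
  have "\<exists>F'. finite F' \<and> F' \<subseteq> S \<and> \<not> F' \<subseteq> Z \<and> F \<subseteq> v F'"
    using assms(1,2)
  proof (induction F rule: finite_induct)
    case empty
    obtain s where "s \<in> S" "s \<notin> Z" using assms(3) by blast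
    then show ?case by (intro exI[of _ "{s}"]) auto
  next
    case (insert x F)
    then obtain F' where F': "finite F'" "F' \<subseteq> S" "\<not> F' \<subseteq> Z" "F \<subseteq> v F'" by auto
    obtain H where H: "finite H" "H \<subseteq> S" "\<not> H \<subseteq> Z" "x \<in> v H"
      using insert.prems by (meson insert_subset tE)
    have "v F' \<subseteq> v (F' \<union> H)" "v H \<subseteq> v (F' \<union> H)" by (simp_all add: v_mono)
    then show ?case using F' H by (intro exI[of _ "F' \<union> H"]) blast
  qed
  then show thesis using that by blast
qed

lemma t_least:
  assumes "S \<subseteq> t T" shows "t S \<subseteq> t T"
proof
  fix x assume "x \<in> t S"
  then obtain F where F: "finite F" "F \<subseteq> S" "\<not> F \<subseteq> Z" "x \<in> v F" by (rule tE)
  have "\<not> T \<subseteq> Z" using F assms t_null by blast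
  then obtain F' where F': "finite F'" "F' \<subseteq> T" "\<not> F' \<subseteq> Z" "F \<subseteq> v F'"
    using finite_subset_t[OF F(1)] F(2) assms by (metis subset_trans)
  then show "x \<in> t T" using v_least[OF F'(4)] F(4) by (intro tI[of x F']) auto
qed

lemma t_idem: "t (t S) = t S"
proof (cases "S \<subseteq> Z")
  case False
  then show ?thesis using t_least[of "t S" S] t_extensive[OF False] t_mono by blast
qed (simp add: t_null)

lemma t_sandwich: "S \<subseteq> T \<Longrightarrow> T \<subseteq> t S \<Longrightarrow> t T = t S"
  by (simp add: subset_antisym t_least t_mono)

lemma t_mult: "x \<in> t S \<Longrightarrow> d \<in> D \<Longrightarrow> x \<star> d \<in> t S"
  unfolding t_def using v_mult by blast

lemma t_D: "t D = D"
  using t_extensive[of D] t_subset_v[of D] v_D e_in e_not_null by blast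

lemma prod_null: "prod S T \<subseteq> Z \<longleftrightarrow> S \<subseteq> Z \<or> T \<subseteq> Z"
  unfolding prod_def using null by blast

lemma finite_prod: "finite S \<Longrightarrow> finite T \<Longrightarrow> finite (prod S T)"
  unfolding prod_def by (rule finite_image_set2) auto

lemma prod_t_subset:
  assumes "\<not> T \<subseteq> Z" shows "prod (t S) T \<subseteq> t (prod S T)"
proof
  fix x assume "x \<in> prod (t S) T"
  then obtain a b where ab: "x = a \<star> b" "a \<in> t S" "b \<in> T" by (auto simp: prod_def)
  obtain F where F: "finite F" "F \<subseteq> S" "\<not> F \<subseteq> Z" "a \<in> v F" using ab(2) by (rule tE)
  obtain c where c: "c \<in> T" "c \<notin> Z" using assms by blast
  have "x \<in> v (prod F {b, c})"
    using prod_v_subset[of F "{b, c}"] F(4) by (auto simp: ab intro: prodI)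
  then show "x \<in> t (prod S T)"
    using F ab c by (intro tI[of x "prod F {b, c}"] finite_prod prod_mono) (auto simp: prod_null)
qed

lemma t_prod: "t (prod (t S) T) = t (prod S T)"
proof (cases "S \<subseteq> Z \<or> T \<subseteq> Z")
  case True
  then have "prod (t S) T \<subseteq> Z" "prod S T \<subseteq> Z" using t_null[of S] by (auto simp: prod_null)
  then show ?thesis by (simp add: t_null)
next
  case False
  then show ?thesis
    by (intro t_sandwich prod_mono t_extensive prod_t_subset) auto
qed

lemma t_prod_t: "t (prod (t S) (t T)) = t (prod S T)"
  by (metis prod_comm t_prod)

lemma scale_colon:
  assumes "a \<star> b = e" shows "colon (scale a S) = scale b (colon S)"
proof
  show "colon (scale a S) \<subseteq> scale b (colon S)"
  proof
    fix x assume x: "x \<in> colon (scale a S)"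
    have "x \<star> a \<in> colon S" using x by (auto intro!: colonI dest: colonD simp: assoc)
    moreover have "x = b \<star> (x \<star> a)" using assms by (metis comm left_comm unit_right)
    ultimately show "x \<in> scale b (colon S)" by blast
  qed
  show "scale b (colon S) \<subseteq> colon (scale a S)"
  proof (clarify intro!: colonI)
    fix x s assume "x \<in> colon S" "s \<in> S"
    then have "x \<star> s \<in> D" by (rule colonD)
    moreover have "b \<star> x \<star> (a \<star> s) = x \<star> s" using assms by (metis assoc comm unit)
    ultimately show "b \<star> x \<star> (a \<star> s) \<in> D" by simp
  qed
qed

lemma scale_v: "a \<notin> Z \<Longrightarrow> v (scale a S) = scale a (v S)"
  unfolding v_def using inverse_exists scale_colon by (metis comm)

lemma scale_null: "a \<notin> Z \<Longrightarrow> scale a S \<subseteq> Z \<longleftrightarrow> S \<subseteq> Z"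
  using null by auto

lemma scale_t:
  assumes a: "a \<notin> Z" shows "t (scale a S) = scale a (t S)"
proof
  show "scale a (t S) \<subseteq> t (scale a S)"
  proof clarify
    fix x assume "x \<in> t S"
    then obtain F where F: "finite F" "F \<subseteq> S" "\<not> F \<subseteq> Z" "x \<in> v F" by (rule tE)
    then show "a \<star> x \<in> t (scale a S)"
      using scale_v[OF a, of F] scale_null[OF a, of F] by (intro tI[of _ "scale a F"]) auto
  qed
  show "t (scale a S) \<subseteq> scale a (t S)"
  proof
    fix x assume "x \<in> t (scale a S)"
    then obtain F where F: "finite F" "F \<subseteq> scale a S" "\<not> F \<subseteq> Z" "x \<in> v F" by (rule tE)
    then obtain H where H: "H \<subseteq> S" "finite H" "F = scale a H" by (meson finite_subset_image)
    then obtain y where "x = a \<star> y" "y \<in> v H" using F(4) scale_v[OF a, of H] by auto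
    moreover have "\<not> H \<subseteq> Z" using F(3) H(3) scale_null[OF a] by simp
    ultimately show "x \<in> scale a (t S)" using H tI by blast
  qed
qed

lemma t_invertible_closed: "t_invertible I \<Longrightarrow> t I = I"
  by (simp add: t_invertible_def)

lemma t_invertible_not_null: "t_invertible I \<Longrightarrow> \<not> I \<subseteq> Z"
  using e_in t_null[of I] t_null[of "prod I _"] prod_null[of I]
  unfolding t_invertible_def by (metis empty_iff)

lemma prod_D_D: "prod D D = D"
proof
  show "prod D D \<subseteq> D" unfolding prod_def using mul_in by blast
  show "D \<subseteq> prod D D" using prodI[OF e_in] unit by fastforce
qed

lemma t_invertible_D: "t_invertible D"
proof -
  have "t (prod D D) = D" by (simp add: prod_D_D t_D)
  then show ?thesis unfolding t_invertible_def using t_D by blast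
qed

lemma t_invertible_prod:
  assumes "t_invertible I" "t_invertible J"
  shows "t_invertible (t (prod I J))"
proof -
  obtain I' J' where I': "t I' = I'" "t (prod I I') = D" and J': "t J' = J'" "t (prod J J') = D"
    using assms unfolding t_invertible_def by blast
  have "t (prod (t (prod I J)) (t (prod I' J'))) = t (prod (prod I I') (prod J J'))"
    unfolding t_prod_t by (metis prod_assoc prod_left_comm)
  also have "\<dots> = t (prod D D)" by (metis I'(2) J'(2) t_prod_t)
  also have "\<dots> = D" by (simp add: prod_D_D t_D)
  finally show ?thesis unfolding t_invertible_def using t_idem by blast
qed

lemma t_invertible_scale:
  assumes "t_invertible I" "a \<notin> Z" shows "t_invertible (scale a I)"
proof -
  obtain J where J: "t I = I" "t J = J" "t (prod I J) = D"
    using assms unfolding t_invertible_def by blast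
  obtain b where b: "a \<star> b = e" using inverse_exists assms by blast
  then have "b \<notin> Z" using e_not_null null by metis
  moreover have "prod (scale a I) (scale b J) = prod I J"
    unfolding prod_scale by (simp add: b unit)
  ultimately show ?thesis
    unfolding t_invertible_def using J assms by (auto simp: scale_t intro!: exI[of _ "scale b J"])
qed

lemma prod_colon_subset: "prod I (colon I) \<subseteq> D"
proof
  fix w assume "w \<in> prod I (colon I)"
  then obtain x y where "w = x \<star> y" "x \<in> I" "y \<in> colon I" by (auto simp: prod_def)
  then show "w \<in> D" using colonD[of y I x] by (simp add: comm)
qed

text \<open>
  A \<open>t\<close>-inverse \<open>J\<close> of \<open>I\<close> satisfies \<open>prod I J \<subseteq> D\<close>, so that it is contained in \<open>colon I\<close>, and
  \<open>prod I (colon I)\<close> lies between \<open>prod I J\<close> and \<open>D\<close>.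
\<close>

lemma t_invertible_colon:
  assumes "t_invertible I"
  shows "\<not> colon I \<subseteq> Z" "t (prod I (colon I)) = D"
proof -
  obtain J where J: "t I = I" "t J = J" "t (prod I J) = D"
    using assms unfolding t_invertible_def by blast
  have nz: "\<not> prod I J \<subseteq> Z" using J(3) e_in t_null[of "prod I J"] by auto
  then have "prod I J \<subseteq> D" using t_extensive[OF nz] J(3) by simp
  have "\<not> J \<subseteq> Z" using nz by (simp add: prod_null)
  have "J \<subseteq> colon I"
  proof (clarify intro!: colonI)
    fix y x assume "y \<in> J" "x \<in> I"
    then have "x \<star> y \<in> prod I J" by (intro prodI)
    then show "y \<star> x \<in> D" using \<open>prod I J \<subseteq> D\<close> by (auto simp: comm[of y x])
  qed
  then show "\<not> colon I \<subseteq> Z" using \<open>\<not> J \<subseteq> Z\<close> by blast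
  have "t (prod I (colon I)) \<subseteq> D" using t_mono[OF prod_colon_subset] t_D by simp
  moreover have "D \<subseteq> t (prod I (colon I))"
    using J(3) t_mono[OF prod_mono[OF order_refl \<open>J \<subseteq> colon I\<close>]] by blast
  ultimately show "t (prod I (colon I)) = D" by blast
qed

lemma t_invertibleI:
  assumes "t I = I" "\<not> colon I \<subseteq> Z" "e \<in> t (prod I (colon I))"
  shows "t_invertible I"
proof -
  have "t (colon I) = colon I" using t_v[of "colon I"] assms(2) by (simp add: v_colon)
  moreover have "t (prod I (colon I)) \<subseteq> D" using t_mono[OF prod_colon_subset] t_D by simp
  moreover have "D \<subseteq> t (prod I (colon I))" using t_mult[OF assms(3)] unit by fastforce
  ultimately show ?thesis unfolding t_invertible_def using assms(1) by blast
qed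

text \<open>
  The unit \<open>e\<close> lies in the divisorial closure of finitely many products of elements of \<open>I\<close> and of
  \<open>colon I\<close>; the factors from \<open>I\<close> that occur in them generate \<open>I\<close> as a divisorial ideal.
\<close>

lemma t_invertible_finite_type:
  assumes "t_invertible I"
  obtains S where "finite S" "\<not> S \<subseteq> Z" "S \<subseteq> I" "I = v S"
proof -
  have tI: "t I = I" and tD: "t (prod I (colon I)) = D"
    using assms t_invertible_closed t_invertible_colon by auto
  then have "e \<in> t (prod I (colon I))" using e_in by simp
  then obtain F where F: "finite F" "F \<subseteq> prod I (colon I)" "\<not> F \<subseteq> Z" "e \<in> v F" by (rule tE)
  have "F \<subseteq> (\<lambda>(x, y). x \<star> y) ` (I \<times> colon I)" using F(2) by (auto simp: prod_def)
  then obtain P where P: "P \<subseteq> I \<times> colon I" "finite P" "F = (\<lambda>(x, y). x \<star> y) ` P"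
    by (meson F(1) finite_subset_image)
  define S where "S = fst ` P"
  have FS: "F \<subseteq> prod S (snd ` P)" unfolding P(3) S_def prod_def by force
  have S: "finite S" "S \<subseteq> I" using P by (auto simp: S_def)
  have nz: "\<not> S \<subseteq> Z" using FS F(3) prod_null by blast
  have "v S \<subseteq> I" using S nz tI by (metis t_finite t_mono)
  moreover have "I \<subseteq> v S"
  proof
    fix x assume x: "x \<in> I"
    show "x \<in> v S"
      unfolding v_def
    proof (rule colonI)
      fix z assume z: "z \<in> colon S"
      have "x \<star> z \<in> colon F"
      proof (rule colonI)
        fix f assume "f \<in> F"
        then obtain s y where P': "(s, y) \<in> P" and "f = s \<star> y" unfolding P(3) by auto
        then have sy: "f = s \<star> y" "s \<in> S" "y \<in> colon I" using P(1) unfolding S_def by force+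
        have "(z \<star> s) \<star> (y \<star> x) \<in> D" by (intro mul_in colonD[OF z] colonD[OF sy(3)] sy x)
        then show "x \<star> z \<star> f \<in> D" by (simp add: sy mul_ac)
      qed
      then have "e \<star> (x \<star> z) \<in> D" using F(4) colonD unfolding v_def by blast
      then show "x \<star> z \<in> D" by (simp add: unit)
    qed
  qed
  ultimately show thesis using that S nz by blast
qed

end

section \<open>The t-operations of domains and of monoids\<close>

locale fraction_domain =
  fixes D :: "'l::field set"
  assumes quotient_field: "subring_with_quotient_field D"
begin

lemma one_in: "1 \<in> D" and diff_in: "x \<in> D \<Longrightarrow> y \<in> D \<Longrightarrow> x - y \<in> D"
  and mult_in: "x \<in> D \<Longrightarrow> y \<in> D \<Longrightarrow> x * y \<in> D"
  using quotient_field by (auto simp: subring_with_quotient_field_def)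

lemma quotientE: obtains a b where "a \<in> D" "b \<in> D" "b \<noteq> 0" "x = a / b"
  using quotient_field unfolding subring_with_quotient_field_def by blast

lemma zero_in: "0 \<in> D"
  using diff_in[OF one_in one_in] by simp

lemma add_in: "x \<in> D \<Longrightarrow> y \<in> D \<Longrightarrow> x + y \<in> D"
  using diff_in[of x "0 - y"] diff_in[OF zero_in] by simp

sublocale divisor_system "(*)" "1 :: 'l" "{0}" D
proof
  fix x :: 'l assume "x \<notin> {0}"
  then show "\<exists>y. x * y = 1" by (intro exI[of _ "inverse x"]) simp
qed (auto simp: one_in mult_in)

lemma elt_set_times_eq: "a *o S = scale a S"
  by (auto simp: elt_set_times_def)

lemma set_times_eq: "S * T = prod S T"
  by (auto simp: prod_def set_times_def)

lemma ideal_colon_eq: "ideal_colon D S = colon S"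
  by (auto simp: ideal_colon_def colon_def elt_set_times_def)

lemma ideal_v_eq: "ideal_v D S = v S"
  by (simp add: ideal_v_def v_def ideal_colon_eq)

definition submodule :: "'l set \<Rightarrow> bool" where
  "submodule M \<longleftrightarrow> 0 \<in> M \<and> (\<forall>x\<in>M. \<forall>y\<in>M. x + y \<in> M) \<and> (\<forall>d\<in>D. \<forall>x\<in>M. d * x \<in> M)"

lemma submoduleD:
  assumes "submodule M"
  shows "0 \<in> M" "x \<in> M \<Longrightarrow> y \<in> M \<Longrightarrow> x + y \<in> M" "d \<in> D \<Longrightarrow> x \<in> M \<Longrightarrow> d * x \<in> M"
  using assms by (auto simp: submodule_def)

lemma submodule_sum: "submodule M \<Longrightarrow> (\<And>i. i \<in> I \<Longrightarrow> f i \<in> M) \<Longrightarrow> sum f I \<in> M"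
  by (induction I rule: infinite_finite_induct) (auto simp: submoduleD)

lemma span_eq: "submodule_span D S = \<Inter>{M. S \<subseteq> M \<and> submodule M}"
  unfolding submodule_span_def submodule_def by simp

lemma span_superset: "S \<subseteq> submodule_span D S"
  and span_least: "S \<subseteq> M \<Longrightarrow> submodule M \<Longrightarrow> submodule_span D S \<subseteq> M"
  unfolding span_eq by auto

lemma submodule_span: "submodule (submodule_span D S)"
  unfolding span_eq submodule_def by blast

lemma span_mono: "S \<subseteq> T \<Longrightarrow> submodule_span D S \<subseteq> submodule_span D T"
  by (meson order_trans span_least span_superset submodule_span)

lemma span_submodule: "submodule M \<Longrightarrow> submodule_span D M = M"
  by (simp add: span_least span_superset subset_antisym)

lemma submodule_colon: "submodule (colon S)"
  unfolding submodule_def colon_def by (auto simp: zero_in add_in mult_in algebra_simps)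

lemma submodule_v: "submodule (v S)"
  unfolding v_def by (rule submodule_colon)

lemma span_subset_v: "submodule_span D S \<subseteq> v S"
  by (intro span_least v_extensive submodule_v)

lemma v_span: "v (submodule_span D S) = v S"
  by (intro subset_antisym v_least span_subset_v v_mono span_superset)

lemma submodule_directed_union:
  assumes "\<F> \<noteq> {}" "\<And>M. M \<in> \<F> \<Longrightarrow> submodule M"
    and "\<And>M N. M \<in> \<F> \<Longrightarrow> N \<in> \<F> \<Longrightarrow> \<exists>P\<in>\<F>. M \<union> N \<subseteq> P"
  shows "submodule (\<Union>\<F>)"
proof -
  have "x + y \<in> \<Union>\<F>" if "x \<in> \<Union>\<F>" "y \<in> \<Union>\<F>" for x y
  proof -
    obtain M N where MN: "M \<in> \<F>" "N \<in> \<F>" "x \<in> M" "y \<in> N" using \<open>x \<in> \<Union>\<F>\<close> \<open>y \<in> \<Union>\<F>\<close> by blast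
    then obtain P where "P \<in> \<F>" "x \<in> P" "y \<in> P" using assms(3)[of M N] by blast
    then show ?thesis using assms(2) submoduleD(2) by blast
  qed
  moreover have "0 \<in> \<Union>\<F>" using assms(1,2) submoduleD(1) by blast
  moreover have "d * x \<in> \<Union>\<F>" if "d \<in> D" "x \<in> \<Union>\<F>" for d x
    using assms(2) submoduleD(3)[OF _ that(1)] that(2) by blast
  ultimately show ?thesis unfolding submodule_def by blast
qed

lemma submodule_t:
  assumes "\<not> S \<subseteq> {0}" shows "submodule (t S)"
  unfolding t_def
proof (rule submodule_directed_union)
  obtain s where "s \<in> S" "s \<noteq> 0" using assms by auto
  then have "v {s} \<in> {v F |F. finite F \<and> F \<subseteq> S \<and> \<not> F \<subseteq> {0}}" by blast
  then show "{v F |F. finite F \<and> F \<subseteq> S \<and> \<not> F \<subseteq> {0}} \<noteq> {}" by blast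
next
  fix M assume "M \<in> {v F |F. finite F \<and> F \<subseteq> S \<and> \<not> F \<subseteq> {0}}"
  then show "submodule M" using submodule_v by blast
next
  fix M N assume "M \<in> {v F |F. finite F \<and> F \<subseteq> S \<and> \<not> F \<subseteq> {0}}"
    "N \<in> {v F |F. finite F \<and> F \<subseteq> S \<and> \<not> F \<subseteq> {0}}"
  then obtain F H where FH: "M = v F" "N = v H" "finite F" "finite H" "F \<subseteq> S" "H \<subseteq> S" "\<not> F \<subseteq> {0}"
    by blast
  then have "M \<union> N \<subseteq> v (F \<union> H)" using v_mono[of F "F \<union> H"] v_mono[of H "F \<union> H"] by auto
  moreover have "finite (F \<union> H)" "F \<union> H \<subseteq> S" "\<not> F \<union> H \<subseteq> {0}" using FH by auto
  ultimately show "\<exists>P\<in>{v F |F. finite F \<and> F \<subseteq> S \<and> \<not> F \<subseteq> {0}}. M \<union> N \<subseteq> P" by blast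
qed

lemma subring_D: "subring D"
  unfolding subring_def by (simp add: one_in diff_in mult_in)

lemma fractions_D: "fractions D = UNIV"
  using quotient_field unfolding subring_with_quotient_field_def fractions_def by blast

lemma common_denominator:
  assumes "finite F"
  obtains d where "d \<in> D" "d \<noteq> 0" "\<And>x. x \<in> F \<Longrightarrow> d * x \<in> D"
  by (rule fractions_common_denominator[OF subring_D assms]) (auto simp: fractions_D)

lemma frac_ideal_span:
  assumes "finite S" "\<not> S \<subseteq> {0}"
  shows "frac_ideal D (submodule_span D S)"
proof -
  obtain d where d: "d \<in> D" "d \<noteq> 0" "\<And>x. x \<in> S \<Longrightarrow> d * x \<in> D"
    using common_denominator[OF assms(1)] by blast
  have "d \<in> colon S" using d(3) by (auto intro: colonI)
  then have "d \<in> colon (submodule_span D S)" by (metis colon_v v_span)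
  then have "d *o submodule_span D S \<subseteq> D" by (auto simp: elt_set_times_def colon_def)
  moreover have "submodule_span D S \<noteq> {0}" using assms(2) span_superset[of S] by auto
  ultimately show ?thesis
    using submodule_span[of S] d(1,2) unfolding frac_ideal_def submodule_def by blast
qed

text \<open>
  The spans of the finite subsets of \<open>S\<close> form a directed family, so that their union is a
  submodule.
\<close>

lemma finite_subset_span:
  assumes "finite T" "T \<subseteq> submodule_span D S"
  obtains F where "finite F" "F \<subseteq> S" "T \<subseteq> submodule_span D F"
proof -
  let ?\<F> = "{submodule_span D F |F. finite F \<and> F \<subseteq> S}"
  have dir: "\<exists>P\<in>?\<F>. M \<union> N \<subseteq> P" if MN: "M \<in> ?\<F>" "N \<in> ?\<F>" for M N
  proof -
    obtain F H where "M = submodule_span D F" "N = submodule_span D H"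
      "finite F" "finite H" "F \<subseteq> S" "H \<subseteq> S" using MN by blast
    then show ?thesis using span_mono[of F "F \<union> H"] span_mono[of H "F \<union> H"]
      by (intro bexI[of _ "submodule_span D (F \<union> H)"]) auto
  qed
  have "submodule (\<Union>?\<F>)"
    using dir submodule_span by (intro submodule_directed_union) blast+
  moreover have "S \<subseteq> \<Union>?\<F>"
  proof
    fix s assume "s \<in> S"
    then have "submodule_span D {s} \<in> ?\<F>" "s \<in> submodule_span D {s}" using span_superset by blast+
    then show "s \<in> \<Union>?\<F>" by blast
  qed
  ultimately have sub: "submodule_span D S \<subseteq> \<Union>?\<F>" by (intro span_least)
  have "\<exists>F. finite F \<and> F \<subseteq> S \<and> T \<subseteq> submodule_span D F"
    using assms
  proof (induction T)
    case empty
    then show ?case by blast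
  next
    case (insert x T)
    then obtain F where F: "finite F" "F \<subseteq> S" "T \<subseteq> submodule_span D F" by blast
    obtain H where H: "finite H" "H \<subseteq> S" "x \<in> submodule_span D H" using sub insert.prems by blast
    show ?case
      using F H span_mono[of F "F \<union> H"] span_mono[of H "F \<union> H"] by (intro exI[of _ "F \<union> H"]) auto
  qed
  then show thesis using that by blast
qed

lemma ideal_t_span: "ideal_t D (submodule_span D S) = t S"
proof
  show "t S \<subseteq> ideal_t D (submodule_span D S)"
  proof
    fix x assume "x \<in> t S"
    then obtain F where F: "finite F" "F \<subseteq> S" "\<not> F \<subseteq> {0}" "x \<in> v F" by (rule tE)
    then have "x \<in> ideal_v D (submodule_span D F)" by (simp add: ideal_v_eq v_span)
    moreover have "fin_gen D (submodule_span D F)" using F(1) unfolding fin_gen_def by blast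
    ultimately show "x \<in> ideal_t D (submodule_span D S)"
      unfolding ideal_t_def using frac_ideal_span[OF F(1,3)] span_mono[OF F(2)] by blast
  qed
  show "ideal_t D (submodule_span D S) \<subseteq> t S"
  proof
    fix x assume "x \<in> ideal_t D (submodule_span D S)"
    then obtain T where T: "finite T" "frac_ideal D (submodule_span D T)"
      "submodule_span D T \<subseteq> submodule_span D S" "x \<in> ideal_v D (submodule_span D T)"
      unfolding ideal_t_def fin_gen_def by blast
    obtain F where F: "finite F" "F \<subseteq> S" "T \<subseteq> submodule_span D F"
      using finite_subset_span[OF T(1)] T(3) span_superset by (metis subset_trans)
    have "\<not> F \<subseteq> {0}"
    proof
      assume "F \<subseteq> {0}"
      then have "submodule_span D F \<subseteq> {0}"
        by (intro span_least) (auto simp: submodule_def)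
      then have "submodule_span D T \<subseteq> {0}"
        using F(3) by (intro span_least) (auto simp: submodule_def)
      then show False using T(2) unfolding frac_ideal_def by blast
    qed
    moreover have "v T \<subseteq> v F" using F(3) span_subset_v by (intro v_least) blast
    then have "x \<in> v F" using T(4) by (auto simp: ideal_v_eq v_span)
    ultimately show "x \<in> t S" using F by (intro tI)
  qed
qed

lemma ideal_t_submodule: "submodule I \<Longrightarrow> ideal_t D I = t I"
  using ideal_t_span[of I] by (simp add: span_submodule)

lemma ideal_t_mult: "ideal_t D (ideal_mult D I J) = t (prod I J)"
  by (simp add: ideal_mult_def ideal_t_span set_times_eq)

lemma t_closed_submodule: "t I = I \<Longrightarrow> \<not> I \<subseteq> {0} \<Longrightarrow> submodule I"
  using submodule_t by metis

lemma t_invertible_submodule: "t_invertible I \<Longrightarrow> submodule I"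
  by (intro t_closed_submodule t_invertible_closed t_invertible_not_null)

lemma t_ideal_closed: "t_ideal D I \<Longrightarrow> t I = I"
  by (metis frac_ideal_def ideal_t_submodule submodule_def t_ideal_def)

text \<open>
  A common denominator for \<open>I\<close> comes from any nonzero element of its \<open>t\<close>-inverse.
\<close>

lemma t_idealI:
  assumes "t I = I" "t J = J" "t (prod I J) = D" shows "t_ideal D I"
proof -
  have "\<not> prod I J \<subseteq> {0}" using assms(3) one_in t_null[of "prod I J"] by auto
  then have nz: "\<not> I \<subseteq> {0}" "\<not> J \<subseteq> {0}" by (simp_all add: prod_null)
  have sub: "prod I J \<subseteq> D" using t_extensive[OF \<open>\<not> prod I J \<subseteq> {0}\<close>] assms(3) by simp
  obtain y where y: "y \<in> J" "y \<noteq> 0" using nz by auto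
  obtain a b where ab: "a \<in> D" "b \<in> D" "b \<noteq> 0" "y = a / b" by (rule quotientE)
  have "a * x \<in> D" if "x \<in> I" for x
  proof -
    have "x * y \<in> D" using sub prodI[OF that y(1)] by blast
    then have "b * (x * y) \<in> D" using ab mult_in by blast
    then show ?thesis using ab by (simp add: mult.commute)
  qed
  then have "a *o I \<subseteq> D" by (auto simp: elt_set_times_def)
  moreover have "a \<noteq> 0" using y ab by auto
  moreover have sm: "submodule I" by (rule t_closed_submodule) fact+
  ultimately have "frac_ideal D I"
    using nz ab unfolding frac_ideal_def submodule_def by blast
  then show ?thesis unfolding t_ideal_def using assms(1) sm ideal_t_submodule by simp
qed

lemma carrier_t_ideal_group: "carrier (t_ideal_group D) = {I. t_invertible I}"
proof (intro subset_antisym subsetI)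
  fix I assume "I \<in> carrier (t_ideal_group D)"
  then show "I \<in> {I. t_invertible I}"
    using t_ideal_closed unfolding t_ideal_group_def t_invertible_def by (auto simp: ideal_t_mult)
next
  fix I assume "I \<in> {I. t_invertible I}"
  then obtain J where J: "t I = I" "t J = J" "t (prod I J) = D" unfolding t_invertible_def by blast
  then have "t (prod J I) = D" by (simp add: prod_comm)
  then show "I \<in> carrier (t_ideal_group D)"
    unfolding t_ideal_group_def
      using J t_idealI[OF J] t_idealI[OF J(2,1)] by (auto simp: ideal_t_mult)
qed

lemma mult_t_ideal_group: "I \<otimes>\<^bsub>t_ideal_group D\<^esub> J = t (prod I J)"
  by (simp add: t_ideal_group_def ideal_t_mult)

lemma class_eq:
  assumes "t_invertible I" shows "ideal_class D I = {scale x I | x. x \<noteq> 0}"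
proof -
  have "I \<in> carrier (t_ideal_group D)" using assms by (simp add: carrier_t_ideal_group)
  then have "t_ideal D I" by (simp add: t_ideal_group_def)
  then show ?thesis using ideal_class_t_ideal[OF quotient_field] by (simp add: elt_set_times_eq)
qed

lemma class_eq_iff:
  assumes "t_invertible I" "t_invertible J"
  shows "ideal_class D I = ideal_class D J \<longleftrightarrow> (\<exists>x. x \<noteq> 0 \<and> I = scale x J)"
proof
  assume "ideal_class D I = ideal_class D J"
  moreover have "I \<in> ideal_class D I" unfolding class_eq[OF assms(1)] by (auto intro: exI[of _ 1])
  ultimately show "\<exists>x. x \<noteq> 0 \<and> I = scale x J" unfolding class_eq[OF assms(2)] by auto
next
  assume "\<exists>x. x \<noteq> 0 \<and> I = scale x J"
  then show "ideal_class D I = ideal_class D J"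
    by (metis elt_set_times_eq ideal_class_scale)
qed

lemma carrier_class_group: "carrier (class_group D) = ideal_class D ` {I. t_invertible I}"
  by (auto simp: class_group_def FactGroup_def RCOSETS_def ideal_class_def carrier_t_ideal_group)

lemma mult_class_group:
  assumes "t_invertible I" "t_invertible J"
  shows "ideal_class D I \<otimes>\<^bsub>class_group D\<^esub> ideal_class D J = ideal_class D (t (prod I J))"
proof -
  have "ideal_class D I \<otimes>\<^bsub>class_group D\<^esub> ideal_class D J
      = {t (prod X Y) | X Y. X \<in> ideal_class D I \<and> Y \<in> ideal_class D J}"
    by (auto simp: class_group_def FactGroup_def set_mult_def mult_t_ideal_group)
  also have "\<dots> = {scale (x * y) (t (prod I J)) | x y. x \<noteq> 0 \<and> y \<noteq> 0}"
    (is "?l = ?r")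
  proof -
    have "t (prod (scale x I) (scale y J)) = scale (x * y) (t (prod I J))" if "x \<noteq> 0" "y \<noteq> 0" for x
      y
      using that scale_t[of "x * y"] by (simp add: prod_scale)
    then show ?thesis
      unfolding class_eq[OF assms(1)] class_eq[OF assms(2)]
      by (smt (verit) Collect_cong mem_Collect_eq)
  qed
  also have "\<dots> = ideal_class D (t (prod I J))"
  proof -
    have "(\<exists>x y. X = scale (x * y) (t (prod I J)) \<and> x \<noteq> 0 \<and> y \<noteq> 0)
        \<longleftrightarrow> (\<exists>x. X = scale x (t (prod I J)) \<and> x \<noteq> 0)" for X
      by (metis mult_1 mult_eq_0_iff zero_neq_one)
    then show ?thesis unfolding class_eq[OF t_invertible_prod[OF assms]] by simp
  qed
  finally show ?thesis .
qed

end

lemma trivial_group_singleton: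
  assumes "carrier G = {\<one>\<^bsub>G\<^esub>}" "\<one>\<^bsub>G\<^esub> \<otimes>\<^bsub>G\<^esub> \<one>\<^bsub>G\<^esub> = \<one>\<^bsub>G\<^esub>"
  shows "trivial_group G"
proof -
  have "group G" by (rule groupI) (simp_all add: assms)
  then show ?thesis using assms(1) by (simp add: trivial_group_def)
qed

locale grading_monoid =
  fixes \<Gamma> :: "'g::torsion_free_ab_group_add set"
  assumes grading: "torsionless_grading_monoid \<Gamma>"
begin

lemma zero_mem: "0 \<in> \<Gamma>" and add_mem: "x \<in> \<Gamma> \<Longrightarrow> y \<in> \<Gamma> \<Longrightarrow> x + y \<in> \<Gamma>"
  using grading by (auto simp: torsionless_grading_monoid_def)

lemma differenceE: obtains a b where "a \<in> \<Gamma>" "b \<in> \<Gamma>" "x = a - b"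
  using grading unfolding torsionless_grading_monoid_def by blast

sublocale divisor_system "(+)" "0 :: 'g" "{}" \<Gamma>
proof
  fix x :: 'g
  show "\<exists>y. x + y = 0" by (intro exI[of _ "- x"]) simp
qed (auto simp: zero_mem add_mem ac_simps)

lemma monoid_colon_eq: "monoid_colon \<Gamma> S = colon S"
  by (auto simp: monoid_colon_def colon_def elt_set_plus_def)

lemma set_plus_eq: "S + T = prod S T"
  by (auto simp: prod_def set_plus_def)

lemma v_prod_monoid: "v (prod F \<Gamma>) = v F"
proof
  show "v (prod F \<Gamma>) \<subseteq> v F"
    by (rule v_least) (use v_extensive[of F] v_mult[of _ F] in \<open>auto simp: prod_def\<close>)
  show "v F \<subseteq> v (prod F \<Gamma>)"
    using prodI[OF _ zero_mem] by (intro v_mono) fastforce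
qed

lemma monoid_t_eq: "monoid_t \<Gamma> Y = t Y"
  unfolding monoid_t_def t_def monoid_v_def monoid_colon_eq set_plus_eq v_def[symmetric]
    v_prod_monoid
  by auto

lemma monoid_t_ideal_closed: "monoid_t_ideal \<Gamma> Y \<Longrightarrow> t Y = Y"
  by (simp add: monoid_t_ideal_def monoid_t_eq)

lemma monoid_t_idealI:
  assumes "t Y = Y" "t W = W" "t (prod Y W) = \<Gamma>" shows "monoid_t_ideal \<Gamma> Y"
proof -
  have nz: "\<not> prod Y W \<subseteq> {}" using assms(3) zero_mem t_null[of "prod Y W"] by auto
  then have "Y \<noteq> {}" "W \<noteq> {}" using prod_null by auto
  have sub: "prod Y W \<subseteq> \<Gamma>" using t_extensive[OF nz] assms(3) by simp
  obtain w where w: "w \<in> W" using \<open>W \<noteq> {}\<close> by blast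
  obtain a b where ab: "a \<in> \<Gamma>" "b \<in> \<Gamma>" "w = a - b" by (rule differenceE)
  have "a + y \<in> \<Gamma>" if "y \<in> Y" for y
  proof -
    have "y + w \<in> \<Gamma>" using sub prodI[OF that w] by blast
    then have "b + (y + w) \<in> \<Gamma>" using ab add_mem by blast
    then show ?thesis using ab by (simp add: add.commute)
  qed
  then have "a +o Y \<subseteq> \<Gamma>" by (auto simp: elt_set_plus_def)
  moreover have "Y + \<Gamma> \<subseteq> Y" using t_mult[of _ Y] assms(1) by (auto simp: set_plus_def)
  ultimately show ?thesis unfolding monoid_t_ideal_def monoid_frac_ideal_def
    using \<open>Y \<noteq> {}\<close> ab(1) assms(1) by (auto simp: monoid_t_eq)
qed

lemma carrier_monoid_t_group: "carrier (monoid_t_group \<Gamma>) = {Y. t_invertible Y}"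
proof (intro subset_antisym subsetI)
  fix Y assume "Y \<in> carrier (monoid_t_group \<Gamma>)"
  then show "Y \<in> {Y. t_invertible Y}"
    using monoid_t_ideal_closed unfolding monoid_t_group_def t_invertible_def
    by (auto simp: monoid_t_eq set_plus_eq)
next
  fix Y assume "Y \<in> {Y. t_invertible Y}"
  then obtain W where W: "t Y = Y" "t W = W" "t (prod Y W) = \<Gamma>" unfolding t_invertible_def by blast
  then have "t (prod W Y) = \<Gamma>" by (simp add: prod_comm)
  then show "Y \<in> carrier (monoid_t_group \<Gamma>)"
    unfolding monoid_t_group_def using W monoid_t_idealI[OF W] monoid_t_idealI[OF W(2,1)]
    by (auto simp: monoid_t_eq set_plus_eq)
qed

lemma mult_monoid_t_group: "Y \<otimes>\<^bsub>monoid_t_group \<Gamma>\<^esub> W = t (prod Y W)"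
  by (simp add: monoid_t_group_def monoid_t_eq set_plus_eq)

text \<open>
  The neutral element of the class group is the set of all principal fractional ideals, so
  triviality of the group says that the coset of each \<open>t\<close>-invertible \<open>t\<close>-ideal is this set.
\<close>

lemma trivial_class_group_iff:
  "trivial_group (monoid_class_group \<Gamma>) \<longleftrightarrow> (\<forall>Y. t_invertible Y \<longrightarrow> (\<exists>\<alpha>. Y = scale \<alpha> \<Gamma>))"
proof -
  let ?G = "monoid_t_group \<Gamma>" and ?P = "{\<alpha> +o \<Gamma> | \<alpha>. True}"
  have P: "?P = {scale \<alpha> \<Gamma> | \<alpha>. True}" by (auto simp: elt_set_plus_def)
  have coset: "?P #>\<^bsub>?G\<^esub> Y = {scale \<alpha> Y | \<alpha>. True}" if "t_invertible Y" for Y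
  proof -
    have "t (prod (scale \<alpha> \<Gamma>) Y) = scale \<alpha> Y" for \<alpha>
    proof -
      have "prod \<Gamma> Y = Y"
      proof
        show "prod \<Gamma> Y \<subseteq> Y" unfolding prod_comm[of \<Gamma>]
          using t_mult[of _ Y] t_invertible_closed[OF that] by (auto simp: prod_def)
        show "Y \<subseteq> prod \<Gamma> Y" using prodI[OF zero_mem] by fastforce
      qed
      then have "prod (scale \<alpha> \<Gamma>) Y = scale \<alpha> Y" by (metis scale_eq_prod prod_assoc)
      then show ?thesis using scale_t[of \<alpha> Y] t_invertible_closed[OF that] by simp
    qed
    then show ?thesis unfolding r_coset_def P mult_monoid_t_group by auto
  qed
  have "{scale \<alpha> \<Gamma> | \<alpha>. True} = ?P" by (simp only: P)
  then have coset1: "?P #>\<^bsub>?G\<^esub> \<Gamma> = ?P" using coset[OF t_invertible_D] by simp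
  have carr: "carrier (monoid_class_group \<Gamma>) = {?P #>\<^bsub>?G\<^esub> Y | Y. t_invertible Y}"
    by (auto simp: monoid_class_group_def FactGroup_def RCOSETS_def carrier_monoid_t_group)
  have one: "\<one>\<^bsub>monoid_class_group \<Gamma>\<^esub> = ?P" by (simp add: monoid_class_group_def FactGroup_def)
  show ?thesis
  proof
    assume "trivial_group (monoid_class_group \<Gamma>)"
    then have "carrier (monoid_class_group \<Gamma>) = {?P}" unfolding trivial_group_def one by blast
    then have "?P #>\<^bsub>?G\<^esub> Y = ?P" if "t_invertible Y" for Y
      using carr that by auto
    then have eq: "{scale \<alpha> Y | \<alpha>. True} = ?P" if "t_invertible Y" for Y
      using coset[OF that] that by simp
    have "scale 0 Y = Y" for Y :: "'g set" by simp
    then have self: "Y \<in> {scale \<alpha> Y | \<alpha>. True}" for Y :: "'g set" by blast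
    show "\<forall>Y. t_invertible Y \<longrightarrow> (\<exists>\<alpha>. Y = scale \<alpha> \<Gamma>)"
    proof (intro allI impI)
      fix Y assume Y: "t_invertible Y"
      have "Y \<in> ?P" using self[of Y] unfolding eq[OF Y] .
      then show "\<exists>\<alpha>. Y = scale \<alpha> \<Gamma>" unfolding P by simp
    qed
  next
    assume *: "\<forall>Y. t_invertible Y \<longrightarrow> (\<exists>\<alpha>. Y = scale \<alpha> \<Gamma>)"
    have "?P #>\<^bsub>?G\<^esub> Y = ?P" if Y: "t_invertible Y" for Y
    proof -
      obtain \<beta> where \<beta>: "Y = scale \<beta> \<Gamma>" using * Y by blast
      have sc: "scale \<alpha> Y = scale (\<alpha> + \<beta>) \<Gamma>" for \<alpha> unfolding \<beta> by (auto simp: add.assoc image_image)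
      have "{scale \<alpha> Y | \<alpha>. True} = {scale \<alpha> \<Gamma> | \<alpha>. True}"
      proof (intro subset_antisym subsetI)
        fix X assume "X \<in> {scale \<alpha> \<Gamma> | \<alpha>. True}"
        then obtain \<alpha> where "X = scale \<alpha> \<Gamma>" by blast
        then have "X = scale (\<alpha> - \<beta>) Y" using sc[of "\<alpha> - \<beta>"] by simp
        then show "X \<in> {scale \<alpha> Y | \<alpha>. True}" by blast
      qed (use sc in blast)
      from trans[OF coset[OF Y] trans[OF this P[symmetric]]] show ?thesis .
    qed
    then have c: "carrier (monoid_class_group \<Gamma>) = {?P}"
      unfolding carr using t_invertible_D by auto
    have m: "?P \<otimes>\<^bsub>monoid_class_group \<Gamma>\<^esub> ?P = ?P"
    proof -
      have "?P \<otimes>\<^bsub>monoid_class_group \<Gamma>\<^esub> ?P = (\<Union>X\<in>?P. \<Union>Y\<in>?P. {t (prod X Y)})"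
        by (simp add: monoid_class_group_def FactGroup_def set_mult_def mult_monoid_t_group)
      also have "\<dots> = {scale \<alpha> \<Gamma> | \<alpha>. True}"
      proof -
        have sum: "t (prod (scale \<alpha> \<Gamma>) (scale \<beta> \<Gamma>)) = scale (\<alpha> + \<beta>) \<Gamma>" for \<alpha> \<beta>
          using scale_t[of "\<alpha> + \<beta>" \<Gamma>] by (simp add: prod_scale prod_D_D t_D)
        define Q where "Q = {scale \<alpha> \<Gamma> | \<alpha>. True}"
        have "t (prod X Y) \<in> Q" if XY: "X \<in> Q" "Y \<in> Q" for X Y
        proof -
          obtain \<alpha> \<beta> where "X = scale \<alpha> \<Gamma>" "Y = scale \<beta> \<Gamma>" using XY unfolding Q_def by blast
          then show ?thesis using sum unfolding Q_def by blast
        qed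
        moreover have "W \<in> (\<Union>X\<in>Q. \<Union>Y\<in>Q. {t (prod X Y)})" if W: "W \<in> Q" for W
        proof -
          obtain \<alpha> where "W = scale \<alpha> \<Gamma>" using W unfolding Q_def by blast
          then have "W = t (prod W (scale 0 \<Gamma>))" using sum[of \<alpha> 0] by simp
          moreover have "scale 0 \<Gamma> \<in> Q" unfolding Q_def by blast
          ultimately show ?thesis using W by blast
        qed
        ultimately show ?thesis unfolding P Q_def[symmetric] by blast
      qed
      also have "\<dots> = ?P" by (rule P[symmetric])
      finally show ?thesis .
    qed
    have "trivial_group (monoid_class_group \<Gamma>)"
    proof (rule trivial_group_singleton)
      show "carrier (monoid_class_group \<Gamma>) = {\<one>\<^bsub>monoid_class_group \<Gamma>\<^esub>}"
        unfolding one by (rule c)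
      show "\<one>\<^bsub>monoid_class_group \<Gamma>\<^esub> \<otimes>\<^bsub>monoid_class_group \<Gamma>\<^esub> \<one>\<^bsub>monoid_class_group \<Gamma>\<^esub>
          = \<one>\<^bsub>monoid_class_group \<Gamma>\<^esub>"
        unfolding one by (rule m)
    qed
    then show "trivial_group (monoid_class_group \<Gamma>)" .
  qed
qed

end

section \<open>Integral elements, valuation rings and cones\<close>

lemma subring_power: "subring B \<Longrightarrow> x \<in> B \<Longrightarrow> x ^ n \<in> B"
  by (induction n) (auto simp: subringD)

lemma subring_poly: "subring B \<Longrightarrow> (\<And>i. coeff p i \<in> B) \<Longrightarrow> x \<in> B \<Longrightarrow> poly p x \<in> B"
  unfolding poly_altdef by (intro subring_sum subringD(4) subring_power)

definition coeffs_in :: "'k::field set \<Rightarrow> 'k poly set" where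
  "coeffs_in B = {p. \<forall>i. coeff p i \<in> B}"

lemma coeffs_in_closed:
  assumes "subring B"
  shows "p \<in> coeffs_in B \<Longrightarrow> q \<in> coeffs_in B \<Longrightarrow> p + q \<in> coeffs_in B"
    "p \<in> coeffs_in B \<Longrightarrow> q \<in> coeffs_in B \<Longrightarrow> p - q \<in> coeffs_in B"
    "p \<in> coeffs_in B \<Longrightarrow> q \<in> coeffs_in B \<Longrightarrow> p * q \<in> coeffs_in B"
    "c \<in> B \<Longrightarrow> monom c n \<in> coeffs_in B"
    "c \<in> B \<Longrightarrow> p \<in> coeffs_in B \<Longrightarrow> smult c p \<in> coeffs_in B"
  using assms
  by (auto simp: coeffs_in_def coeff_mult subringD intro!: subring_sum)

definition integral_over :: "'k::field set \<Rightarrow> 'k \<Rightarrow> bool" where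
  "integral_over B x \<longleftrightarrow> (\<exists>p. lead_coeff p = 1 \<and> (\<forall>i. coeff p i \<in> B) \<and> poly p x = 0)"

definition valuation_ring :: "'k::field set \<Rightarrow> bool" where
  "valuation_ring V \<longleftrightarrow> subring V \<and> (\<forall>x. x \<noteq> 0 \<longrightarrow> x \<in> V \<or> inverse x \<in> V)"

definition adjoin :: "'k::field set \<Rightarrow> 'k \<Rightarrow> 'k set" where
  "adjoin B z = (\<lambda>p. poly p z) ` coeffs_in B"

lemma adjoin:
  assumes B: "subring B"
  shows "subring (adjoin B z)" "B \<subseteq> adjoin B z" "z \<in> adjoin B z"
proof -
  show "z \<in> adjoin B z"
    unfolding adjoin_def using coeffs_in_closed(4)[OF B subringD(1)[OF B], of 1]
    by (intro image_eqI[of _ _ "monom 1 1"]) (auto simp: poly_monom)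
  show sub: "B \<subseteq> adjoin B z"
  proof
    fix b assume "b \<in> B"
    then show "b \<in> adjoin B z"
      unfolding adjoin_def using coeffs_in_closed(4)[OF B, of b 0]
      by (intro image_eqI[of _ _ "monom b 0"]) (auto simp: poly_monom)
  qed
  then have "1 \<in> adjoin B z" using subringD(1)[OF B] by blast
  then show "subring (adjoin B z)"
    unfolding subring_def using coeffs_in_closed(2,3)[OF B]
    by (auto simp: adjoin_def simp flip: poly_diff poly_mult)
qed

text \<open>
  As \<open>1 - y * coeff q 0\<close> is a unit, the second relation, multiplied by \<open>z ^ degree p\<close>, expresses
  this power of \<open>z\<close> by lower ones.
\<close>

lemma shorten_relation:
  assumes B: "subring B" and y: "y \<in> B"
    and unit: "\<And>b. b \<in> B \<Longrightarrow> 1 - y * b \<noteq> 0 \<and> inverse (1 - y * b) \<in> B"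
    and z: "z \<noteq> (0 :: 'k::field)"
    and p: "p \<in> coeffs_in B" "y * poly p z = 1" and q: "q \<in> coeffs_in B"
      "y * poly q (inverse z) = 1"
    and deg: "degree q \<le> degree p"
  shows "\<exists>r\<in>coeffs_in B. y * poly r z = 1 \<and> degree r < degree p"
proof -
  define n m u where "n = degree p" and "m = degree q" and "u = inverse (1 - y * coeff q 0)"
  have qB: "coeff q i \<in> B" and pB: "coeff p i \<in> B" for i using p q by (auto simp: coeffs_in_def)
  have u: "u \<in> B" "u * (1 - y * coeff q 0) = 1" using unit[OF qB[of 0]] by (auto simp: u_def)
  have "n \<noteq> 0"
  proof
    assume "n = 0"
    then have "poly p z = coeff p 0" unfolding n_def poly_altdef by simp
    then show False using p(2) unit[OF pB[of 0]] by simp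
  qed
  have mn: "m \<le> n" using deg by (simp add: m_def n_def)
  define s where "s = (\<Sum>j\<in>{1..m}. monom (coeff q j) (n - j))"
  have s: "s \<in> coeffs_in B"
    using qB by (auto simp: s_def coeffs_in_def coeff_sum subringD[OF B] intro!: subring_sum[OF B])
  define r where "r = p - monom (coeff p n) n + smult (coeff p n * y * u) s"
  have "r \<in> coeffs_in B"
    unfolding r_def by (intro coeffs_in_closed[OF B] p s subringD(4)[OF B] pB y u)
  moreover have "degree r < n"
  proof -
    have "coeff r k = 0" if "k \<ge> n" for k
    proof -
      have "coeff s k = 0"
        unfolding s_def coeff_sum by (intro sum.neutral) (use that mn in \<open>auto simp: coeff_monom\<close>)
      moreover have "coeff p k = 0" if "k \<noteq> n" using that \<open>k \<ge> n\<close> by (simp add: n_def coeff_eq_0)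
      ultimately show ?thesis by (auto simp: r_def coeff_monom)
    qed
    then show ?thesis
      using \<open>n \<noteq> 0\<close> by (metis degree_le le_degree leading_coeff_0_iff degree_0 not_le gr0I)
  qed
  moreover have "y * poly r z = 1"
  proof -
    have "poly s z = z ^ n * (poly q (inverse z) - coeff q 0)"
    proof -
      have "poly q (inverse z) = (\<Sum>j\<le>m. coeff q j * inverse z ^ j)" by (simp add: poly_altdef m_def)
      also have "{..m} = insert 0 {1..m}" by auto
      finally have "poly q (inverse z) - coeff q 0 = (\<Sum>j\<in>{1..m}. coeff q j * inverse z ^ j)" by simp
      then have "z ^ n * (poly q (inverse z) - coeff q 0) = (\<Sum>j\<in>{1..m}. coeff q j * (z ^ n *
        inverse z ^ j))"
        by (simp add: sum_distrib_left ac_simps)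
      also have "\<dots> = (\<Sum>j\<in>{1..m}. coeff q j * z ^ (n - j))"
      proof (intro sum.cong refl)
        fix j assume "j \<in> {1..m}"
        then have "z ^ n = z ^ (n - j) * z ^ j" using mn by (simp flip: power_add)
        then show "coeff q j * (z ^ n * inverse z ^ j) = coeff q j * z ^ (n - j)"
          using z by (simp add: power_inverse)
      qed
      finally show ?thesis by (simp add: s_def poly_sum poly_monom)
    qed
    then have "y * poly s z = z ^ n * (y * poly q (inverse z) - y * coeff q 0)"
      by (simp add: right_diff_distrib ac_simps)
    then have "y * poly s z = z ^ n * (1 - y * coeff q 0)" using q(2) by simp
    then have "u * (y * poly s z) = z ^ n"
      using u(2) by (metis mult.left_commute mult_1_right mult.commute)
    moreover have "y * poly r z = y * poly p z - y * (coeff p n * z ^ n)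
        + y * (coeff p n * (u * (y * poly s z)))"
      unfolding r_def by (simp add: poly_monom algebra_simps)
    ultimately show ?thesis using p(2) by simp
  qed
  ultimately show ?thesis unfolding n_def by blast
qed

lemma no_two_relations:
  assumes B: "subring B" and y: "y \<in> B"
    and unit: "\<And>b. b \<in> B \<Longrightarrow> 1 - y * b \<noteq> 0 \<and> inverse (1 - y * b) \<in> B"
    and z: "z \<noteq> (0 :: 'k::field)"
    and p: "p \<in> coeffs_in B" "y * poly p z = 1" and q: "q \<in> coeffs_in B"
      "y * poly q (inverse z) = 1"
  shows False
  using z p q
proof (induction "degree p + degree q" arbitrary: z p q rule: less_induct)
  case less
  show False
  proof (cases "degree q \<le> degree p")
    case True
    then obtain r where "r \<in> coeffs_in B" "y * poly r z = 1" "degree r < degree p"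
      using shorten_relation[OF B y unit less.prems] by blast
    then show ?thesis using less.hyps[of r q z] less.prems by auto
  next
    case False
    then obtain r where "r \<in> coeffs_in B" "y * poly r (inverse z) = 1" "degree r < degree q"
      using shorten_relation[OF B y unit, of "inverse z" q p] less.prems by auto
    then show ?thesis using less.hyps[of p r z] less.prems by auto
  qed
qed

lemma maximal_set:
  assumes "good B"
    and union: "\<And>C. C \<noteq> {} \<Longrightarrow> (\<And>B. B \<in> C \<Longrightarrow> good B) \<Longrightarrow>
      (\<And>a b. a \<in> \<Union>C \<Longrightarrow> b \<in> \<Union>C \<Longrightarrow> \<exists>B\<in>C. a \<in> B \<and> b \<in> B) \<Longrightarrow> good (\<Union>C)"
  obtains M where "good M" "\<forall>X. good X \<longrightarrow> M \<subseteq> X \<longrightarrow> X = M"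
proof -
  have "\<exists>M\<in>{B. good B}. \<forall>X\<in>{B. good B}. M \<subseteq> X \<longrightarrow> X = M"
  proof (rule subset_Zorn_nonempty)
    show "{B. good B} \<noteq> {}" using assms(1) by blast
  next
    fix C assume C: "C \<noteq> {}" "subset.chain {B. good B} C"
    have "\<exists>B\<in>C. a \<in> B \<and> b \<in> B" if ab: "a \<in> \<Union>C" "b \<in> \<Union>C" for a b
    proof -
      obtain P Q where PQ: "P \<in> C" "Q \<in> C" "a \<in> P" "b \<in> Q" using ab by blast
      then have "P \<subseteq> Q \<or> Q \<subseteq> P" using C(2) by (auto simp: subset_chain_def)
      then show ?thesis using PQ by blast
    qed
    moreover have "good B" if "B \<in> C" for B using C(2) that by (auto simp: subset_chain_def)
    ultimately show "\<Union>C \<in> {B. good B}" using union[OF C(1)] by simp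
  qed
  then show thesis using that by auto
qed

text \<open>
  Let \<open>y = 1 / x\<close>. An equation \<open>1 = y p(y)\<close> with coefficients in \<open>A\<close> would be an equation of
  integral dependence for \<open>x\<close>, so \<open>y\<close> is not a unit of \<open>A[y]\<close>. Let \<open>V\<close> be a maximal subring that
  contains \<open>A[y]\<close> and in which \<open>y\<close> is not a unit. By maximality, each \<open>z \<notin> V\<close> satisfies an
  equation \<open>1 = y p(z)\<close> over \<open>V\<close>. For the inverses of the elements \<open>1 - y b\<close> such an equation is
  impossible, so they are in \<open>V\<close>; then \<open>no_two_relations\<close> excludes that \<open>z\<close> and \<open>1 / z\<close> are both
  outside of \<open>V\<close>.
\<close>

theorem valuation_ring_avoiding:
  fixes x :: "'k::field"
  assumes A: "subring A" and x: "\<not> integral_over A x"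
  obtains V where "valuation_ring V" "A \<subseteq> V" "x \<notin> V"
proof -
  have "x \<noteq> 0"
  proof
    assume "x = 0"
    then have "integral_over A x"
      unfolding integral_over_def using subringD(1,2)[OF A]
      by (intro exI[of _ "monom 1 1"]) (auto simp: poly_monom degree_monom_eq)
    then show False using x by blast
  qed
  define y where "y = inverse x"
  have "y \<noteq> 0" using \<open>x \<noteq> 0\<close> by (simp add: y_def)
  define good where "good B \<longleftrightarrow> subring B \<and> A \<subseteq> B \<and> y \<in> B \<and> (\<forall>b\<in>B. y * b \<noteq> 1)" for B
  have "good (adjoin A y)"
  proof -
    have "y * b \<noteq> 1" if "b \<in> adjoin A y" for b
    proof
      assume yb: "y * b = 1"
      obtain p where p: "p \<in> coeffs_in A" "b = poly p y"
        using \<open>b \<in> adjoin A y\<close> by (auto simp: adjoin_def)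
      define n where "n = degree p"
      define r where "r = monom 1 (Suc n) - (\<Sum>i\<le>n. monom (coeff p i) (n - i))"
      have cs: "coeff (\<Sum>i\<le>n. monom (coeff p i) (n - i)) k = 0" if "k > n" for k
        unfolding coeff_sum by (intro sum.neutral) (use that in \<open>auto simp: coeff_monom\<close>)
      have deg: "degree r = Suc n"
      proof (rule antisym)
        show "degree r \<le> Suc n" by (rule degree_le) (auto simp: r_def cs coeff_monom)
        show "Suc n \<le> degree r" by (rule le_degree) (auto simp: r_def cs coeff_monom)
      qed
      have "lead_coeff r = 1" unfolding deg by (simp add: r_def cs)
      moreover have "coeff r i \<in> A" for i
        using p(1) unfolding r_def coeff_diff coeff_sum coeffs_in_def
        by (auto simp: coeff_monom intro!: subringD[OF A] subring_sum[OF A])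
      moreover have "poly r x = 0"
      proof -
        have "x ^ Suc n = x ^ Suc n * (y * b)" using yb by simp
        also have "\<dots> = x ^ n * b" using \<open>x \<noteq> 0\<close> by (simp add: y_def)
        also have "\<dots> = (\<Sum>i\<le>n. coeff p i * (x ^ n * y ^ i))"
          unfolding p(2) poly_altdef n_def by (simp add: sum_distrib_left ac_simps)
        also have "\<dots> = (\<Sum>i\<le>n. coeff p i * x ^ (n - i))"
        proof (intro sum.cong refl)
          fix i assume "i \<in> {..n}"
          then have "x ^ n = x ^ (n - i) * x ^ i" by (simp flip: power_add)
          then show "coeff p i * (x ^ n * y ^ i) = coeff p i * x ^ (n - i)"
            using \<open>x \<noteq> 0\<close> by (simp add: y_def power_inverse)
        qed
        finally show ?thesis by (simp add: r_def poly_monom poly_sum)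
      qed
      ultimately show False using x unfolding integral_over_def by blast
    qed
    then show ?thesis unfolding good_def using adjoin[OF A] by blast
  qed
  obtain V where V: "good V" and max': "\<forall>X. good X \<longrightarrow> V \<subseteq> X \<longrightarrow> X = V"
  proof (rule maximal_set[of good])
    show "good (adjoin A y)" by fact
  next
    fix C assume C: "C \<noteq> {}" "\<And>B. B \<in> C \<Longrightarrow> good B"
      and common: "\<And>a b. a \<in> \<Union>C \<Longrightarrow> b \<in> \<Union>C \<Longrightarrow> \<exists>B\<in>C. a \<in> B \<and> b \<in> B"
    have "subring (\<Union>C)"
      unfolding subring_def
    proof (intro conjI ballI)
      show "1 \<in> \<Union>C" using C subringD(1) unfolding good_def by blast
    next
      fix a b assume "a \<in> \<Union>C" "b \<in> \<Union>C"
      then obtain B where "B \<in> C" "a \<in> B" "b \<in> B" using common by blast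
      then show "a - b \<in> \<Union>C" "a * b \<in> \<Union>C" using C(2) subringD(3,4) unfolding good_def by blast+
    qed
    then show "good (\<Union>C)" using C unfolding good_def by blast
  qed
  have max: "X = V" if "good X" "V \<subseteq> X" for X using max' that by blast
  have sV: "subring V" and yV: "y \<in> V" and AV: "A \<subseteq> V" and neV: "\<And>b. b \<in> V \<Longrightarrow> y * b \<noteq> 1"
    using V by (auto simp: good_def)
  have relation: "\<exists>p\<in>coeffs_in V. y * poly p z = 1" if "z \<notin> V" for z
  proof -
    have "\<not> good (adjoin V z)" using max[of "adjoin V z"] adjoin[OF sV] that by blast
    then show ?thesis unfolding good_def using adjoin[OF sV, of z] yV AV by (auto simp: adjoin_def)
  qed
  \<comment> \<open>Modulo \<open>y\<close> the element \<open>w = 1 - y b\<close> is \<open>1\<close>, but \<open>1 = y p(1 / w)\<close> would make a power of \<open>w\<close>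
    divisible by \<open>y\<close>.\<close>
  have unit: "1 - y * b \<noteq> 0 \<and> inverse (1 - y * b) \<in> V" if b: "b \<in> V" for b
  proof -
    define w where "w = 1 - y * b"
    have w: "w \<noteq> 0" "w \<in> V" using neV[OF b] subringD[OF sV] yV b by (auto simp: w_def)
    have "inverse w \<in> V"
    proof (rule ccontr)
      assume "inverse w \<notin> V"
      then obtain p where p: "p \<in> coeffs_in V" "y * poly p (inverse w) = 1" using relation by blast
      define n where "n = degree p"
      define c where "c = (\<Sum>i\<le>n. coeff p i * w ^ (n - i))"
      have "w ^ n = y * (w ^ n * poly p (inverse w))" using p(2) by (simp add: ac_simps)
      also have "w ^ n * poly p (inverse w) = (\<Sum>i\<le>n. coeff p i * (w ^ n * inverse w ^ i))"
        unfolding poly_altdef n_def by (simp add: sum_distrib_left ac_simps)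
      also have "\<dots> = c"
        unfolding c_def
      proof (intro sum.cong refl)
        fix i assume "i \<in> {..n}"
        then have "w ^ n = w ^ (n - i) * w ^ i" by (simp flip: power_add)
        then show "coeff p i * (w ^ n * inverse w ^ i) = coeff p i * w ^ (n - i)"
          using w by (simp add: power_inverse)
      qed
      finally have wn: "w ^ n = y * c" .
      have cV: "c \<in> V"
        unfolding c_def using p(1) w
        by (intro subring_sum[OF sV] subringD(4)[OF sV] subring_power[OF sV]) (auto
          simp: coeffs_in_def)
      have "\<exists>d\<in>V. w ^ k = 1 - y * d" for k
      proof (induction k)
        case 0
        then show ?case using subringD(2)[OF sV] by (intro bexI[of _ 0]) auto
      next
        case (Suc k)
        then obtain d where d: "d \<in> V" "w ^ k = 1 - y * d" by blast
        have "w ^ Suc k = 1 - y * (b + d - y * b * d)"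
          by (simp add: d(2)) (simp add: w_def algebra_simps)
        moreover have "b + d - y * b * d \<in> V" using b d yV subringD[OF sV] by simp
        ultimately show ?case by blast
      qed
      then obtain d where d: "d \<in> V" "w ^ n = 1 - y * d" by blast
      then have "y * (c + d) = 1" using wn by (simp add: algebra_simps)
      then show False using neV[of "c + d"] subringD(6)[OF sV cV d(1)] by blast
    qed
    then show ?thesis using w by (simp add: w_def)
  qed
  have "z \<in> V \<or> inverse z \<in> V" if "z \<noteq> 0" for z
  proof (rule ccontr)
    assume "\<not> ?thesis"
    then obtain p q where "p \<in> coeffs_in V" "y * poly p z = 1" "q \<in> coeffs_in V"
      "y * poly q (inverse z) = 1"
      using relation by blast
    then show False using no_two_relations[OF sV yV unit that] by blast
  qed
  then have "valuation_ring V" using sV by (auto simp: valuation_ring_def)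
  moreover have "x \<notin> V" using neV[of x] \<open>x \<noteq> 0\<close> by (auto simp: y_def)
  ultimately show thesis using that AV by blast
qed

lemma valuation_ring_UNIV: "valuation_ring UNIV"
  by (simp add: valuation_ring_def subring_def)

definition total_cone :: "'g::ab_group_add set \<Rightarrow> bool" where
  "total_cone P \<longleftrightarrow> 0 \<in> P \<and> (\<forall>x\<in>P. \<forall>y\<in>P. x + y \<in> P) \<and> (\<forall>x. x \<in> P \<or> - x \<in> P)"

lemma total_coneD:
  assumes "total_cone P"
  shows "0 \<in> P" "x \<in> P \<Longrightarrow> y \<in> P \<Longrightarrow> x + y \<in> P" "x \<in> P \<or> - x \<in> P"
  using assms by (auto simp: total_cone_def)

lemma antisymmetric_total_cone:
  obtains P :: "'g::torsion_free_ab_group_add set"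
  where "total_cone P" "\<And>x. x \<in> P \<Longrightarrow> - x \<in> P \<Longrightarrow> x = 0"
proof (rule total_cone_exists)
  fix P :: "'g set"
  assume "0 \<in> P" "\<And>x y. x \<in> P \<Longrightarrow> y \<in> P \<Longrightarrow> x + y \<in> P"
    "\<And>x. x \<in> P \<Longrightarrow> - x \<in> P \<Longrightarrow> x = 0" "\<And>x. x \<in> P \<or> - x \<in> P"
  then show thesis using that[of P] by (simp add: total_cone_def)
qed

lemma multiple_mem:
  assumes "0 \<in> P" "\<And>x y. x \<in> P \<Longrightarrow> y \<in> P \<Longrightarrow> x + y \<in> P" "x \<in> P"
  shows "(\<Sum>i<(n::nat). x) \<in> P"
  by (induction n) (auto simp: assms)

text \<open>
  Let \<open>P\<close> be a maximal monoid that contains \<open>\<Gamma>\<close> and no positive multiple of \<open>g\<close>. If \<open>P\<close> contained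
  neither \<open>x\<close> nor \<open>- x\<close>, adjoining either of them would bring in a positive multiple of \<open>g\<close>.
\<close>

theorem total_cone_avoiding:
  fixes \<Gamma> :: "'g::torsion_free_ab_group_add set"
  assumes \<Gamma>: "0 \<in> \<Gamma>" "\<And>x y. x \<in> \<Gamma> \<Longrightarrow> y \<in> \<Gamma> \<Longrightarrow> x + y \<in> \<Gamma>" "integrally_closed_monoid \<Gamma>" and g: "g \<notin> \<Gamma>"
  obtains P where "total_cone P" "\<Gamma> \<subseteq> P" "g \<notin> P"
proof -
  define good where "good P \<longleftrightarrow> \<Gamma> \<subseteq> P \<and> (\<forall>x\<in>P. \<forall>y\<in>P. x + y \<in> P) \<and> (\<forall>n\<ge>(1::nat). (\<Sum>i<n. g) \<notin> P)" for P
  have "good \<Gamma>" using \<Gamma> g by (auto simp: good_def integrally_closed_monoid_def)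
  obtain P where P: "good P" and max': "\<forall>X. good X \<longrightarrow> P \<subseteq> X \<longrightarrow> X = P"
  proof (rule maximal_set[of good])
    show "good \<Gamma>" by fact
  next
    fix C assume C: "C \<noteq> {}" "\<And>B. B \<in> C \<Longrightarrow> good B"
      and common: "\<And>a b. a \<in> \<Union>C \<Longrightarrow> b \<in> \<Union>C \<Longrightarrow> \<exists>B\<in>C. a \<in> B \<and> b \<in> B"
    have "a + b \<in> \<Union>C" if "a \<in> \<Union>C" "b \<in> \<Union>C" for a b
      using common[OF that] C(2) unfolding good_def by blast
    then show "good (\<Union>C)" using C unfolding good_def by blast
  qed
  have max: "X = P" if "good X" "P \<subseteq> X" for X using max' that by blast
  have add: "\<And>x y. x \<in> P \<Longrightarrow> y \<in> P \<Longrightarrow> x + y \<in> P" and sub: "\<Gamma> \<subseteq> P"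
    and avoid: "\<And>n::nat. n \<ge> 1 \<Longrightarrow> (\<Sum>i<n. g) \<notin> P" using P by (auto simp: good_def)
  have zero: "0 \<in> P" using \<Gamma>(1) sub by blast
  have key: "\<exists>n\<ge>1::nat. \<exists>m::nat. \<exists>p\<in>P. (\<Sum>i<n. g) = p + (\<Sum>i<m. x)" if x: "x \<notin> P" for x
  proof -
    define Q where "Q = {p + (\<Sum>i<m. x) | p (m::nat). p \<in> P}"
    have "P \<subseteq> Q" unfolding Q_def by (force intro: exI[of _ "0::nat"])
    moreover have "x \<in> Q" unfolding Q_def mem_Collect_eq
      by (intro exI[of _ 0] exI[of _ "Suc 0"]) (simp add: zero)
    ultimately have "\<not> good Q" using max[of Q] x by blast
    moreover have "a + b \<in> Q" if ab: "a \<in> Q" "b \<in> Q" for a b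
    proof -
      obtain p q and n m :: nat where "a = p + (\<Sum>i<n. x)" "b = q + (\<Sum>i<m. x)" "p \<in> P" "q \<in> P"
        using ab unfolding Q_def by blast
      then have "a + b = (p + q) + (\<Sum>i<n + m. x)" "p + q \<in> P"
        unfolding multiple_add by (simp_all add: ac_simps add)
      then show ?thesis unfolding Q_def by blast
    qed
    ultimately obtain n :: nat where "n \<ge> 1" "(\<Sum>i<n. g) \<in> Q"
      using sub \<open>P \<subseteq> Q\<close> unfolding good_def by blast
    then show ?thesis unfolding Q_def by blast
  qed
  have "x \<in> P \<or> - x \<in> P" for x
  proof (rule ccontr)
    assume "\<not> ?thesis"
    then obtain n m n' m' :: nat and p q where n: "n \<ge> 1" "p \<in> P" "(\<Sum>i<n. g) = p + (\<Sum>i<m. x)"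
      and n': "n' \<ge> 1" "q \<in> P" "(\<Sum>i<n'. g) = q + (\<Sum>i<m'. - x)"
      using key[of x] key[of "- x"] by blast
    have "m \<noteq> 0"
    proof
      assume "m = 0"
      then have "(\<Sum>i<n. g) = p" using n(3) by simp
      then show False using n(1,2) avoid[of n] by simp
    qed
    \<comment> \<open>Eliminating \<open>x\<close> from the two relations puts a positive multiple of \<open>g\<close> into \<open>P\<close>.\<close>
    have "(\<Sum>i<m' * n + m * n'. g) = (\<Sum>i<m'. \<Sum>i<n. g) + (\<Sum>i<m. \<Sum>i<n'. g)"
      by (simp only: multiple_add multiple_mult)
    also have "\<dots> = (\<Sum>i<m'. p) + (\<Sum>i<m. q) + ((\<Sum>i<m'. \<Sum>i<m. x) + - (\<Sum>i<m. \<Sum>i<m'. x))"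
      unfolding n(3) n'(3) by (simp only: sum.distrib sum_negf ac_simps)
    also have "\<dots> = (\<Sum>i<m'. p) + (\<Sum>i<m. q)"
      using multiple_mult[of x m m'] multiple_mult[of x m' m] by (simp add: mult.commute)
    also have "\<dots> \<in> P" using n(2) n'(2) multiple_mem[of P] zero add by blast
    finally have "(\<Sum>i<m' * n + m * n'. g) \<in> P" .
    moreover have "m' * n + m * n' \<ge> 1" using \<open>m \<noteq> 0\<close> n'(1) by (cases m) auto
    ultimately show False using avoid by blast
  qed
  then have "total_cone P" using zero add by (auto simp: total_cone_def)
  moreover have "g \<notin> P" using avoid[of 1] by simp
  ultimately show thesis using that sub by blast
qed

section \<open>Products of coefficients are integral over the coefficients of a product\<close>

text \<open>
  Suppose that \<open>x / y \<in> V\<close>. Since \<open>x + y = y (x / y + 1)\<close>, an inverse of \<open>x + y\<close> in \<open>V\<close> would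
  yield one of \<open>y\<close>.
\<close>

lemma nonunits_add:
  assumes V: "valuation_ring V"
    and x: "x \<in> V" "x = 0 \<or> inverse x \<notin> V" and y: "y \<in> V" "y = 0 \<or> inverse y \<notin> V"
  shows "x + y = 0 \<or> inverse (x + y) \<notin> V"
proof (rule ccontr)
  have sV: "subring V" and val: "\<And>z. z \<noteq> 0 \<Longrightarrow> z \<in> V \<or> inverse z \<in> V"
    using V by (auto simp: valuation_ring_def)
  assume "\<not> ?thesis"
  then have s: "x + y \<noteq> 0" "inverse (x + y) \<in> V" by auto
  then have xy: "x \<noteq> 0" "y \<noteq> 0" using x y by auto
  have *: "inverse b \<in> V" if "a / b \<in> V" "b \<noteq> 0" "a + b \<noteq> 0" "inverse (a + b) \<in> V" for a b
  proof -
    have "inverse b = (a / b + 1) * inverse (a + b)" using that by (simp add: field_simps)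
    then show ?thesis using that subringD[OF sV] by simp
  qed
  have "x / y \<in> V \<or> y / x \<in> V" using val[of "x / y"] xy by simp
  then show False
  proof
    assume "x / y \<in> V"
    then show False using *[of x y] s xy y by blast
  next
    assume "y / x \<in> V"
    then show False using *[of y x] s xy x by (simp add: add.commute)
  qed
qed

text \<open>
  The order is a parameter, since a torsion-free group has many total orders and none is
  distinguished.
\<close>

definition translation_order :: "('i::plus \<Rightarrow> 'i \<Rightarrow> bool) \<Rightarrow> bool" where
  "translation_order prec \<longleftrightarrow>
     (\<forall>i. prec i i) \<and> (\<forall>i j k. prec i j \<longrightarrow> prec j k \<longrightarrow> prec i k) \<and> (\<forall>i j. prec i j \<or> prec j i) \<and>
     (\<forall>i j. prec i j \<longrightarrow> prec j i \<longrightarrow> i = j) \<and> (\<forall>i j k. prec i j \<longrightarrow> prec (i + k) (j + k))"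

lemma translation_orderD:
  assumes "translation_order prec"
  shows "prec i i" "prec i j \<Longrightarrow> prec j k \<Longrightarrow> prec i k" "prec i j \<or> prec j i"
    "prec i j \<Longrightarrow> prec j i \<Longrightarrow> i = j" "prec i j \<Longrightarrow> prec (i + k) (j + k)"
  using assms unfolding translation_order_def by blast+

text \<open>
  Among the indices at which \<open>f\<close> has least value, \<open>a\<close> is the least one.
\<close>

lemma dominant_index:
  fixes f :: "'i::plus \<Rightarrow> 'k::field" and prec :: "'i \<Rightarrow> 'i \<Rightarrow> bool"
  assumes V: "valuation_ring V"
    and prec: "translation_order prec"
    and I: "finite I" "I \<noteq> {}" "\<And>i. i \<in> I \<Longrightarrow> f i \<noteq> 0"
  shows "\<exists>a\<in>I. \<forall>i\<in>I. f i / f a \<in> V \<and> (f a / f i \<in> V \<longrightarrow> prec a i)"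
  using I
proof (induction I rule: finite_ne_induct)
  have sV: "subring V" and val: "\<And>z. z \<noteq> 0 \<Longrightarrow> z \<in> V \<or> inverse z \<in> V"
    using V by (auto simp: valuation_ring_def)
  {
    case (singleton x)
    then show ?case using translation_orderD(1)[OF prec] subringD(1)[OF sV] by simp
  next
    case (insert x I)
    then obtain a where a: "a \<in> I" "\<And>i. i \<in> I \<Longrightarrow> f i / f a \<in> V \<and> (f a / f i \<in> V \<longrightarrow> prec a i)" by auto
    have nz: "f a \<noteq> 0" "f x \<noteq> 0" "\<And>i. i \<in> I \<Longrightarrow> f i \<noteq> 0" using insert.prems a(1) by auto
    have trans: "u / w \<in> V" if "u / v \<in> V" "v / w \<in> V" "v \<noteq> 0" for u v w
      using subringD(4)[OF sV that(1,2)] that(3) by simp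
    show ?case
    proof (cases "f x / f a \<in> V \<and> (f a / f x \<in> V \<longrightarrow> prec a x)")
      case True
      then show ?thesis using a by blast
    next
      case False
      have ax: "f a / f x \<in> V" "f x / f a \<in> V \<Longrightarrow> prec x a"
        using False val[of "f x / f a"] nz translation_orderD(3)[OF prec] by auto
      have "f i / f x \<in> V \<and> (f x / f i \<in> V \<longrightarrow> prec x i)" if "i \<in> I" for i
      proof (intro conjI impI)
        show "f i / f x \<in> V" using trans[of "f i" "f a" "f x"] a(2)[OF that] ax(1) nz by blast
        assume "f x / f i \<in> V"
        then have "f x / f a \<in> V" "f a / f i \<in> V"
          using trans[of "f x" "f i" "f a"] trans[of "f a" "f x" "f i"] a(2)[OF that] ax(1) nz that
            by blast+
        then show "prec x i" using ax(2) a(2)[OF that] translation_orderD(2)[OF prec] by blast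
      qed
      then show ?thesis using translation_orderD(1)[OF prec] subringD(1)[OF sV] nz by auto
    qed
  }
qed

definition convolution ::
    "'i::plus set \<Rightarrow> ('i \<Rightarrow> 'k) \<Rightarrow> 'i set \<Rightarrow> ('i \<Rightarrow> 'k) \<Rightarrow> 'i \<Rightarrow> 'k::comm_ring_1" where
  "convolution I f J g k = (\<Sum>(i, j)\<in>{(i, j). i \<in> I \<and> j \<in> J \<and> i + j = k}. f i * g j)"

text \<open>
  If \<open>a\<close> and \<open>b\<close> are the dominant indices of \<open>f\<close> and \<open>g\<close>, then all other contributions to the
  coefficient of the product at \<open>a + b\<close> have larger value than \<open>f a * g b\<close>.
\<close>

lemma dominant_term:
  fixes f g :: "'i::cancel_ab_semigroup_add \<Rightarrow> 'k::field" and prec :: "'i \<Rightarrow> 'i \<Rightarrow> bool"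
  assumes V: "valuation_ring V"
    and prec: "translation_order prec"
    and I: "finite I" "I \<noteq> {}" "\<And>i. i \<in> I \<Longrightarrow> f i \<noteq> 0"
    and J: "finite J" "J \<noteq> {}" "\<And>j. j \<in> J \<Longrightarrow> g j \<noteq> 0"
  obtains a b where "a \<in> I" "b \<in> J"
    "\<And>i. i \<in> I \<Longrightarrow> f i / f a \<in> V" "\<And>i. i \<in> I \<Longrightarrow> f a / f i \<in> V \<Longrightarrow> prec a i"
    "\<And>j. j \<in> J \<Longrightarrow> g j / g b \<in> V" "\<And>j. j \<in> J \<Longrightarrow> g b / g j \<in> V \<Longrightarrow> prec b j"
    "convolution I f J g (a + b) \<noteq> 0"
    "f a * g b / convolution I f J g (a + b) \<in> V"
proof -
  have sV: "subring V" and val: "\<And>z. z \<noteq> 0 \<Longrightarrow> z \<in> V \<or> inverse z \<in> V"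
    using V by (auto simp: valuation_ring_def)
  have "\<exists>a\<in>I. \<forall>i\<in>I. f i / f a \<in> V \<and> (f a / f i \<in> V \<longrightarrow> prec a i)"
    by (intro dominant_index V prec I)
  then obtain a where a: "a \<in> I" "\<And>i. i \<in> I \<Longrightarrow> f i / f a \<in> V \<and> (f a / f i \<in> V \<longrightarrow> prec a i)"
    by blast
  have "\<exists>b\<in>J. \<forall>j\<in>J. g j / g b \<in> V \<and> (g b / g j \<in> V \<longrightarrow> prec b j)"
    by (intro dominant_index V prec J)
  then obtain b where b: "b \<in> J" "\<And>j. j \<in> J \<Longrightarrow> g j / g b \<in> V \<and> (g b / g j \<in> V \<longrightarrow> prec b j)"
    by blast
  have nz: "f a \<noteq> 0" "g b \<noteq> 0" using a b I J by auto
  define m where "m = {x \<in> V. x = 0 \<or> inverse x \<notin> V}"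
  have m_sum: "sum h T \<in> m" if "\<And>t. t \<in> T \<Longrightarrow> h t \<in> m" for h :: "('i \<times> 'i) \<Rightarrow> 'k" and T
    using that
  proof (induction T rule: infinite_finite_induct)
    case (insert x F)
    then show ?case using nonunits_add[OF V] subringD(6)[OF sV] unfolding m_def by auto
  qed (auto simp: m_def subringD[OF sV])
  define T where "T = {(i, j). i \<in> I \<and> j \<in> J \<and> i + j = a + b}"
  have "finite T" by (rule finite_subset[of _ "I \<times> J"]) (use I J in \<open>auto simp: T_def\<close>)
  have ab: "(a, b) \<in> T" using a b by (simp add: T_def)
  have term_m: "f i / f a * (g j / g b) \<in> m" if ij: "(i, j) \<in> T - {(a, b)}" for i j
  proof -
    have mem: "i \<in> I" "j \<in> J" "i + j = a + b" using ij by (auto simp: T_def)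
    then have nij: "f i \<noteq> 0" "g j \<noteq> 0" using I J by auto
    have V1: "f i / f a \<in> V" "g j / g b \<in> V" using a b mem by auto
    have "inverse (f i / f a * (g j / g b)) \<notin> V"
    proof
      assume inv: "inverse (f i / f a * (g j / g b)) \<in> V"
      have "f a / f i = inverse (f i / f a * (g j / g b)) * (g j / g b)"
        "g b / g j = inverse (f i / f a * (g j / g b)) * (f i / f a)"
        using nz nij by (simp_all add: field_simps)
      then have "f a / f i \<in> V" "g b / g j \<in> V" using inv V1 subringD(4)[OF sV] by metis+
      then have l: "prec a i" "prec b j" using a b mem by auto
      \<comment> \<open>Since \<open>i + j = a + b\<close>, neither inequality can be strict.\<close>
      have "prec (a + j) (i + j)" "prec (b + a) (j + a)"
        using l translation_orderD(5)[OF prec] by blast+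
      then have "a + j = a + b"
        using mem(3) translation_orderD(4)[OF prec, of "a + j" "a + b"] by (simp add: add.commute)
      then show False using ij mem(3) by auto
    qed
    moreover have "f i / f a * (g j / g b) \<in> V" using V1 subringD(4)[OF sV] by blast
    ultimately show ?thesis unfolding m_def by blast
  qed
  define c where "c = (\<Sum>(i, j)\<in>T. f i * g j)"
  define w where "w = (\<Sum>(i, j)\<in>T - {(a, b)}. f i / f a * (g j / g b))"
  have w: "w \<in> m" unfolding w_def using term_m by (intro m_sum) auto
  have "c = f a * g b + (\<Sum>(i, j)\<in>T - {(a, b)}. f i * g j)"
    unfolding c_def using sum.remove[OF \<open>finite T\<close> ab, of "\<lambda>(i, j). f i * g j"] by simp
  also have "(\<Sum>(i, j)\<in>T - {(a, b)}. f i * g j) = f a * g b * w"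
    unfolding w_def sum_distrib_left using nz by (intro sum.cong) auto
  finally have c: "c = f a * g b * (1 + w)" by (simp add: algebra_simps)
  have wm: "1 + w \<noteq> 0 \<and> inverse (1 + w) \<in> V"
  proof (rule ccontr)
    assume "\<not> ?thesis"
    moreover have "1 + w \<in> V" using w subringD[OF sV] by (simp add: m_def)
    moreover have "- w \<in> V" "- w = 0 \<or> inverse (- w) \<notin> V"
      using w subringD(5)[OF sV, of "inverse (- w)"] subringD(5)[OF sV, of w]
        unfolding m_def by auto
    ultimately show False using nonunits_add[OF V, of "1 + w" "- w"] subringD(1)[OF sV] by auto
  qed
  then have "c \<noteq> 0" using nz by (simp add: c)
  moreover have "f a * g b / c = inverse (1 + w)" using nz wm by (simp add: c inverse_eq_divide)
  then have "f a * g b / c \<in> V" using wm by simp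
  ultimately show thesis using that[OF a(1) b(1)] a b unfolding c_def T_def convolution_def by blast
qed

text \<open>
  Let \<open>V\<close> be a valuation ring that contains \<open>A\<close>. The product \<open>f i * g j\<close> is a multiple in \<open>V\<close> of
  the dominant one, and this is a multiple in \<open>V\<close> of a coefficient of the product of \<open>f\<close> and \<open>g\<close>,
  which lies in \<open>A\<close>.
\<close>

lemma kronecker_convolution:
  fixes f g :: "'i::cancel_ab_semigroup_add \<Rightarrow> 'k::field" and prec :: "'i \<Rightarrow> 'i \<Rightarrow> bool"
  assumes A: "subring A"
    and prec: "translation_order prec"
    and I: "finite I" "\<And>i. i \<in> I \<Longrightarrow> f i \<noteq> 0"
    and J: "finite J" "\<And>j. j \<in> J \<Longrightarrow> g j \<noteq> 0"
    and conv: "\<And>k. convolution I f J g k \<in> A"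
    and ij: "i \<in> I" "j \<in> J"
  shows "integral_over A (f i * g j)"
proof (rule ccontr)
  assume "\<not> ?thesis"
  then obtain V where V: "valuation_ring V" "A \<subseteq> V" "f i * g j \<notin> V"
    using valuation_ring_avoiding[OF A] by blast
  have sV: "subring V" using V(1) by (simp add: valuation_ring_def)
  obtain a b where ab: "a \<in> I" "b \<in> J" "f i / f a \<in> V" "g j / g b \<in> V"
    and c: "convolution I f J g (a + b) \<noteq> 0"
      "f a * g b / convolution I f J g (a + b) \<in> V"
    by (rule dominant_term[OF V(1) prec, of I f J g]) (use I J ij in auto)
  let ?c = "convolution I f J g (a + b)"
  have "f i * g j = (f i / f a) * (g j / g b) * (f a * g b / ?c) * ?c"
    using c(1) I(2)[OF ab(1)] J(2)[OF ab(2)] by (simp add: field_simps)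
  moreover have "?c \<in> V" using conv V(2) by blast
  moreover have "(f i / f a) * (g j / g b) * (f a * g b / ?c) * ?c \<in> V"
    by (intro subringD(4)[OF sV] ab(3,4) c(2)) fact
  ultimately have "f i * g j \<in> V" by (simp only:)
  then show False using V(3) by blast
qed

lemma kronecker_poly:
  fixes p q :: "'k::field poly"
  assumes A: "subring A" and pq: "p * q \<in> coeffs_in A"
  shows "integral_over A (coeff p i * coeff q j)"
proof (cases "coeff p i = 0 \<or> coeff q j = 0")
  case True
  then show ?thesis
    unfolding integral_over_def using subringD(1,2)[OF A]
    by (intro exI[of _ "monom 1 1"]) (auto simp: poly_monom degree_monom_eq)
next
  case False
  define I where "I r = {i. coeff r i \<noteq> 0}" for r :: "'k poly"
  have fin: "finite (I r)" for r
    by (rule finite_subset[of _ "{..degree r}"]) (auto simp: I_def le_degree)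
  have order: "translation_order ((\<le>) :: nat \<Rightarrow> nat \<Rightarrow> bool)"
    by (auto simp: translation_order_def)
  show ?thesis
  proof (rule kronecker_convolution[OF A order, of "I p" "coeff p" "I q" "coeff q"])
    fix k
    have "convolution (I p) (coeff p) (I q) (coeff q) k
        = (\<Sum>(i, j)\<in>(\<lambda>i. (i, k - i)) ` {..k}. coeff p i * coeff q j)"
      unfolding convolution_def by (intro sum.mono_neutral_left) (auto simp: I_def image_iff)
    also have "\<dots> = coeff (p * q) k"
      by (subst sum.reindex) (auto simp: inj_on_def coeff_mult)
    finally show "convolution (I p) (coeff p) (I q) (coeff q) k \<in> A"
      using pq by (simp add: coeffs_in_def)
  qed (use fin False in \<open>auto simp: I_def\<close>)
qed

abbreviation keys :: "('a \<Rightarrow>\<^sub>0 'b::zero) \<Rightarrow> 'a set" where "keys \<equiv> Poly_Mapping.keys"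
abbreviation lookup :: "('a \<Rightarrow>\<^sub>0 'b::zero) \<Rightarrow> 'a \<Rightarrow> 'b" where "lookup \<equiv> Poly_Mapping.lookup"
abbreviation single :: "'a \<Rightarrow> 'b \<Rightarrow> 'a \<Rightarrow>\<^sub>0 'b::zero" where "single \<equiv> Poly_Mapping.single"

lemma sum_single: "(\<Sum>k\<in>keys f. single k (lookup f k)) = f"
  by (rule poly_mapping_eqI)
    (simp add: lookup_sum lookup_single when_def in_keys_iff)

lemma sum_single_superset:
  "finite S \<Longrightarrow> keys f \<subseteq> S \<Longrightarrow> (\<Sum>k\<in>S. single k (lookup f k)) = f"
  by (rule poly_mapping_eqI)
    (auto simp: lookup_sum lookup_single when_def in_keys_iff)

lemma lookup_mult_pairs:
  fixes f g :: "'g::ab_group_add \<Rightarrow>\<^sub>0 'k::comm_ring_1"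
  shows "lookup (f * g) k = convolution (keys f) (lookup f) (keys g) (lookup g) k"
proof -
  have "f * g = (\<Sum>i\<in>keys f. \<Sum>j\<in>keys g. single (i + j) (lookup f i * lookup g j))"
    by (subst (1 2) sum_single[symmetric]) (simp add: sum_product mult_single)
  then have "lookup (f * g) k =
      (\<Sum>i\<in>keys f. \<Sum>j\<in>keys g. if i + j = k then lookup f i * lookup g j else 0)"
    by (simp add: lookup_sum lookup_single when_def)
  also have "\<dots> = (\<Sum>(i, j)\<in>keys f \<times> keys g. if i + j = k then lookup f i * lookup g j else 0)"
    by (simp add: sum.cartesian_product)
  also have "\<dots> = convolution (keys f) (lookup f) (keys g) (lookup g) k"
    unfolding convolution_def by (rule sum.mono_neutral_cong_right) (auto split: if_splits)
  finally show ?thesis .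
qed

lemma cone_order:
  assumes C: "total_cone (C :: 'g::ab_group_add set)" and anti: "\<And>x. x \<in> C \<Longrightarrow> - x \<in> C \<Longrightarrow> x = 0"
  shows "translation_order (\<lambda>i j. j - i \<in> C)"
proof -
  have "i = j" if "j - i \<in> C" "i - j \<in> C" for i j using anti[of "j - i"] that by simp
  moreover have "k - i \<in> C" if "j - i \<in> C" "k - j \<in> C" for i j k
    using total_coneD(2)[OF C that] by simp
  moreover have "j - i \<in> C \<or> i - j \<in> C" for i j using total_coneD(3)[OF C, of "j - i"] by simp
  ultimately show ?thesis
    unfolding translation_order_def using total_coneD(1)[OF C] by simp
qed

theorem kronecker_group_ring:
  fixes f g :: "'g::torsion_free_ab_group_add \<Rightarrow>\<^sub>0 'k::field"
  assumes A: "subring A" and fg: "\<And>k. lookup (f * g) k \<in> A"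
  shows "integral_over A (lookup f i * lookup g j)"
proof (cases "lookup f i = 0 \<or> lookup g j = 0")
  case True
  then show ?thesis
    unfolding integral_over_def using subringD(1,2)[OF A]
    by (intro exI[of _ "monom 1 1"]) (auto simp: poly_monom degree_monom_eq)
next
  case False
  obtain C :: "'g set" where C: "total_cone C" "\<And>x. x \<in> C \<Longrightarrow> - x \<in> C \<Longrightarrow> x = 0"
    using antisymmetric_total_cone by blast
  have order: "translation_order (\<lambda>i j. j - i \<in> C)" using C by (intro cone_order)
  show ?thesis
    by (rule kronecker_convolution[OF A order, of "keys f" "lookup f" "keys g" "lookup g"])
      (use False fg in \<open>auto simp: lookup_mult_pairs[symmetric] simp flip: in_keys_iff\<close>)
qed

text \<open>
  A total cone is the positive cone of a total preorder. The exponents that are least with respect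
  to a refinement of this preorder to a total order cannot cancel in the product, and all other
  sums of exponents are at least as large as their sum.
\<close>

theorem keys_mult_in_cone:
  fixes f g :: "'g::torsion_free_ab_group_add \<Rightarrow>\<^sub>0 'k::field"
  assumes P: "total_cone P" and fg: "keys (f * g) \<subseteq> P" and ij: "i \<in> keys f" "j \<in> keys g"
  shows "i + j \<in> P"
proof -
  obtain C :: "'g set" where C: "total_cone C" "\<And>x. x \<in> C \<Longrightarrow> - x \<in> C \<Longrightarrow> x = 0"
    using antisymmetric_total_cone by blast
  define Q where "Q = {x \<in> P. - x \<in> P \<longrightarrow> x \<in> C}"
  have Q: "total_cone Q"
    unfolding total_cone_def
  proof (intro conjI ballI allI)
    show "0 \<in> Q" using total_coneD(1) P C by (auto simp: Q_def)
  next
    fix x y assume xy: "x \<in> Q" "y \<in> Q"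
    have "x + y \<in> P" using xy total_coneD(2)[OF P] by (auto simp: Q_def)
    moreover have "x + y \<in> C" if "- (x + y) \<in> P"
    proof -
      have "- (x + y) + x = - y" "- (x + y) + y = - x" by simp_all
      then have "- x \<in> P" "- y \<in> P"
        using that xy total_coneD(2)[OF P] by (metis (mono_tags, lifting) Q_def mem_Collect_eq)+
      then show ?thesis using xy total_coneD(2)[OF C(1)] by (auto simp: Q_def)
    qed
    ultimately show "x + y \<in> Q" by (simp add: Q_def)
  next
    fix x show "x \<in> Q \<or> - x \<in> Q"
      using total_coneD(3)[OF P, of x] total_coneD(3)[OF C(1), of x] by (auto simp: Q_def)
  qed
  have Qa: "x = 0" if "x \<in> Q" "- x \<in> Q" for x using that C(2) by (auto simp: Q_def)
  have order: "translation_order (\<lambda>i j. j - i \<in> Q)" using Q Qa by (intro cone_order)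
  obtain a b where ab: "a \<in> keys f" "b \<in> keys g"
    "\<And>i. i \<in> keys f \<Longrightarrow> i - a \<in> Q" "\<And>j. j \<in> keys g \<Longrightarrow> j - b \<in> Q" "lookup (f * g) (a + b) \<noteq> 0"
    unfolding lookup_mult_pairs
    by (rule dominant_term[OF valuation_ring_UNIV order, of "keys f" "lookup f" "keys g"
      "lookup g"])
      (use ij in \<open>auto simp: in_keys_iff\<close>)
  have "a + b \<in> P" using ab(5) fg by (auto simp: in_keys_iff)
  moreover have "i - a \<in> P" "j - b \<in> P" using ab(3)[OF ij(1)] ab(4)[OF ij(2)] by (auto simp: Q_def)
  ultimately have "(a + b) + ((i - a) + (j - b)) \<in> P" using total_coneD(2)[OF P] by blast
  then show ?thesis by (simp add: algebra_simps)
qed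

theorem keys_mult_in_integrally_closed:
  fixes f g :: "'g::torsion_free_ab_group_add \<Rightarrow>\<^sub>0 'k::field"
  assumes \<Gamma>: "0 \<in> \<Gamma>" "\<And>x y. x \<in> \<Gamma> \<Longrightarrow> y \<in> \<Gamma> \<Longrightarrow> x + y \<in> \<Gamma>" "integrally_closed_monoid \<Gamma>"
    and "keys (f * g) \<subseteq> \<Gamma>" "i \<in> keys f" "j \<in> keys g"
  shows "i + j \<in> \<Gamma>"
proof (rule ccontr)
  assume "i + j \<notin> \<Gamma>"
  then obtain P where "total_cone P" "\<Gamma> \<subseteq> P" "i + j \<notin> P" using total_cone_avoiding \<Gamma> by metis
  then show False using keys_mult_in_cone[of P f g i j] assms by blast
qed

text \<open>
  With respect to a total order, the sum of the least exponents and the sum of the greatest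
  exponents of the two factors are both equal to \<open>k\<close>, so that each factor has one exponent only.
\<close>

theorem single_factor:
  fixes f g :: "'g::torsion_free_ab_group_add \<Rightarrow>\<^sub>0 'k::field"
  assumes fg: "f * g = single k c" "c \<noteq> 0"
  obtains i a where "a \<noteq> 0" "f = single i a"
proof -
  have nz: "f \<noteq> 0" "g \<noteq> 0"
    using fg by (metis lookup_single_eq lookup_zero mult_zero_left mult_zero_right)+
  obtain j where j: "j \<in> keys g" using nz by (metis keys_eq_empty all_not_in_conv)
  obtain i where i: "i \<in> keys f" using nz by (metis keys_eq_empty all_not_in_conv)
  obtain C :: "'g set" where C: "total_cone C" "\<And>x. x \<in> C \<Longrightarrow> - x \<in> C \<Longrightarrow> x = 0"
    using antisymmetric_total_cone by blast
  have C': "total_cone {x. - x \<in> C}"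
    unfolding total_cone_def
  proof (intro conjI ballI allI)
    show "0 \<in> {x. - x \<in> C}" using total_coneD(1)[OF C(1)] by simp
  next
    fix x y assume "x \<in> {x. - x \<in> C}" "y \<in> {x. - x \<in> C}"
    then show "x + y \<in> {x. - x \<in> C}" using total_coneD(2)[OF C(1), of "- x" "- y"] by simp
  next
    fix x show "x \<in> {x. - x \<in> C} \<or> - x \<in> {x. - x \<in> C}" using total_coneD(3)[OF C(1), of x] by auto
  qed
  define g' where "g' = g * single (- k) 1"
  have fg': "f * g' = single 0 c"
    unfolding g'_def mult.assoc[symmetric] fg(1) by (simp add: mult_single)
  have "lookup g' (j - k) = lookup g j"
  proof -
    have "lookup g' (j - k) = (\<Sum>(i, l)\<in>{(i, l). i \<in> keys g \<and> l \<in> keys (single (- k) (1::'k)) \<and> i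
      + l = j - k}.
        lookup g i * lookup (single (- k) 1)
          l)" unfolding g'_def lookup_mult_pairs convolution_def ..
    also have "{(i, l). i \<in> keys g \<and> l \<in> keys (single (- k) (1::'k)) \<and> i + l = j - k} = {(j, - k)}"
      using j by auto
    finally show ?thesis by simp
  qed
  then have j': "j - k \<in> keys g'" using j by (simp add: in_keys_iff)
  have "keys (f * g') \<subseteq> {0}" unfolding fg' by simp
  then have sub: "keys (f * g') \<subseteq> C" "keys (f * g') \<subseteq> {x. - x \<in> C}"
    using total_coneD(1)[OF C(1)] by force+
  have "l + (j - k) = 0" if l: "l \<in> keys f" for l
  proof (rule C(2))
    show "l + (j - k) \<in> C" using keys_mult_in_cone[OF C(1) sub(1) l j'] .
    show "- (l + (j - k)) \<in> C" using keys_mult_in_cone[OF C' sub(2) l j'] by simp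
  qed
  then have "l = i" if "l \<in> keys f" for l using that i by (metis add_right_cancel)
  then have "keys f = {i}" using i by blast
  then have "f = single i (lookup f i)" using sum_single[of f] by simp
  then show thesis using that[of "lookup f i" i] i by (simp add: in_keys_iff)
qed

section \<open>Laurent polynomials over a GCD domain\<close>

text \<open>
  The condition on \<open>d\<close> says \<open>(D : {a, b}) = (D : {d})\<close> within the ambient field; for \<open>x = 1 / c\<close>
  it becomes the familiar statement that the common divisors \<open>c\<close> of \<open>a\<close> and \<open>b\<close> are the divisors
  of \<open>d\<close>.
\<close>

definition gcd_domain :: "'l::field set \<Rightarrow> bool" where
  "gcd_domain D \<longleftrightarrow> subring D \<and>
     (\<forall>a\<in>D. \<forall>b\<in>D. a \<noteq> 0 \<or> b \<noteq> 0 \<longrightarrow> (\<exists>d. d \<noteq> 0 \<and> (\<forall>x. x * a \<in> D \<and> x * b \<in> D \<longleftrightarrow> x * d \<in> D)))"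

lemma gcd_domain_subring: "gcd_domain D \<Longrightarrow> subring D"
  by (simp add: gcd_domain_def)

lemma gcd_domainE:
  assumes "gcd_domain D" "a \<in> D" "b \<in> D" "a \<noteq> 0 \<or> b \<noteq> 0"
  obtains d where "d \<noteq> 0" "\<And>x. x * a \<in> D \<and> x * b \<in> D \<longleftrightarrow> x * d \<in> D"
  using assms unfolding gcd_domain_def by blast

lemma gcd_domain_finite:
  assumes D: "gcd_domain D" and "finite S" "S \<subseteq> fractions D" "\<not> S \<subseteq> {0}"
  obtains d where "d \<noteq> 0" "d \<in> fractions D" "\<And>x. (\<forall>s\<in>S. x * s \<in> D) \<longleftrightarrow> x * d \<in> D"
proof -
  have sD: "subring D" using D by (rule gcd_domain_subring)
  have "\<exists>d. d \<noteq> 0 \<and> d \<in> fractions D \<and> (\<forall>x. (\<forall>s\<in>S. x * s \<in> D) \<longleftrightarrow> x * d \<in> D)"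
    using assms(2-4)
  proof (induction S)
    case (insert a S)
    show ?case
    proof (cases "S \<subseteq> {0}")
      case True
      then have "(\<forall>s\<in>insert a S. x * s \<in> D) \<longleftrightarrow> x * a \<in> D" for x using subringD(2)[OF sD] by auto
      moreover have "a \<noteq> 0" using True insert.prems by auto
      ultimately show ?thesis using insert.prems by blast
    next
      case False
      then obtain d where d: "d \<noteq> 0" "d \<in> fractions D" "\<And>x. (\<forall>s\<in>S. x * s \<in> D) \<longleftrightarrow> x * d \<in> D"
        using insert by blast
      have "{a, d} \<subseteq> fractions D" using insert.prems d(2) by auto
      then obtain m where m: "m \<in> D" "m \<noteq> 0" "m * a \<in> D" "m * d \<in> D"
        by (rule fractions_common_denominator[OF sD, of "{a, d}", rotated]) auto
      obtain h where h: "h \<noteq> 0" "\<And>x. x * (m * a) \<in> D \<and> x * (m * d) \<in> D \<longleftrightarrow> x * h \<in> D"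
        using gcd_domainE[OF D m(3,4)] d(1) m(2) by auto
      have eq: "(\<forall>s\<in>insert a S. x * s \<in> D) \<longleftrightarrow> x * (h / m) \<in> D" for x
        using h(2)[of "x / m"] d(3)[of x] m(2) by simp
      have "inverse (h / m) * d \<in> D"
        using eq[of "inverse (h / m)"] d(3)[of "inverse (h / m)"] h(1) m(2) subringD(1)[OF sD]
          by simp
      then have "inverse (h / m) * d \<in> fractions D" using subring_subset_fractions[OF sD] by blast
      then have "d / (inverse (h / m) * d) \<in> fractions D" by (rule divide_in_fractions[OF sD d(2)])
      then have "h / m \<in> fractions D" using d(1) h(1) m(2) by (simp add: field_simps)
      then show ?thesis using eq h(1) m(2) by (intro exI[of _ "h / m"]) auto
    qed
  qed simp
  then show thesis using that by blast
qed

text \<open>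
  Write \<open>x = a / b\<close> with coprime \<open>a\<close> and \<open>b\<close>. Then \<open>a ^ n\<close> and \<open>b\<close> are coprime, too, but an
  equation of integral dependence of degree \<open>n\<close> makes \<open>b\<close> divide \<open>a ^ n\<close>.
\<close>

lemma gcd_domain_integrally_closed:
  assumes D: "gcd_domain D" and x: "x \<in> fractions D" "integral_over D x"
  shows "x \<in> D"
proof (cases "x = 0")
  case True
  then show ?thesis using subringD(2)[OF gcd_domain_subring[OF D]] by simp
next
  case False
  have sD: "subring D" using D by (rule gcd_domain_subring)
  obtain a0 b0 where ab0: "a0 \<in> D" "b0 \<in> D" "b0 \<noteq> 0" "x = a0 / b0" using x(1) by (rule fractionsE)
  obtain d where d: "d \<noteq> 0" "\<And>z. z * a0 \<in> D \<and> z * b0 \<in> D \<longleftrightarrow> z * d \<in> D"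
    using gcd_domainE[OF D ab0(1,2)] ab0(3) by auto
  define a b where "a = a0 / d" and "b = b0 / d"
  have cop: "z * a \<in> D \<and> z * b \<in> D \<longleftrightarrow> z \<in> D" for z
    using d(2)[of "z / d"] d(1) by (simp add: a_def b_def)
  have ab: "a \<in> D" "b \<in> D" "b \<noteq> 0" "x = a / b"
    using cop[of 1] subringD(1)[OF sD] ab0 d(1) by (auto simp: a_def b_def)
  have cop_power: "z \<in> D" if "z * a ^ k \<in> D" "z * b \<in> D" for z k
    using that
  proof (induction k)
    case (Suc k)
    have "(z * a ^ k) * a \<in> D" using Suc.prems(1) by (simp add: ac_simps)
    moreover have "(z * a ^ k) * b \<in> D"
      using subringD(4)[OF sD Suc.prems(2) subring_power[OF sD ab(1), of k]] by (simp add: ac_simps)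
    ultimately show ?case using cop Suc by blast
  qed simp
  obtain p where p: "lead_coeff p = 1" "\<And>i. coeff p i \<in> D" "poly p x = 0"
    using x(2) unfolding integral_over_def by blast
  define n where "n = degree p"
  have "n \<noteq> 0"
  proof
    assume "n = 0"
    then have "poly p x = 1" using p(1) unfolding n_def poly_altdef by simp
    then show False using p(3) by simp
  qed
  define c where "c = (\<Sum>i<n. coeff p i * a ^ i * b ^ (n - Suc i))"
  have "0 = b ^ n * poly p x" using p(3) by simp
  also have "\<dots> = (\<Sum>i\<le>n. coeff p i * (b ^ n * x ^ i))"
    unfolding poly_altdef n_def by (simp add: sum_distrib_left ac_simps)
  also have "\<dots> = (\<Sum>i\<le>n. coeff p i * a ^ i * b ^ (n - i))"
  proof (intro sum.cong refl)
    fix i assume "i \<in> {..n}"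
    then have "b ^ n = b ^ (n - i) * b ^ i" by (simp flip: power_add)
    then show "coeff p i * (b ^ n * x ^ i) = coeff p i * a ^ i * b ^ (n - i)"
      using ab(3) by (simp add: ab(4) power_divide)
  qed
  also have "\<dots> = (\<Sum>i<n. coeff p i * a ^ i * b ^ (n - i)) + a ^ n"
    using p(1) by (simp add: n_def flip: lessThan_Suc_atMost)
  also have "(\<Sum>i<n. coeff p i * a ^ i * b ^ (n - i)) = b * c"
    unfolding c_def sum_distrib_left
  proof (intro sum.cong refl)
    fix i assume "i \<in> {..<n}"
    then have "n - i = Suc (n - Suc i)" by simp
    then show "coeff p i * a ^ i * b ^ (n - i) = b * (coeff p i * a ^ i * b ^ (n - Suc i))" by simp
  qed
  finally have "a ^ n = - (b * c)" by (simp add: eq_neg_iff_add_eq_0 add.commute)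
  then have "inverse b * a ^ n = - c" using ab(3) by simp
  moreover have "c \<in> D"
    unfolding c_def by (intro subring_sum subringD(4) subring_power sD p(2) ab)
  ultimately have "inverse b \<in> D"
    using cop_power[of "inverse b" n] subringD(1,5)[OF sD] ab(3) by simp
  then show ?thesis using subringD(4)[OF sD ab(1)] by (simp add: ab(4) divide_inverse)
qed

definition bezout :: "'l::field set \<Rightarrow> 'l poly \<Rightarrow> 'l poly \<Rightarrow> bool" where
  "bezout F p q \<longleftrightarrow> (\<exists>h\<in>coeffs_in F. \<exists>p'\<in>coeffs_in F. \<exists>q'\<in>coeffs_in F. \<exists>u\<in>coeffs_in F. \<exists>v\<in>coeffs_in F.
     h \<noteq> 0 \<and> p = h * p' \<and> q = h * q' \<and> h = u * p + v * q)"

text \<open>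
  This is Euclid's algorithm; that \<open>F\<close> is a subfield keeps all polynomials that occur within
  \<open>F[X]\<close>.
\<close>

lemma bezout_in_subfield:
  fixes F :: "'l::field set"
  assumes F: "subring F" "\<And>x. x \<in> F \<Longrightarrow> inverse x \<in> F"
    and "p \<in> coeffs_in F" "q \<in> coeffs_in F" "p \<noteq> 0 \<or> q \<noteq> 0"
  shows "bezout F p q"
  using assms(3-5)
proof (induction "(if p = 0 then 0 else Suc (degree p)) + (if q = 0 then 0 else Suc (degree q))"
    arbitrary: p q rule: less_induct)
  case (less p q)
  have IH: "bezout F r s" if "r \<in> coeffs_in F" "s \<in> coeffs_in F" "r \<noteq> 0 \<or> s \<noteq> 0"
    "(if r = 0 then 0 else Suc (degree r)) + (if s = 0 then 0 else Suc (degree s))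
      < (if p = 0 then 0 else Suc (degree p)) + (if q = 0 then 0 else Suc (degree q))" for r s
    using less.hyps[OF that(4) that(1-3)] .
  have const: "0 \<in> coeffs_in F" "1 \<in> coeffs_in F"
    using coeffs_in_closed(4)[OF F(1) subringD(1)[OF F(1)], of 0]
      coeffs_in_closed(4)[OF F(1) subringD(2)[OF F(1)], of 0]
    by (simp_all add: monom_0 one_pCons)
  have sym: "bezout F r s" if "bezout F s r" for r s
    using that unfolding bezout_def by (metis add.commute)
  have zero: "bezout F r 0" if "r \<noteq> 0" "r \<in> coeffs_in F" for r
    unfolding bezout_def
      by (rule bexI[of _ r], rule bexI[of _ 1], rule bexI[of _ 0], rule bexI[of _ 1], rule
      bexI[of _ 0])
      (use that const in auto)
  have step: "bezout F r s"
    if rs: "r \<in> coeffs_in F" "s \<in> coeffs_in F" "m \<in> coeffs_in F" "bezout F (r - m * s) s" for r s m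
  proof -
    obtain h r' s' u v where *: "h \<in> coeffs_in F" "r' \<in> coeffs_in F" "s' \<in> coeffs_in F"
      "u \<in> coeffs_in F"
      "v \<in> coeffs_in F" "h \<noteq> 0" "r - m * s = h * r'" "s = h * s'" "h = u * (r - m * s) + v * s"
      using rs(4) unfolding bezout_def by blast
    have ms: "m * s = h * (m * s')" by (subst *(8)) (simp only: ac_simps)
    have "r = (r - m * s) + m * s" by simp
    also have "\<dots> = h * r' + h * (m * s')" by (rule arg_cong2[of _ _ _ _ "(+)", OF *(7) ms])
    also have "\<dots> = h * (r' + m * s')" by (simp only: distrib_left)
    finally have "r = h * (r' + m * s')" .
    moreover have "h = u * r + (v - u * m) * s" using *(9) by (simp add: algebra_simps)
    moreover have "r' + m * s' \<in> coeffs_in F" "v - u * m \<in> coeffs_in F"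
      by (intro coeffs_in_closed[OF F(1)] *(2-5) rs(3))+
    ultimately show ?thesis unfolding bezout_def using *(1-6,8) by blast
  qed
  have reduce: "\<exists>m\<in>coeffs_in F. r = m * s \<or> degree (r - m * s) < degree r"
    if rs: "r \<in> coeffs_in F" "s \<in> coeffs_in F" "r \<noteq> 0" "s \<noteq> 0" "degree s \<le> degree r" for r s
  proof -
    define m where "m = monom (lead_coeff r / lead_coeff s) (degree r - degree s)"
    have "lead_coeff r / lead_coeff s \<in> F"
      using rs F subringD(4)[OF F(1)] unfolding divide_inverse coeffs_in_def by blast
    then have m: "m \<in> coeffs_in F" unfolding m_def by (intro coeffs_in_closed(4)[OF F(1)])
    have "lead_coeff r / lead_coeff s \<noteq> 0" using rs by simp
    then have "degree m = degree r - degree s" unfolding m_def by (rule degree_monom_eq)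
    moreover have "m \<noteq> 0"
      using \<open>lead_coeff r / lead_coeff s \<noteq> 0\<close> by (simp only: m_def monom_eq_0_iff not_False_eq_True)
    ultimately have dm: "degree (m * s) = degree r" using rs by (simp add: degree_mult_eq)
    have "lead_coeff (m * s) = lead_coeff r"
    proof -
      have "lead_coeff m = lead_coeff r / lead_coeff s" unfolding m_def by (rule lead_coeff_monom)
      then show ?thesis unfolding lead_coeff_mult using rs(4) by simp
    qed
    then have c0: "coeff (r - m * s) (degree r) = 0" using dm by simp
    have "degree (r - m * s) \<le> degree r" using dm by (intro degree_diff_le) auto
    then have "r = m * s \<or> degree (r - m * s) < degree r"
      using c0 by (metis eq_iff_diff_eq_0 leading_coeff_0_iff le_neq_implies_less)
    then show ?thesis using m by blast
  qed
  have half: "bezout F r s"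
    if rs: "r \<in> coeffs_in F" "s \<in> coeffs_in F" "r \<noteq> 0" "s \<noteq> 0" "degree s \<le> degree r"
      and le: "Suc (degree r) + Suc (degree s)
        \<le> (if p = 0 then 0 else Suc (degree p)) + (if q = 0 then 0 else Suc (degree q))" for r s
  proof -
    obtain m where m: "m \<in> coeffs_in F" "r = m * s \<or> degree (r - m * s) < degree r"
      using reduce[OF rs] by blast
    have "bezout F (r - m * s) s"
    proof (rule IH)
      show "(if r - m * s = 0 then 0 else Suc (degree (r - m * s))) + (if s = 0 then 0 else
        Suc (degree s))
        < (if p = 0 then 0 else Suc (degree p)) + (if q = 0 then 0 else Suc (degree q))"
        using m(2) rs(4) le by auto
    qed (use rs m coeffs_in_closed[OF F(1)] in auto)
    then show ?thesis using step[OF rs(1,2) m(1)] by blast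
  qed
  have "bezout F p q"
  proof (cases "p = 0 \<or> q = 0")
    case True
    then show ?thesis using zero sym less.prems by metis
  next
    case False
    show ?thesis
    proof (cases "degree q \<le> degree p")
      case True
      then show ?thesis using half[of p q] less.prems False by auto
    next
      case not_le: False
      then show ?thesis using sym[OF half[of q p]] less.prems False by auto
    qed
  qed
  then show ?case .
qed

definition laurent :: "'l::field set \<Rightarrow> 'l \<Rightarrow> 'l set" where
  "laurent D t = {poly p t / t ^ n | p n. p \<in> coeffs_in D}"

lemma laurentI: "p \<in> coeffs_in D \<Longrightarrow> poly p t / t ^ n \<in> laurent D t"
  unfolding laurent_def by blast

lemma laurent_common_power:
  assumes D: "subring D" and t: "t \<noteq> 0" and "x \<in> laurent D t" "y \<in> laurent D t"
  obtains p q n where "p \<in> coeffs_in D" "q \<in> coeffs_in D" "x = poly p t / t ^ n"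
    "y = poly q t / t ^ n"
proof -
  obtain p n where p: "p \<in> coeffs_in D" "x = poly p t / t ^ n"
    using assms unfolding laurent_def by blast
  obtain q m where q: "q \<in> coeffs_in D" "y = poly q t / t ^ m"
    using assms unfolding laurent_def by blast
  have one: "1 \<in> D" by (rule subringD(1)[OF D])
  show thesis
  proof (rule that[of "monom 1 m * p" "monom 1 n * q" "n + m"])
    show "monom 1 m * p \<in> coeffs_in D" "monom 1 n * q \<in> coeffs_in D"
      using p q coeffs_in_closed[OF D] one by simp_all
    show "x = poly (monom 1 m * p) t / t ^ (n + m)" "y = poly (monom 1 n * q) t / t ^ (n + m)"
      using p q t by (simp_all add: poly_monom power_add)
  qed
qed

lemma subring_laurent:
  assumes D: "subring D" and t: "t \<noteq> 0" shows "subring (laurent D t)"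
  unfolding subring_def
proof (intro conjI ballI)
  have "(1 :: 'a poly) \<in> coeffs_in D"
    using coeffs_in_closed(4)[OF D subringD(1)[OF D], of 0] by (simp add: monom_0 one_pCons)
  then show "1 \<in> laurent D t" using laurentI[of 1 D t 0] by simp
next
  fix x y assume "x \<in> laurent D t" "y \<in> laurent D t"
  then obtain p q n where p: "p \<in> coeffs_in D" "q \<in> coeffs_in D" "x = poly p t / t ^ n"
    "y = poly q t / t ^ n"
    using laurent_common_power[OF D t] by blast
  have "x - y = poly (p - q) t / t ^ n" using p by (simp add: diff_divide_distrib)
  then show "x - y \<in> laurent D t" using laurentI coeffs_in_closed(2)[OF D p(1,2)] by metis
  have "x * y = poly (p * q) t / t ^ (n + n)" using p by (simp add: power_add)
  then show "x * y \<in> laurent D t" using laurentI coeffs_in_closed(3)[OF D p(1,2)] by metis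
qed

definition transcendental :: "'l::field set \<Rightarrow> 'l \<Rightarrow> bool" where
  "transcendental D t \<longleftrightarrow> (\<forall>p\<in>coeffs_in D. poly p t = 0 \<longrightarrow> p = 0)"

lemma transcendental_fractions:
  assumes D: "subring D" and t: "transcendental D t" shows "transcendental (fractions D) t"
  unfolding transcendental_def
proof (intro ballI impI)
  fix p assume p: "p \<in> coeffs_in (fractions D)" "poly p t = 0"
  obtain m where m: "m \<in> D" "m \<noteq> 0" "\<And>s. s \<in> coeff p ` {..degree p} \<Longrightarrow> m * s \<in> D"
    using fractions_common_denominator[OF D, of "coeff p ` {..degree p}"] p(1)
      by (auto simp: coeffs_in_def)
  have "coeff (smult m p) i \<in> D" for i
    using m(3) subringD(2)[OF D] by (cases "i \<le> degree p") (auto simp: coeff_eq_0)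
  then have "smult m p \<in> coeffs_in D" by (simp add: coeffs_in_def)
  moreover have "poly (smult m p) t = 0" using p(2) by simp
  ultimately have "smult m p = 0" using t unfolding transcendental_def by blast
  then show "p = 0" using m(2) by simp
qed

text \<open>
  This is Gauss's lemma, with a greatest common divisor \<open>e\<close> of all coefficients of \<open>p\<close> and \<open>q\<close>. If
  \<open>w p\<close> and \<open>w q\<close> have coefficients in \<open>D\<close>, then by Kronecker's theorem so do all products of a
  coefficient of \<open>w\<close> with one of \<open>p\<close> or \<open>q\<close>, because \<open>D\<close> is integrally closed in its field of
  fractions.
\<close>

lemma gauss_content:
  assumes D: "gcd_domain D" and p: "p \<in> coeffs_in (fractions D)" "q \<in> coeffs_in (fractions D)"
    "p \<noteq> 0 \<or> q \<noteq> 0"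
  obtains e where "e \<noteq> 0"
    "\<And>w. w \<in> coeffs_in (fractions D) \<Longrightarrow> w * p \<in> coeffs_in D \<Longrightarrow> w * q \<in> coeffs_in D \<Longrightarrow> smult e w \<in>
      coeffs_in D"
    "\<And>w. smult e w \<in> coeffs_in D \<Longrightarrow> w * p \<in> coeffs_in D \<and> w * q \<in> coeffs_in D"
proof -
  have sD: "subring D" using D by (rule gcd_domain_subring)
  define S where "S = coeff p ` {..degree p} \<union> coeff q ` {..degree q}"
  have S: "finite S" "S \<subseteq> fractions D" using p(1,2) by (auto simp: S_def coeffs_in_def)
  have "\<not> S \<subseteq> {0}"
  proof -
    have "lead_coeff p \<in> S" "lead_coeff q \<in> S" by (auto simp: S_def)
    moreover have "lead_coeff p \<noteq> 0 \<or> lead_coeff q \<noteq> 0" using p(3) by simp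
    ultimately show ?thesis by blast
  qed
  then obtain e where e: "e \<noteq> 0" "\<And>x. (\<forall>s\<in>S. x * s \<in> D) \<longleftrightarrow> x * e \<in> D"
    using gcd_domain_finite[OF D S] by blast
  have coeff_S: "(\<forall>s\<in>S. x * s \<in> D) \<longleftrightarrow> (\<forall>i. x * coeff p i \<in> D \<and> x * coeff q i \<in> D)" for x
  proof -
    have "x * coeff p i \<in> D" if "\<forall>s\<in>S. x * s \<in> D" for i
      using that subringD(2)[OF sD] by (cases "i \<le> degree p") (auto simp: S_def coeff_eq_0)
    moreover have "x * coeff q i \<in> D" if "\<forall>s\<in>S. x * s \<in> D" for i
      using that subringD(2)[OF sD] by (cases "i \<le> degree q") (auto simp: S_def coeff_eq_0)
    ultimately show ?thesis by (auto simp: S_def)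
  qed
  show thesis
  proof (rule that[OF e(1)])
    fix w assume w: "w \<in> coeffs_in (fractions D)" "w * p \<in> coeffs_in D" "w * q \<in> coeffs_in D"
    have "coeff w i * coeff p j \<in> D \<and> coeff w i * coeff q j \<in> D" for i j
    proof -
      have "coeff w i * coeff p j \<in> fractions D" "coeff w i * coeff q j \<in> fractions D"
        using w(1) p(1,2) subringD(4)[OF subring_fractions[OF sD]] by (auto simp: coeffs_in_def)
      then show ?thesis
        using gcd_domain_integrally_closed[OF D] kronecker_poly[OF sD w(2)]
          kronecker_poly[OF sD w(3)] by blast
    qed
    then have "coeff w i * e \<in> D" for i using e(2)[of "coeff w i"] coeff_S[of "coeff w i"] by blast
    then show "smult e w \<in> coeffs_in D" by (simp add: coeffs_in_def mult.commute)
  next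
    fix w assume w: "smult e w \<in> coeffs_in D"
    then have "coeff w i * e \<in> D" for i by (simp add: coeffs_in_def mult.commute)
    then have "coeff w i * coeff p j \<in> D \<and> coeff w i * coeff q j \<in> D" for i j
      using e(2)[of "coeff w i"] coeff_S[of "coeff w i"] by blast
    then show "w * p \<in> coeffs_in D \<and> w * q \<in> coeffs_in D"
      by (simp add: coeffs_in_def coeff_mult subring_sum[OF sD])
  qed
qed

text \<open>
  A greatest common divisor of \<open>p(t)\<close> and \<open>q(t)\<close> is \<open>e h(t)\<close>, where \<open>h\<close> is one over the field of
  fractions of \<open>D\<close> and \<open>e\<close> is the content of the two cofactors of \<open>h\<close>.
\<close>

theorem gcd_domain_laurent:
  assumes D: "gcd_domain D" and tr: "transcendental D t" and t: "t \<noteq> 0"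
  shows "gcd_domain (laurent D t)"
  unfolding gcd_domain_def
proof (intro conjI ballI impI)
  have sD: "subring D" using D by (rule gcd_domain_subring)
  define F where "F = fractions D"
  have sF: "subring F" and DF: "D \<subseteq> F" and invF: "\<And>x. x \<in> F \<Longrightarrow> inverse x \<in> F"
    unfolding F_def
      using subring_fractions[OF sD] subring_subset_fractions[OF sD] inverse_in_fractions[OF sD]
      by auto
  have cDF: "p \<in> coeffs_in F" if "p \<in> coeffs_in D" for p using that DF by (auto simp: coeffs_in_def)
  have inj: "p = q" if "poly p t = poly q t" "p \<in> coeffs_in F" "q \<in> coeffs_in F" for p q
  proof -
    have "p - q \<in> coeffs_in F" "poly (p - q) t = 0" using that coeffs_in_closed(2)[OF sF] by auto
    then have "p - q = 0"
      using transcendental_fractions[OF sD tr] unfolding transcendental_def F_def by blast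
    then show ?thesis by simp
  qed
  show "subring (laurent D t)" by (rule subring_laurent[OF sD t])
  fix a b assume "a \<in> laurent D t" "b \<in> laurent D t" and nz: "a \<noteq> 0 \<or> b \<noteq> 0"
  then obtain p q n where pq: "p \<in> coeffs_in D" "q \<in> coeffs_in D" "a = poly p t / t ^ n"
    "b = poly q t / t ^ n"
    using laurent_common_power[OF sD t] by blast
  have "p \<noteq> 0 \<or> q \<noteq> 0" using nz pq by auto
  then have "bezout F p q" by (intro bezout_in_subfield sF invF cDF pq)
  then obtain h p' q' u v where h: "h \<in> coeffs_in F" "p' \<in> coeffs_in F" "q' \<in> coeffs_in F"
    "u \<in> coeffs_in F"
    "v \<in> coeffs_in F" "h \<noteq> 0" "p = h * p'" "q = h * q'" "h = u * p + v * q"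
    unfolding bezout_def by blast
  have "p' \<noteq> 0 \<or> q' \<noteq> 0" using h(7,8) \<open>p \<noteq> 0 \<or> q \<noteq> 0\<close> mult_zero_right[of h] by metis
  then obtain e where e: "e \<noteq> 0"
    "\<And>w. w \<in> coeffs_in F \<Longrightarrow> w * p' \<in> coeffs_in D \<Longrightarrow> w * q' \<in> coeffs_in D \<Longrightarrow> smult e w \<in> coeffs_in D"
    "\<And>w. smult e w \<in> coeffs_in D \<Longrightarrow> w * p' \<in> coeffs_in D \<and> w * q' \<in> coeffs_in D"
    using gauss_content[OF D, of p' q'] h(2,3) unfolding F_def by blast
  have ht: "poly h t \<noteq> 0" using inj[of h 0] h(1,6) subringD(2)[OF sF] by (auto simp: coeffs_in_def)
  show "\<exists>d. d \<noteq> 0 \<and> (\<forall>x. x * a \<in> laurent D t \<and> x * b \<in> laurent D t \<longleftrightarrow> x * d \<in> laurent D t)"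
  proof (intro exI[of _ "poly h t * e / t ^ n"] conjI allI iffI)
    show "poly h t * e / t ^ n \<noteq> 0" using ht e(1) t by simp
  next
    fix x assume "x * a \<in> laurent D t \<and> x * b \<in> laurent D t"
    then obtain r s m where rs: "r \<in> coeffs_in D" "s \<in> coeffs_in D" "x * a = poly r t / t ^ m"
      "x * b = poly s t / t ^ m"
      using laurent_common_power[OF sD t] by blast
    define w where "w = u * r + v * s"
    have w: "w \<in> coeffs_in F"
      unfolding w_def by (intro coeffs_in_closed[OF sF] h cDF rs)
    have xp: "x * poly p t * t ^ m = t ^ n * poly r t"
      using rs(3) t unfolding pq(3) by (simp add: field_simps)
    have xq: "x * poly q t * t ^ m = t ^ n * poly s t"
      using rs(4) t unfolding pq(4) by (simp add: field_simps)
    \<comment> \<open>As \<open>h\<close> is a combination of \<open>p\<close> and \<open>q\<close>, also \<open>x h(t)\<close> is a Laurent polynomial, with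
      coefficients in \<open>F\<close>.\<close>
    have xh: "x * poly h t * t ^ m = t ^ n * poly w t"
    proof -
      have "x * poly h t * t ^ m = poly u t * (x * poly p t * t ^ m) + poly v t * (x * poly
        q t * t ^ m)"
        by (subst h(9)) (simp add: algebra_simps)
      also have "\<dots> = t ^ n * poly w t" unfolding xp xq w_def by (simp add: algebra_simps)
      finally show ?thesis .
    qed
    have "t ^ n * poly r t = (x * poly h t * t ^ m) * poly p' t"
      "t ^ n * poly s t = (x * poly h t * t ^ m) * poly q' t"
      unfolding xp[symmetric] xq[symmetric]
        by (subst h(7), simp add: ac_simps, subst h(8), simp add: ac_simps)
    then have "poly r t = poly (w * p') t" "poly s t = poly (w * q') t"
      unfolding xh using t by (simp_all add: ac_simps)
    then have "r = w * p'" "s = w * q'"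
      by (intro inj cDF rs coeffs_in_closed(3)[OF sF] w h; simp)+
    then have "smult e w \<in> coeffs_in D" using e(2)[OF w] rs by simp
    moreover have "x * (poly h t * e / t ^ n) = poly (smult e w) t / t ^ m"
      using xh t by (simp add: field_simps)
    ultimately show "x * (poly h t * e / t ^ n) \<in> laurent D t" using laurentI by metis
  next
    fix x assume "x * (poly h t * e / t ^ n) \<in> laurent D t"
    then obtain r m where r: "r \<in> coeffs_in D" "x * (poly h t * e / t ^ n) = poly r t / t ^ m"
      unfolding laurent_def by blast
    define w where "w = smult (inverse e) r"
    have "smult e w = r" using e(1) by (simp add: w_def)
    then have w: "w * p' \<in> coeffs_in D" "w * q' \<in> coeffs_in D" using e(3)[of w] r by auto
    have xh: "x * poly h t / t ^ n = poly w t / t ^ m"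
      using r(2) e(1) t by (simp add: w_def field_simps)
    have "x * a = (x * poly h t / t ^ n) * poly p' t" "x * b = (x * poly h t / t ^ n) * poly q' t"
      unfolding pq(3,4) by (subst h(7), simp, subst h(8), simp)
    then have "x * a = poly (w * p') t / t ^ m" "x * b = poly (w * q') t / t ^ m"
      unfolding xh by simp_all
    then show "x * a \<in> laurent D t" "x * b \<in> laurent D t" using laurentI w by metis+
  qed
qed

section \<open>Finitely generated torsion-free groups are free\<close>

definition additive_subgroup :: "'g::ab_group_add set \<Rightarrow> bool" where
  "additive_subgroup H \<longleftrightarrow> 0 \<in> H \<and> (\<forall>x\<in>H. \<forall>y\<in>H. x - y \<in> H)"

lemma additive_subgroupD:
  assumes "additive_subgroup H"
  shows "0 \<in> H" "x \<in> H \<Longrightarrow> y \<in> H \<Longrightarrow> x - y \<in> H" "x \<in> H \<Longrightarrow> - x \<in> H"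
    "x \<in> H \<Longrightarrow> y \<in> H \<Longrightarrow> x + y \<in> H"
proof -
  show zero: "0 \<in> H" and diff: "\<And>x y. x \<in> H \<Longrightarrow> y \<in> H \<Longrightarrow> x - y \<in> H"
    using assms by (auto simp: additive_subgroup_def)
  show neg: "\<And>x. x \<in> H \<Longrightarrow> - x \<in> H" using diff[OF zero] by fastforce
  show "x \<in> H \<Longrightarrow> y \<in> H \<Longrightarrow> x + y \<in> H" using diff[of x "- y"] neg[of y] by simp
qed

abbreviation multiple :: "nat \<Rightarrow> 'g::comm_monoid_add \<Rightarrow> 'g" where
  "multiple n x \<equiv> (\<Sum>i<n. x)"

lemma multiple_in_subgroup: "additive_subgroup H \<Longrightarrow> x \<in> H \<Longrightarrow> multiple n x \<in> H"
  by (intro multiple_mem additive_subgroupD)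

definition int_multiple :: "int \<Rightarrow> 'g::ab_group_add \<Rightarrow> 'g" where
  "int_multiple k x = multiple (nat k) x - multiple (nat (- k)) x"

lemma int_multiple_diff_nat: "int_multiple (int m - int n) x = multiple m x - multiple n x"
proof -
  have "nat (int m - int n) + n = m + nat (- (int m - int n))" by simp
  then have "multiple (nat (int m - int n)) x + multiple n x = multiple m x + multiple (nat (-
    (int m - int n))) x"
    by (metis multiple_add)
  then show ?thesis unfolding int_multiple_def by (simp add: algebra_simps)
qed

lemma int_multiple_simps:
  "int_multiple 0 x = 0" "int_multiple 1 x = x" "int_multiple (- 1) x = - x" "int_multiple k 0 = 0"
  "int_multiple (int n) x = multiple n x"
  by (simp_all add: int_multiple_def)

lemma int_multiple_diff: "int_multiple (k - l) x = int_multiple k x - int_multiple l x"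
proof -
  have "k - l = int (nat k + nat (- l)) - int (nat (- k) + nat l)" by simp
  then have "int_multiple (k - l) x = multiple (nat k + nat (- l)) x - multiple (nat (-
    k) + nat l) x"
    by (metis int_multiple_diff_nat)
  then show ?thesis unfolding multiple_add int_multiple_def by (simp add: algebra_simps)
qed

lemma int_multiple_minus: "int_multiple (- k) x = - int_multiple k x"
  using int_multiple_diff[of 0 k x] by (simp add: int_multiple_simps)

lemma int_multiple_add: "int_multiple (k + l) x = int_multiple k x + int_multiple l x"
  using int_multiple_diff[of k "- l" x] by (simp add: int_multiple_minus)

lemma int_multiple_diff_right: "int_multiple k (x - y) = int_multiple k x - int_multiple k y"
  by (simp add: int_multiple_def sum_subtractf algebra_simps)

lemma int_multiple_add_right: "int_multiple k (x + y) = int_multiple k x + int_multiple k y"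
  using int_multiple_diff_right[of k "x + y" y] by (simp add: algebra_simps)

lemma int_multiple_eq_0:
  fixes x :: "'g::torsion_free_ab_group_add"
  assumes "int_multiple k x = 0" "k \<noteq> 0" shows "x = 0"
proof (cases "k > 0")
  case True
  then have "multiple (nat k) x = 0" using assms by (simp add: int_multiple_def)
  then show ?thesis using torsion_free[of "nat k" x] True by simp
next
  case False
  then have "multiple (nat (- k)) x = 0" using assms by (simp add: int_multiple_def)
  then show ?thesis using torsion_free[of "nat (- k)" x] False assms(2) by simp
qed

lemma int_multiple_in_subgroup: "additive_subgroup H \<Longrightarrow> x \<in> H \<Longrightarrow> int_multiple k x \<in> H"
  unfolding int_multiple_def by (intro additive_subgroupD(2) multiple_in_subgroup)

definition combination :: "'g::ab_group_add set \<Rightarrow> ('g \<Rightarrow> int) \<Rightarrow> 'g" where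
  "combination T m = (\<Sum>x\<in>T. int_multiple (m x) x)"

definition generated :: "'g::ab_group_add set \<Rightarrow> 'g set" where
  "generated T = range (combination T)"

definition independent :: "'g::ab_group_add set \<Rightarrow> bool" where
  "independent T \<longleftrightarrow> (\<forall>m. combination T m = 0 \<longrightarrow> (\<forall>x\<in>T. m x = 0))"

lemma additive_subgroup_generated: "additive_subgroup (generated T)"
proof -
  have "combination T m - combination T n = combination T (\<lambda>x. m x - n x)" for m n
    by (simp add: combination_def int_multiple_diff sum_subtractf)
  then have "x - y \<in> generated T" if "x \<in> generated T" "y \<in> generated T" for x y
    using that unfolding generated_def by auto
  moreover have "combination T (\<lambda>_. 0) = 0" by (simp add: combination_def int_multiple_simps)
  then have "0 \<in> generated T" unfolding generated_def by (metis rangeI)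
  ultimately show ?thesis unfolding additive_subgroup_def by blast
qed

lemma sum_in_subgroup: "additive_subgroup H \<Longrightarrow> (\<And>i. i \<in> I \<Longrightarrow> f i \<in> H) \<Longrightarrow> sum f I \<in> H"
  by (induction I rule: infinite_finite_induct) (auto simp: additive_subgroupD)

lemma generated_least: "additive_subgroup H \<Longrightarrow> T \<subseteq> H \<Longrightarrow> generated T \<subseteq> H"
  unfolding generated_def combination_def by (auto intro!: sum_in_subgroup int_multiple_in_subgroup)

lemma generated_superset:
  assumes "finite T" shows "T \<subseteq> generated T"
proof
  fix x assume x: "x \<in> T"
  have "combination T (\<lambda>y. if y = x then 1 else 0) = (\<Sum>y\<in>T. if y = x then x else 0)"
    unfolding combination_def by (intro sum.cong) (auto simp: int_multiple_simps)
  also have "\<dots> = x" using x assms by simp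
  finally show "x \<in> generated T" unfolding generated_def by (metis rangeI)
qed

lemma generated_subset: "finite T' \<Longrightarrow> T \<subseteq> generated T' \<Longrightarrow> generated T \<subseteq> generated T'"
  by (rule generated_least[OF additive_subgroup_generated])

lemma combination_insert:
  "finite T \<Longrightarrow> x \<notin> T \<Longrightarrow> combination (insert x T) m = int_multiple (m x) x + combination T m"
  by (simp add: combination_def)

lemma combination_cong: "(\<And>x. x \<in> T \<Longrightarrow> m x = n x) \<Longrightarrow> combination T m = combination T n"
  by (simp add: combination_def)

text \<open>
  A generating set of least cardinality is independent: as in the Euclidean algorithm, a relation
  with two nonzero coefficients can be replaced by one with smaller coefficients, and a relation
  with a single nonzero coefficient shows that a generator is \<open>0\<close>.
\<close>

theorem independent_generators:
  fixes S :: "'g::torsion_free_ab_group_add set"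
  assumes "finite S"
  obtains T where "finite T" "S \<subseteq> generated T" "independent T"
proof -
  define gens where "gens T \<longleftrightarrow> finite T \<and> S \<subseteq> generated T" for T
  \<comment> \<open>The least number of generators; \<open>no_relation\<close> excludes a relation
    by induction on the sum of its absolute coefficients.\<close>
  define n where "n = (LEAST n. \<exists>T. gens T \<and> card T = n)"
  have "\<exists>n T. gens T \<and> card T = n" using assms generated_superset by (auto simp: gens_def)
  then have "\<exists>T. gens T \<and> card T = n" unfolding n_def by (rule LeastI_ex)
  then obtain T where T: "gens T" "card T = n" by blast
  have least: "n \<le> card U" if "gens U" for U unfolding n_def by (rule Least_le) (use that in blast)
  have no_relation: False
    if "gens U" "card U = n" "combination U m = 0" "x \<in> U" "m x \<noteq> 0" for U m x
    using that
  proof (induction "\<Sum>x\<in>U. nat \<bar>m x\<bar>" arbitrary: U m x rule: less_induct)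
    case less
    have fin: "finite U" and SU: "S \<subseteq> generated U" using less.prems(1) by (auto simp: gens_def)
    show False
    proof (cases "\<exists>y\<in>U. y \<noteq> x \<and> m y \<noteq> 0")
      case False
      have "combination U m = int_multiple (m x) x + combination (U - {x}) m"
        using combination_insert[of "U - {x}" x m] fin less.prems(4) by (simp add: insert_absorb)
      also have "combination (U - {x}) m = combination (U - {x}) (\<lambda>_. 0)"
        using False by (intro combination_cong) auto
      also have "\<dots> = 0" by (simp add: combination_def int_multiple_simps)
      finally have "x = 0" using less.prems(3,5) int_multiple_eq_0 by auto
      then have "U \<subseteq> generated (U - {x})"
        using generated_superset[of "U - {x}"] fin
          additive_subgroupD(1)[OF additive_subgroup_generated, of "U - {x}"]
        by auto
      then have "gens (U - {x})"
        using SU generated_subset[of "U - {x}" U] fin by (auto simp: gens_def)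
      then show False using least less.prems(2,4) fin by (metis card_Diff1_less not_less)
    next
      case True
      have reduce: False if x: "x \<in> U" "m x \<noteq> 0" and y: "y \<in> U" "m y \<noteq> 0" "y \<noteq> x" "\<bar>m y\<bar> \<le> \<bar>m x\<bar>"
        for x y
      proof -
        \<comment> \<open>With this sign, replacing the generator \<open>y\<close>
          by \<open>y + s x\<close> lowers the coefficient of \<open>x\<close> in absolute value.\<close>
        define s where "s = sgn (m x) * sgn (m y)"
        have s: "s = 1 \<or> s = - 1" "\<bar>m x - s * m y\<bar> = \<bar>m x\<bar> - \<bar>m y\<bar>"
          using x y by (auto simp: s_def sgn_if)
        define z where "z = y + int_multiple s x"
        define V where "V = U - {x, y}"
        have U: "U = insert x (insert y V)" and V: "finite V" "x \<notin> V" "y \<notin> V"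
          using x y fin by (auto simp: V_def)
        have xW: "x \<in> insert x V" "finite (insert x V)" using V by auto
        let ?U' = "insert z (insert x V)"
        have "y = z - int_multiple s x" by (simp add: z_def)
        then have "y \<in> generated ?U'"
          using generated_superset[of ?U'] V
          by (auto intro!: additive_subgroupD(2)[OF additive_subgroup_generated]
              int_multiple_in_subgroup[OF additive_subgroup_generated])
        then have "U \<subseteq> generated ?U'" using generated_superset[of ?U'] V by (auto simp: U)
        then have gens': "gens ?U'" using SU generated_subset[of ?U' U] V by (auto simp: gens_def)
        have cardU: "card U = Suc (Suc (card V))" using U V y by simp
        show False
        proof (cases "z \<in> insert x V")
          case True
          then have "card ?U' < card U" using V cardU by (simp add: insert_absorb)
          then show False using least[OF gens'] less.prems(2) by simp
        next
          case False
          define m' where "m' = m(x := m x - s * m y, z := m y)"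
          have "card ?U' = n" using False V cardU less.prems(2) by simp
          moreover have "combination ?U' m' = 0"
          proof -
            have "int_multiple s (int_multiple (m y) x) = int_multiple (s * m y) x"
              using s(1) by (auto simp: int_multiple_simps int_multiple_minus)
            moreover have "int_multiple (m y) (int_multiple s x) = int_multiple s
              (int_multiple (m y) x)"
              using s(1) int_multiple_diff_right[of "m y" 0 x]
              by (auto simp: int_multiple_simps int_multiple_minus)
            ultimately have z: "int_multiple (m y) z = int_multiple (m y) y + int_multiple
              (s * m y) x"
              unfolding z_def int_multiple_add_right by simp
            have "combination ?U' m' = int_multiple (m y) z + (int_multiple (m x - s * m y) x +
              combination V m')"
            proof -
              have "x \<noteq> z" "z \<notin> V" using False by auto
              then show ?thesis using V by (simp add: combination_insert m'_def)
            qed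
            also have "combination V m' = combination V m"
              using False V by (intro combination_cong) (auto simp: m'_def)
            also have "int_multiple (m y) z + (int_multiple (m x - s * m y) x + combination V m)
                = int_multiple (m x) x + (int_multiple (m y) y + combination V m)"
              unfolding z int_multiple_diff by (simp add: algebra_simps)
            also have "\<dots> = combination U m"
              unfolding U using V y(3) by (simp add: combination_insert)
            finally show ?thesis using less.prems(3) by simp
          qed
          moreover have "(\<Sum>x\<in>?U'. nat \<bar>m' x\<bar>) < (\<Sum>x\<in>U. nat \<bar>m x\<bar>)"
          proof -
            have "(\<Sum>x\<in>?U'. nat \<bar>m' x\<bar>) = nat \<bar>m y\<bar> + (nat \<bar>m x - s * m y\<bar> + (\<Sum>x\<in>V. nat \<bar>m' x\<bar>))"
            proof -
              have "x \<noteq> z" "z \<notin> V" using False by auto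
              then show ?thesis using V by (simp add: m'_def)
            qed
            also have "(\<Sum>x\<in>V. nat \<bar>m' x\<bar>) = (\<Sum>x\<in>V. nat \<bar>m x\<bar>)"
              using False V by (intro sum.cong) (auto simp: m'_def)
            also have "nat \<bar>m x - s * m y\<bar> < nat \<bar>m x\<bar>" using s(2) y(2) x(2) by simp
            also have "nat \<bar>m y\<bar> + (nat \<bar>m x\<bar> + (\<Sum>x\<in>V. nat \<bar>m x\<bar>)) = (\<Sum>x\<in>U. nat \<bar>m x\<bar>)"
              unfolding U using V y(3) by simp
            finally show ?thesis by simp
          qed
          moreover have "m' z \<noteq> 0" using y(2) by (simp add: m'_def)
          ultimately show False using less.hyps[of m' ?U' z] gens' by blast
        qed
      qed
      obtain y where y: "y \<in> U" "y \<noteq> x" "m y \<noteq> 0" using True by blast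
      then show False using reduce[of x y] reduce[of y x] less.prems(4,5) by fastforce
    qed
  qed
  have "independent T" using no_relation T unfolding independent_def by blast
  then show thesis using that T by (auto simp: gens_def)
qed

lemma independent_subset:
  assumes "independent T" "U \<subseteq> T" "finite T" shows "independent U"
  unfolding independent_def
proof (intro allI impI ballI)
  fix m x assume m: "combination U m = 0" and x: "x \<in> U"
  have "combination T (\<lambda>x. if x \<in> U then m x else 0) = combination U (\<lambda>x. if x \<in> U then m x else 0)"
    unfolding combination_def
      by (rule sum.mono_neutral_right) (use assms in \<open>auto simp: int_multiple_simps\<close>)
  also have "\<dots> = combination U m" by (rule combination_cong) simp
  finally have "combination T (\<lambda>x. if x \<in> U then m x else 0) = 0" using m by simp
  then have "\<forall>y\<in>T. (if y \<in> U then m y else 0) = 0" using assms(1) unfolding independent_def by blast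
  then have "(if x \<in> U then m x else 0) = 0" using x assms(2) by blast
  then show "m x = 0" using x by simp
qed

lemma independent_insert:
  assumes "independent (insert x T)" "finite T" "x \<notin> T" "n > 0"
  shows "multiple n x \<notin> generated T"
proof
  assume "multiple n x \<in> generated T"
  then obtain m where m: "multiple n x = combination T m" by (auto simp: generated_def)
  \<comment> \<open>The assumption becomes a relation in which \<open>x\<close> has the nonzero coefficient \<open>- n\<close>.\<close>
  define m' where "m' = m(x := - int n)"
  have "combination T m' = combination T m"
    using assms(3) by (intro combination_cong) (auto simp: m'_def)
  then have "combination (insert x T) m' = 0"
    using assms m by (simp add: combination_insert m'_def int_multiple_minus int_multiple_simps)
  then have "m' x = 0" using assms(1) by (auto simp: independent_def)
  then show False using assms(4) by (simp add: m'_def)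
qed

lemma generated_insert:
  assumes "finite T" "x \<notin> T"
  shows "generated (insert x T) = {h + int_multiple k x | h k. h \<in> generated T}"
proof (intro subset_antisym subsetI)
  fix y assume "y \<in> generated (insert x T)"
  then obtain m where "y = combination T m + int_multiple (m x) x"
    unfolding generated_def using assms by (auto simp: combination_insert add.commute)
  then show "y \<in> {h + int_multiple k x | h k. h \<in> generated T}" unfolding generated_def by blast
next
  fix y assume "y \<in> {h + int_multiple k x | h k. h \<in> generated T}"
  then obtain h k where hk: "y = h + int_multiple k x" "h \<in> generated T" by blast
  have sup: "insert x T \<subseteq> generated (insert x T)" using assms(1) by (intro generated_superset) simp
  then have "generated T \<subseteq> generated (insert x T)"
    by (intro generated_least additive_subgroup_generated) auto
  then have "h \<in> generated (insert x T)" using hk by blast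
  moreover have "int_multiple k x \<in> generated (insert x T)"
    using sup by (intro int_multiple_in_subgroup additive_subgroup_generated) auto
  ultimately show "y \<in> generated (insert x T)"
    unfolding hk by (rule additive_subgroupD(4)[OF additive_subgroup_generated])
qed

section \<open>Group algebras over a field are GCD domains\<close>

text \<open>
  Elements of the group algebra \<open>K[G]\<close> are handled through an embedding into an arbitrary field
  \<open>L\<close> of fractions; the quotient field of \<open>A[G]\<close> will serve as \<open>L\<close>.
\<close>

locale group_algebra =
  fixes emb :: "('g::torsion_free_ab_group_add \<Rightarrow>\<^sub>0 'k::field) \<Rightarrow> 'l::field"
  assumes emb_add: "emb (f + g) = emb f + emb g"
    and emb_mult: "emb (f * g) = emb f * emb g"
    and emb_one: "emb 1 = 1"
    and emb_eq_0: "emb f = 0 \<Longrightarrow> f = 0"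
    and emb_quotient: "\<exists>f g. g \<noteq> 0 \<and> x = emb f / emb g"
begin

lemma emb_zero: "emb 0 = 0"
  using emb_add[of 0 0] by (metis add_0_left add_cancel_right_right)

lemma emb_eq_0_iff: "emb f = 0 \<longleftrightarrow> f = 0"
  using emb_eq_0 emb_zero by blast

lemma emb_diff: "emb (f - g) = emb f - emb g"
  using emb_add[of "f - g" g] by simp

lemma emb_eq_iff: "emb f = emb g \<longleftrightarrow> f = g"
  using emb_eq_0_iff[of "f - g"] by (simp add: emb_diff)

lemma emb_sum: "emb (sum f I) = (\<Sum>i\<in>I. emb (f i))"
  by (induction I rule: infinite_finite_induct) (simp_all add: emb_zero emb_add)

definition monomial :: "'g \<Rightarrow> 'l" where
  "monomial g = emb (single g 1)"

lemma monomial_0: "monomial 0 = 1"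
  unfolding monomial_def by (simp add: emb_one)

lemma monomial_add: "monomial (g + h) = monomial g * monomial h"
  unfolding monomial_def by (simp add: mult_single flip: emb_mult)

lemma monomial_nonzero: "monomial g \<noteq> 0"
  unfolding monomial_def by (metis emb_eq_0 lookup_single_eq lookup_zero zero_neq_one)

lemma monomial_minus: "monomial (- g) = inverse (monomial g)"
  using monomial_add[of "- g" g]
    by (simp add: monomial_0 inverse_eq_divide monomial_nonzero field_simps)

lemma monomial_multiple: "monomial (multiple n g) = monomial g ^ n"
  by (induction n) (simp_all add: monomial_0 monomial_add)

text \<open>
  For a submonoid \<open>H\<close> of \<open>G\<close> this is the image of \<open>K[H]\<close>.
\<close>

definition supported :: "'g set \<Rightarrow> 'l set" where
  "supported H = emb ` {f. keys f \<subseteq> H}"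

lemma supported_mono: "H \<subseteq> H' \<Longrightarrow> supported H \<subseteq> supported H'"
  unfolding supported_def by blast

lemma subring_supported:
  assumes "0 \<in> H" "\<And>x y. x \<in> H \<Longrightarrow> y \<in> H \<Longrightarrow> x + y \<in> H"
  shows "subring (supported H)"
  unfolding subring_def
proof (intro conjI ballI)
  show "1 \<in> supported H"
    unfolding supported_def using assms(1) by (intro image_eqI[of _ _ 1]) (auto simp: emb_one)
next
  fix x y assume "x \<in> supported H" "y \<in> supported H"
  then obtain f g where fg: "x = emb f" "y = emb g" "keys f \<subseteq> H" "keys g \<subseteq> H"
    unfolding supported_def by blast
  then show "x - y \<in> supported H"
    using keys_diff[of f g]
      unfolding supported_def by (intro image_eqI[of _ _ "f - g"]) (auto simp: emb_diff)
  have "keys (f * g) \<subseteq> H" using fg(3,4) keys_mult[of f g] assms(2) by blast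
  then show "x * y \<in> supported H"
    using fg unfolding supported_def by (intro image_eqI[of _ _ "f * g"]) (auto simp: emb_mult)
qed

lemma subring_supported_subgroup: "additive_subgroup H \<Longrightarrow> subring (supported H)"
  by (intro subring_supported additive_subgroupD)

lemma emb_single_supported: "g \<in> H \<Longrightarrow> emb (single g c) \<in> supported H"
  unfolding supported_def by (intro image_eqI[of _ _ "single g c"]) auto

lemma monomial_supported: "g \<in> H \<Longrightarrow> monomial g \<in> supported H"
  unfolding monomial_def by (rule emb_single_supported)

lemma emb_in_subring:
  assumes "subring B" "\<And>k. k \<in> keys f \<Longrightarrow> emb (single k (lookup f k)) \<in> B"
  shows "emb f \<in> B"
proof -
  have "emb f = (\<Sum>k\<in>keys f. emb (single k (lookup f k)))" by (metis emb_sum sum_single)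
  also have "\<dots> \<in> B" by (intro subring_sum assms)
  finally show ?thesis .
qed

lemma lookup_mult_single:
  "lookup (f * single g c) x = lookup f (x - g) * c" for f :: "'g \<Rightarrow>\<^sub>0 'k"
proof (cases "c = 0")
  case False
  have "lookup (f * single g c) x
      = (\<Sum>(i, j)\<in>{(i, j). i \<in> keys f \<and> j \<in> keys (single g c) \<and> i + j = x}. lookup f i * lookup
        (single g c) j)"
    unfolding lookup_mult_pairs convolution_def ..
  also have "{(i, j). i \<in> keys f \<and> j \<in> keys (single g c) \<and> i + j = x}
      = (if x - g \<in> keys f then {(x - g, g)} else {})"
    using False by (auto simp: eq_diff_eq)
  finally show ?thesis by (auto simp: in_keys_iff)
qed simp

lemma gcd_domain_scalars: "gcd_domain (supported {0})"
proof -
  have sub: "subring (supported {0})" by (rule subring_supported) auto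
  have inv: "inverse x \<in> supported {0}" if x: "x \<in> supported {0}" for x
  proof (cases "x = 0")
    case True
    then show ?thesis using x by simp
  next
    case False
    obtain f where f: "x = emb f" "keys f \<subseteq> {0}" using x unfolding supported_def by blast
    have fs: "f = single 0 (lookup f 0)" using sum_single_superset[of "{0}" f] f(2) by simp
    have "lookup f 0 \<noteq> 0" using fs False f(1) by (metis emb_zero single_zero)
    then have "f * single 0 (inverse (lookup f 0)) = 1" by (subst fs) (simp add: mult_single)
    then have "x * emb (single 0 (inverse (lookup f 0))) = 1"
      unfolding f(1) by (simp add: emb_one flip: emb_mult)
    then have "inverse x = emb (single 0 (inverse (lookup f 0)))" by (rule inverse_unique)
    then show ?thesis by (simp add: emb_single_supported)
  qed
  have "\<exists>d. d \<noteq> 0 \<and> (\<forall>x. x * a \<in> supported {0} \<and> x * b \<in> supported {0} \<longleftrightarrow> x * d \<in> supported {0})"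
    if ab: "a \<in> supported {0}" "b \<in> supported {0}" "a \<noteq> 0 \<or> b \<noteq> 0" for a b
  proof (intro exI[of _ 1] conjI allI iffI)
    fix x assume *: "x * a \<in> supported {0} \<and> x * b \<in> supported {0}"
    have "(x * a) * inverse a \<in> supported {0}" "(x * b) * inverse b \<in> supported {0}"
      using * ab(1,2) inv subringD(4)[OF sub] by blast+
    moreover have "(x * a) * inverse a = x \<or> (x * b) * inverse b = x" using ab(3) by auto
    ultimately show "x * 1 \<in> supported {0}" by (metis mult_1_right)
  qed (use ab subringD(4)[OF sub] in auto)
  then show ?thesis unfolding gcd_domain_def using sub by blast
qed

lemma supported_adjoin_eq_laurent:
  assumes H: "additive_subgroup H" and H': "H' = {h + int_multiple k g | h k. h \<in> H}"
  shows "supported H' = laurent (supported H) (monomial g)"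
proof
  have sH: "subring (supported H)" using H by (rule subring_supported_subgroup)
  have HH': "H \<subseteq> H'" unfolding H' by (force intro: exI[of _ "0::int"] simp: int_multiple_simps)
  have sL: "subring (laurent (supported H) (monomial g))"
    by (intro subring_laurent sH monomial_nonzero)
  show "supported H' \<subseteq> laurent (supported H) (monomial g)"
  proof
    fix x assume "x \<in> supported H'"
    then obtain f where f: "x = emb f" "keys f \<subseteq> H'" unfolding supported_def by blast
    have "emb (single k (lookup f k)) \<in> laurent (supported H) (monomial g)" if k: "k \<in> keys f" for k
    proof -
      obtain h m where hm: "h \<in> H" "k = h + int_multiple m g" using f(2) k unfolding H' by blast
      have "emb (single k (lookup f k)) = emb (single h (lookup f k)) * monomial (int_multiple m g)"
        unfolding monomial_def emb_mult[symmetric] mult_single hm by simp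
      also have "monomial (int_multiple m g) = monomial g ^ nat m / monomial g ^ nat (- m)"
        unfolding int_multiple_def diff_conv_add_uminus monomial_add monomial_minus
          monomial_multiple
        by (simp add: divide_inverse)
      also have "emb (single h (lookup f k)) * (monomial g ^ nat m / monomial g ^ nat (- m))
          = poly (monom (emb (single h (lookup f k))) (nat m)) (monomial g) / monomial g ^ nat (-
            m)"
        by (simp add: poly_monom)
      also have "\<dots> \<in> laurent (supported H) (monomial g)"
        by (intro laurentI coeffs_in_closed(4)[OF sH] emb_single_supported hm)
      finally show ?thesis .
    qed
    then show "x \<in> laurent (supported H) (monomial g)"
      unfolding f(1) by (rule emb_in_subring[OF sL])
  qed
  have addH': "x + y \<in> H'" if xy: "x \<in> H'" "y \<in> H'" for x y
  proof -
    obtain h k where x: "x = h + int_multiple k g" "h \<in> H" using xy unfolding H' by blast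
    obtain h' k' where y: "y = h' + int_multiple k' g" "h' \<in> H" using xy unfolding H' by blast
    have "x + y = (h + h') + int_multiple (k + k') g"
      using x y by (simp add: int_multiple_add algebra_simps)
    moreover have "h + h' \<in> H" using x y additive_subgroupD(4)[OF H] by blast
    ultimately show ?thesis unfolding H' by blast
  qed
  have sH': "subring (supported H')"
    using additive_subgroupD(1)[OF H] HH' addH' by (intro subring_supported) auto
  have "g = 0 + int_multiple 1 g" "- g = 0 + int_multiple (- 1) g"
    by (simp_all add: int_multiple_simps)
  then have g: "g \<in> H'" "- g \<in> H'" unfolding H' using additive_subgroupD(1)[OF H] by blast+
  show "laurent (supported H) (monomial g) \<subseteq> supported H'"
  proof
    fix x assume "x \<in> laurent (supported H) (monomial g)"
    then obtain p n where pn: "p \<in> coeffs_in (supported H)"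
      "x = poly p (monomial g) / monomial g ^ n"
      unfolding laurent_def by blast
    have "poly p (monomial g) \<in> supported H'"
      using pn(1) supported_mono[OF HH'] g
        by (intro subring_poly sH' monomial_supported) (auto simp: coeffs_in_def)
    moreover have "inverse (monomial g) ^ n \<in> supported H'"
      unfolding monomial_minus[symmetric] by (intro subring_power sH' monomial_supported g)
    ultimately have "poly p (monomial g) * inverse (monomial g) ^ n \<in> supported H'"
      by (rule subringD(4)[OF sH'])
    then show "x \<in> supported H'" unfolding pn(2) by (simp add: divide_inverse power_inverse)
  qed
qed

text \<open>
  The exponents that occur in different terms of \<open>\<Sum>i. f\<^sub>i X\<^bsup>i g\<^esup>\<close>, with \<open>f\<^sub>i \<in> K[H]\<close>, lie in
  different cosets of \<open>H\<close>, so nothing cancels.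
\<close>

lemma monomial_transcendental:
  assumes H: "additive_subgroup H" and g: "\<And>n. n > 0 \<Longrightarrow> multiple n g \<notin> H"
  shows "transcendental (supported H) (monomial g)"
  unfolding transcendental_def
proof (intro ballI impI)
  fix p assume p: "p \<in> coeffs_in (supported H)" "poly p (monomial g) = 0"
  have "\<forall>i. \<exists>f. keys f \<subseteq> H \<and> coeff p i = emb f"
    using p(1) unfolding coeffs_in_def supported_def by blast
  then obtain f where f: "\<And>i. keys (f i) \<subseteq> H" "\<And>i. coeff p i = emb (f i)" by metis
  have "emb (\<Sum>i\<le>degree p. f i * single (multiple i g) 1) = poly p (monomial g)"
    unfolding poly_altdef emb_sum emb_mult f(2)[symmetric] monomial_multiple[symmetric]
    unfolding monomial_def ..
  then have zero: "(\<Sum>i\<le>degree p. f i * single (multiple i g) 1) = 0" using p(2) emb_eq_0 by simp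
  have apart: "h + (multiple j g - multiple i g) \<notin> H" if "h \<in> H" "i \<noteq> j" for h i j
  proof
    assume "h + (multiple j g - multiple i g) \<in> H"
    then have m: "multiple j g - multiple i g \<in> H" "multiple i g - multiple j g \<in> H"
      using that(1) additive_subgroupD(2)[OF H, of "h + (multiple j g - multiple i g)" h]
        additive_subgroupD(2)[OF H, of h "h + (multiple j g - multiple i g)"] by simp_all
    show False
    proof (cases "i < j")
      case True
      then have "multiple j g = multiple (j - i) g + multiple i g"
        using multiple_add[of g "j - i" i] by simp
      then show False using m(1) g[of "j - i"] True by simp
    next
      case False
      then have "multiple i g = multiple (i - j) g + multiple j g"
        using multiple_add[of g "i - j" j] by simp
      then show False using m(2) g[of "i - j"] False that(2) by simp
    qed
  qed
  have "lookup (f j) h = 0" if "j \<le> degree p" for j h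
  proof (cases "h \<in> H")
    case True
    have "0 = lookup (\<Sum>i\<le>degree p. f i * single (multiple i g) 1) (h + multiple j g)"
      by (simp add: zero)
    also have "\<dots> = (\<Sum>i\<le>degree p. lookup (f i) (h + (multiple j g - multiple i g)))"
      by (simp add: lookup_sum lookup_mult_single algebra_simps)
    also have "\<dots> = (\<Sum>i\<le>degree p. if i = j then lookup (f j) h else 0)"
    proof (intro sum.cong refl)
      fix i assume "i \<in> {..degree p}"
      show "lookup (f i) (h + (multiple j g - multiple i g)) = (if i = j then lookup (f
        j) h else 0)"
        using f(1)[of i] apart[OF True, of i j] by (auto simp: in_keys_iff subset_iff)
    qed
    also have "\<dots> = lookup (f j) h" using that by simp
    finally show ?thesis by simp
  next
    case False
    then show ?thesis using f(1)[of j] by (auto simp: in_keys_iff subset_iff)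
  qed
  then have "f (degree p) = 0" by (intro poly_mapping_eqI) simp
  then show "p = 0" using f(2)[of "degree p"] by (simp add: emb_zero)
qed

lemma gcd_domain_generated:
  assumes "finite T" "independent T" shows "gcd_domain (supported (generated T))"
  using assms
proof (induction T)
  case empty
  have "generated {} = ({0} :: 'g set)" by (simp add: generated_def combination_def)
  then show ?case using gcd_domain_scalars by simp
next
  case (insert x T)
  have "gcd_domain (supported (generated T))"
    using insert independent_subset[of "insert x T" T] by blast
  moreover have "transcendental (supported (generated T)) (monomial x)"
    using independent_insert[OF insert.prems insert.hyps(1,2)]
    by (intro monomial_transcendental additive_subgroup_generated) blast
  ultimately have "gcd_domain (laurent (supported (generated T)) (monomial x))"
    by (intro gcd_domain_laurent monomial_nonzero)
  then show ?case
    using supported_adjoin_eq_laurent[OF additive_subgroup_generated generated_insert[OF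
      insert.hyps(1,2)]] by simp
qed

definition restriction :: "'g set \<Rightarrow> ('g \<Rightarrow>\<^sub>0 'k) \<Rightarrow> ('g \<Rightarrow>\<^sub>0 'k)" where
  "restriction C f = (\<Sum>k\<in>keys f \<inter> C. single k (lookup f k))"

lemma lookup_restriction: "lookup (restriction C f) x = (if x \<in> C then lookup f x else 0)"
  unfolding restriction_def by (auto simp: lookup_sum lookup_single when_def in_keys_iff)

lemma keys_restriction: "keys (restriction C f) = keys f \<inter> C"
  by (auto simp: in_keys_iff lookup_restriction split: if_splits)

lemma restriction_mult:
  assumes H: "additive_subgroup H" and C: "C = (\<lambda>h. c + h) ` H" and q: "keys q \<subseteq> H"
  shows "restriction C (f * q) = restriction C f * q"
proof (rule poly_mapping_eqI)
  fix x
  have move: "i \<in> C \<longleftrightarrow> x \<in> C" if "i + j = x" "j \<in> keys q" for i j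
  proof -
    have "j \<in> H" using that q by blast
    have "i + j = c + h' \<Longrightarrow> i = c + (h' - j)" for h' by (simp add: algebra_simps)
    moreover have "i = c + h' \<Longrightarrow> i + j = c + (h' + j)" for h' by (simp add: algebra_simps)
    ultimately show ?thesis
      unfolding C using that(1) \<open>j \<in> H\<close> additive_subgroupD(2,4)[OF H] by blast
  qed
  have "{(i, j). i \<in> keys (restriction C f) \<and> j \<in> keys q \<and> i + j = x}
      = (if x \<in> C then {(i, j). i \<in> keys f \<and> j \<in> keys q \<and> i + j = x} else {})"
    using move by (auto simp: keys_restriction)
  moreover have "lookup (restriction C f) i = lookup f i" if "i + j = x" "j \<in> keys q" "x \<in> C" for i
    j
    using move that by (simp add: lookup_restriction)
  ultimately show "lookup (restriction C (f * q)) x = lookup (restriction C f * q) x"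
    unfolding lookup_restriction lookup_mult_pairs convolution_def by (auto intro!: sum.cong)
qed

text \<open>
  The restrictions of \<open>u\<close> and \<open>w\<close> to a coset of \<open>H\<close> satisfy the same equation, as \<open>p\<close> and \<open>q\<close> are
  supported in \<open>H\<close>. A monomial shifts them into \<open>K[H]\<close>, where \<open>d\<close> is a greatest common divisor.
  Splitting off one coset at a time leads to all of \<open>u\<close>.
\<close>

lemma gcd_coset_step:
  assumes H: "additive_subgroup H" and keysH: "keys p \<subseteq> H" "keys q \<subseteq> H"
    and d: "\<And>x. x * emb p \<in> supported H \<and> x * emb q \<in> supported H \<longleftrightarrow> x * d \<in> supported H"
    and "u * q = w * p" "emb p \<noteq> 0"
  shows "emb u * d / emb p \<in> supported UNIV"
proof -
  have sG: "subring (supported UNIV)" by (rule subring_supported) auto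
  have HG: "supported H \<subseteq> supported UNIV" by (rule supported_mono) simp
  show ?thesis
    using assms(5,6)
  proof (induction "card (keys u)" arbitrary: u w rule: less_induct)
    case less
    show ?case
    proof (cases "u = 0")
      case True
      then show ?thesis using subringD(2)[OF sG] by (simp add: emb_zero)
    next
      case False
      then obtain k where k: "k \<in> keys u" by (metis keys_eq_empty all_not_in_conv)
      define C where "C = (\<lambda>h. k + h) ` H"
      have "k \<in> C" using additive_subgroupD(1)[OF H] by (force simp: C_def)
      have eqC: "restriction C u * q = restriction C w * p"
        using restriction_mult[OF H C_def keysH(2)] restriction_mult[OF H C_def keysH(1)]
          less.prems(1) by metis
      have shift: "emb (restriction C f) * monomial (- k) \<in> supported H" for f
      proof -
        have "keys (restriction C f * single (- k) 1) \<subseteq> H"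
          using keys_mult[of "restriction C f" "single (- k) (1::'k)"]
          by (auto simp: keys_restriction C_def)
        then show ?thesis unfolding monomial_def emb_mult[symmetric] supported_def by blast
      qed
      define x where "x = emb (restriction C u) * monomial (- k) / emb p"
      have "emb (restriction C u) * emb q = emb (restriction C w) * emb p"
        unfolding emb_mult[symmetric] eqC ..
      then have "x * emb q = emb (restriction C w) * monomial (- k)"
        using less.prems(2) by (simp add: x_def field_simps)
      then have "x * emb q \<in> supported H" using shift by simp
      moreover have "x * emb p \<in> supported H" using shift less.prems(2) by (simp add: x_def)
      ultimately have "x * d \<in> supported H" using d by blast
      then have "x * d * monomial k \<in> supported UNIV"
        using HG by (intro subringD(4)[OF sG, of "x * d"] monomial_supported) auto
      moreover have "x * d * monomial k = emb (restriction C u) * d / emb p"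
        by (simp add: x_def monomial_minus monomial_nonzero)
      ultimately have part: "emb (restriction C u) * d / emb p \<in> supported UNIV" by simp
      have keys': "keys (u - restriction C u) = keys u - C"
        by (auto simp: in_keys_iff lookup_minus lookup_restriction split: if_splits)
      have "card (keys (u - restriction C u)) < card (keys u)"
        unfolding keys' using k \<open>k \<in> C\<close> by (intro psubset_card_mono) auto
      moreover have "(u - restriction C u) * q = (w - restriction C w) * p"
        using eqC less.prems(1) by (simp add: left_diff_distrib)
      ultimately have "emb (u - restriction C u) * d / emb p \<in> supported UNIV"
        using less.hyps less.prems(2) by blast
      then have "emb (u - restriction C u) * d / emb p + emb (restriction C u) * d / emb p \<in>
        supported UNIV"
        using part by (rule subringD(6)[OF sG])
      also have "emb (u - restriction C u) * d / emb p + emb (restriction C u) * d / emb p = emb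
        u * d / emb p"
        by (simp add: emb_diff left_diff_distrib diff_divide_distrib)
      finally show ?thesis .
    qed
  qed
qed

text \<open>
  Two elements lie in some \<open>K[H]\<close> with \<open>H\<close> free of finite rank, which is a ring of Laurent
  polynomials. Since \<open>K[G]\<close> is a free module over \<open>K[H]\<close>, with one basis element for each coset of
  \<open>H\<close>, a greatest common divisor in \<open>K[H]\<close> remains one in \<open>K[G]\<close>.
\<close>

theorem gcd_domain_group_algebra: "gcd_domain (supported UNIV)"
  unfolding gcd_domain_def
proof (intro conjI ballI impI)
  have sG: "subring (supported UNIV)" by (rule subring_supported) auto
  show "subring (supported UNIV)" by (rule sG)
  fix a b assume "a \<in> supported UNIV" "b \<in> supported UNIV" and nz: "a \<noteq> 0 \<or> b \<noteq> 0"
  then obtain p q where pq: "a = emb p" "b = emb q" unfolding supported_def by blast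
  have "finite (keys p \<union> keys q)" by simp
  then obtain T where T: "finite T" "keys p \<union> keys q \<subseteq> generated T" "independent T"
    by (rule independent_generators)
  define H where "H = generated T"
  have H: "additive_subgroup H" and gcdH: "gcd_domain (supported H)" and keysH: "keys p \<subseteq> H"
    "keys q \<subseteq> H"
    unfolding H_def using additive_subgroup_generated gcd_domain_generated T by auto
  have abH: "a \<in> supported H" "b \<in> supported H" using pq keysH by (auto simp: supported_def)
  obtain d where d: "d \<noteq> 0" "\<And>x. x * a \<in> supported H \<and> x * b \<in> supported H \<longleftrightarrow> x * d \<in> supported H"
    using gcd_domainE[OF gcdH abH nz] by blast
  have HG: "supported H \<subseteq> supported UNIV" by (rule supported_mono) simp
  have sH: "subring (supported H)" using H by (rule subring_supported_subgroup)
  have ad: "a / d \<in> supported UNIV" "b / d \<in> supported UNIV"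
    using d(2)[of "inverse d"] d(1) subringD(1)[OF sH] HG
      by (auto simp: divide_inverse mult.commute)
  show "\<exists>d. d \<noteq> 0 \<and> (\<forall>x. x * a \<in> supported UNIV \<and> x * b \<in> supported UNIV \<longleftrightarrow> x * d \<in> supported UNIV)"
  proof (intro exI[of _ d] conjI allI iffI d(1))
    fix x assume "x * a \<in> supported UNIV \<and> x * b \<in> supported UNIV"
    then obtain u w where uw: "x * a = emb u" "x * b = emb w" unfolding supported_def by blast
    have "emb (u * q) = emb (w * p)"
      unfolding emb_mult uw[symmetric] pq[symmetric] by (simp add: ac_simps)
    then have eq: "u * q = w * p" by (simp add: emb_eq_iff)
    show "x * d \<in> supported UNIV"
    proof (cases "a = 0")
      case False
      then have "emb u * d / emb p \<in> supported UNIV"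
        using gcd_coset_step[OF H keysH d(2)[unfolded pq] eq] pq(1) by simp
      then show ?thesis using False unfolding uw[symmetric] pq[symmetric] by simp
    next
      case True
      have "emb q \<noteq> 0" using True nz pq(2) by simp
      moreover have "x * emb q \<in> supported H \<and> x * emb p \<in> supported H \<longleftrightarrow> x * d \<in> supported H" for x
        using d(2)[of x] pq by auto
      ultimately have "emb w * d / emb q \<in> supported UNIV"
        using gcd_coset_step[OF H keysH(2,1) _ eq[symmetric]] by blast
      then show ?thesis using True nz unfolding uw[symmetric] pq[symmetric] by simp
    qed
  next
    fix x assume x: "x * d \<in> supported UNIV"
    have "x * a = x * d * (a / d)" "x * b = x * d * (b / d)" using d(1) by simp_all
    then show "x * a \<in> supported UNIV" "x * b \<in> supported UNIV"
      using subringD(4)[OF sG x] ad by metis+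
  qed
qed

end

section \<open>Homogeneous fractional ideals of a semigroup ring\<close>

context group_algebra
begin

text \<open>
  For an additive subgroup \<open>J\<close> of \<open>K\<close>, this is the group usually written \<open>J[Y]\<close>.
\<close>

definition graded :: "'k set \<Rightarrow> 'g set \<Rightarrow> 'l set" where
  "graded J Y = emb ` {f. \<forall>g\<in>keys f. lookup f g \<in> J \<and> g \<in> Y}"

definition homogeneous :: "('k \<times> 'g) set \<Rightarrow> 'l set" where
  "homogeneous T = (\<lambda>(a, g). emb (single g a)) ` T"

lemma emb_in_graded: "emb f \<in> graded J Y \<longleftrightarrow> (\<forall>g\<in>keys f. lookup f g \<in> J \<and> g \<in> Y)"
  unfolding graded_def by (auto simp: emb_eq_iff)

lemma emb_single_in_graded: "a \<noteq> 0 \<Longrightarrow> emb (single g a) \<in> graded J Y \<longleftrightarrow> a \<in> J \<and> g \<in> Y"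
  by (simp add: emb_in_graded)

lemma single_in_graded: "a \<in> J \<Longrightarrow> g \<in> Y \<Longrightarrow> emb (single g a) \<in> graded J Y"
  by (simp add: emb_in_graded)

lemma gradedE:
  assumes "x \<in> graded J Y"
  obtains f where "x = emb f" "\<forall>g\<in>keys f. lookup f g \<in> J" "keys f \<subseteq> Y"
  using assms unfolding graded_def by blast

lemma graded_mono: "J \<subseteq> J' \<Longrightarrow> Y \<subseteq> Y' \<Longrightarrow> graded J Y \<subseteq> graded J' Y'"
  unfolding graded_def by blast

lemma graded_subset_supported: "graded J Y \<subseteq> supported Y"
  unfolding graded_def supported_def by blast

lemma homogeneous_subset_graded: "homogeneous (S \<times> E) \<subseteq> graded S E"
  unfolding homogeneous_def by (auto intro: single_in_graded)

lemma graded_eq_iff: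
  assumes "a \<in> J" "a \<noteq> 0" "y \<in> Y" "a' \<in> J'" "a' \<noteq> 0" "y' \<in> Y'" "0 \<in> J" "0 \<in> J'"
  shows "graded J Y = graded J' Y' \<longleftrightarrow> J = J' \<and> Y = Y'"
proof -
  have *: "J \<subseteq> J' \<and> Y \<subseteq> Y'"
    if "graded J Y \<subseteq> graded J' Y'" "a \<in> J" "a \<noteq> 0" "y \<in> Y" "0 \<in> J'" for J J' Y Y' a y
  proof -
    have "b \<in> J'" if "b \<in> J" for b
    proof (cases "b = 0")
      case False
      have "emb (single y b) \<in> graded J' Y'"
        using single_in_graded[OF \<open>b \<in> J\<close> \<open>y \<in> Y\<close>] \<open>graded J Y \<subseteq> graded J' Y'\<close> by blast
      then show ?thesis using emb_single_in_graded[OF False] by blast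
    qed (use \<open>0 \<in> J'\<close> in simp)
    moreover have "z \<in> Y'" if "z \<in> Y" for z
    proof -
      have "emb (single z a) \<in> graded J' Y'"
        using single_in_graded[OF \<open>a \<in> J\<close> \<open>z \<in> Y\<close>] \<open>graded J Y \<subseteq> graded J' Y'\<close> by blast
      then show ?thesis using emb_single_in_graded[OF \<open>a \<noteq> 0\<close>] by blast
    qed
    ultimately show ?thesis by blast
  qed
  show ?thesis
    using *[of J Y J' Y' a y] *[of J' Y' J Y a' y'] assms by auto
qed

lemma scale_graded:
  assumes u: "u \<noteq> 0"
  shows "(\<lambda>x. emb (single h u) * x) ` graded J Y = graded ((\<lambda>x. u * x) ` J) ((\<lambda>y. h + y) ` Y)"
proof
  have "f * single h u = single h u * f" for f :: "'g \<Rightarrow>\<^sub>0 'k" by (rule mult.commute)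
  then have look: "lookup (single h u * f) k = u * lookup f (k - h)" for f k
    using lookup_mult_single[of f h u k] by (simp add: mult.commute)
  show "(\<lambda>x. emb (single h u) * x) ` graded J Y \<subseteq> graded ((\<lambda>x. u * x) ` J) ((\<lambda>y. h + y) ` Y)"
  proof clarify
    fix x assume "x \<in> graded J Y"
    then obtain f where f: "x = emb f" "\<forall>g\<in>keys f. lookup f g \<in> J" "keys f \<subseteq> Y" by (rule gradedE)
    have "lookup (single h u * f) g \<in> (\<lambda>x. u * x) ` J \<and> g \<in> (\<lambda>y. h + y) ` Y"
      if "g \<in> keys (single h u * f)" for g
    proof -
      have k: "g - h \<in> keys f" using that by (simp add: in_keys_iff look)
      then have "lookup (single h u * f) g \<in> (\<lambda>x. u * x) ` J" unfolding look using f(2) by blast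
      moreover have "g = h + (g - h)" by simp
      then have "g \<in> (\<lambda>y. h + y) ` Y" using k f(3) by blast
      ultimately show ?thesis by blast
    qed
    then show "emb (single h u) * x \<in> graded ((\<lambda>x. u * x) ` J) ((\<lambda>y. h + y) ` Y)"
      unfolding f(1) emb_mult[symmetric] emb_in_graded by blast
  qed
  show "graded ((\<lambda>x. u * x) ` J) ((\<lambda>y. h + y) ` Y) \<subseteq> (\<lambda>x. emb (single h u) * x) ` graded J Y"
  proof
    fix x assume "x \<in> graded ((\<lambda>x. u * x) ` J) ((\<lambda>y. h + y) ` Y)"
    then obtain f where f: "x = emb f" "\<forall>g\<in>keys f. lookup f g \<in> (\<lambda>x. u * x) ` J"
      "keys f \<subseteq> (\<lambda>y. h + y) ` Y"
      by (rule gradedE)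
    define f' where "f' = f * single (- h) (inverse u)"
    have "lookup f' g \<in> J \<and> g \<in> Y" if "g \<in> keys f'" for g
    proof -
      have l: "lookup f' g = lookup f (g + h) * inverse u"
        unfolding f'_def lookup_mult_single by simp
      then have k: "g + h \<in> keys f" using that by (auto simp: in_keys_iff)
      then obtain b where "lookup f (g + h) = u * b" "b \<in> J" using f(2) by blast
      moreover obtain y where "g + h = h + y" "y \<in> Y" using k f(3) by blast
      ultimately have "g \<in> Y" "lookup f' g = b" "b \<in> J" using l u by (simp_all add: add.commute)
      then show ?thesis by simp
    qed
    then have "emb f' \<in> graded J Y" by (simp add: emb_in_graded)
    moreover have "single h u * f' = f"
    proof -
      have "single h u * f' = f * (single h u * single (- h) (inverse u))"
        by (simp add: f'_def ac_simps)
      also have "single h u * single (- h) (inverse u) = 1" using u by (simp add: mult_single)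
      finally show ?thesis by simp
    qed
    ultimately show "x \<in> (\<lambda>x. emb (single h u) * x) ` graded J Y"
      unfolding f(1) by (metis emb_mult imageI)
  qed
qed

lemma emb_single_nonzero: "a \<noteq> 0 \<Longrightarrow> emb (single g a) \<noteq> 0"
  by (metis emb_eq_0_iff lookup_single_eq lookup_zero)

lemma inverse_emb_single: "a \<noteq> 0 \<Longrightarrow> inverse (emb (single g a)) = emb (single (- g) (inverse a))"
proof (rule inverse_unique)
  assume "a \<noteq> 0"
  then show "emb (single g a) * emb (single (- g) (inverse a)) = 1"
    unfolding emb_mult[symmetric] mult_single by (simp add: emb_one)
qed

lemma group_algebra_unit:
  assumes "x \<in> supported UNIV" "inverse x \<in> supported UNIV" "x \<noteq> 0"
  obtains h u where "u \<noteq> 0" "x = emb (single h u)"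
proof -
  obtain w w' where w: "x = emb w" "inverse x = emb w'" using assms unfolding supported_def by blast
  have "emb (w * w') = x * inverse x" unfolding emb_mult w(2)[symmetric] w(1)[symmetric] ..
  also have "\<dots> = emb (single 0 1)" using assms(3) by (simp add: emb_one)
  finally have "emb (w * w') = emb (single 0 1)" .
  then have ww: "w * w' = single 0 1" by (simp add: emb_eq_iff)
  obtain i a where "a \<noteq> 0" "w = single i a" by (rule single_factor[OF ww one_neq_zero])
  then show thesis using that w(1) by blast
qed

end

locale semigroup_algebra = group_algebra emb + A: fraction_domain A + \<Gamma>: grading_monoid \<Gamma>
  for emb :: "('g::torsion_free_ab_group_add \<Rightarrow>\<^sub>0 'k::field) \<Rightarrow> 'l::field" and A :: "'k set" and \<Gamma>
    :: "'g set"
begin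

abbreviation ring :: "'l set" where "ring \<equiv> graded A \<Gamma>"

lemma ring_quotient_field: "subring_with_quotient_field ring"
  unfolding subring_with_quotient_field_def
proof (intro conjI ballI allI)
  have "emb (single 0 1) \<in> ring" by (intro single_in_graded A.one_in \<Gamma>.zero_mem)
  then show "1 \<in> ring" by (simp add: emb_one)
next
  fix x y assume "x \<in> ring" "y \<in> ring"
  then obtain f g where fg: "x = emb f" "y = emb g" "\<forall>k\<in>keys f. lookup f k \<in> A" "keys f \<subseteq> \<Gamma>"
    "\<forall>k\<in>keys g. lookup g k \<in> A" "keys g \<subseteq> \<Gamma>" by (elim gradedE)
  have A: "lookup f k \<in> A" "lookup g k \<in> A" for k
    using fg(3,5) A.zero_in by (auto simp: in_keys_iff)
  show "x - y \<in> ring"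
    unfolding fg emb_diff[symmetric] emb_in_graded
    using keys_diff[of f g] fg(4,6) A A.diff_in by (auto simp: lookup_minus)
  have "lookup (f * g) k \<in> A" for k
    unfolding lookup_mult_pairs convolution_def
      using A A.mult_in by (auto intro!: subring_sum A.subring_D)
  moreover have "keys (f * g) \<subseteq> \<Gamma>" using keys_mult[of f g] fg(4,6) \<Gamma>.add_mem by blast
  ultimately show "x * y \<in> ring"
    unfolding fg emb_mult[symmetric] emb_in_graded by blast
next
  fix x
  obtain f g where fg: "g \<noteq> 0" "x = emb f / emb g" using emb_quotient by blast
  obtain c where c: "c \<in> A" "c \<noteq> 0" "\<And>a. a \<in> lookup f ` keys f \<union> lookup g ` keys g \<Longrightarrow> c * a \<in> A"
    by (rule A.common_denominator[of "lookup f ` keys f \<union> lookup g ` keys g"]) auto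
  obtain \<gamma> where \<gamma>: "\<And>k. k \<in> keys f \<union> keys g \<Longrightarrow> \<gamma> + k \<in> \<Gamma>"
    using grading_monoid_common_shift[OF \<Gamma>.grading, of "keys f \<union> keys g"] by auto
  have "emb (h * single \<gamma> c) \<in> ring" if "keys h \<subseteq> keys f \<union> keys g"
    "\<And>k. k \<in> keys h \<Longrightarrow> c * lookup h k \<in> A" for h
    unfolding emb_in_graded
  proof
    fix k assume "k \<in> keys (h * single \<gamma> c)"
    then have k: "k - \<gamma> \<in> keys h" by (auto simp: in_keys_iff lookup_mult_single)
    then have "\<gamma> + (k - \<gamma>) \<in> \<Gamma>" using that(1) \<gamma> by blast
    then show "lookup (h * single \<gamma> c) k \<in> A \<and> k \<in> \<Gamma>"
      using that(2)[OF k] by (simp add: lookup_mult_single mult.commute)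
  qed
  then have "emb (f * single \<gamma> c) \<in> ring" "emb (g * single \<gamma> c) \<in> ring" using c(3) by auto
  moreover have "emb (g * single \<gamma> c) \<noteq> 0" "x = emb (f * single \<gamma> c) / emb (g * single \<gamma> c)"
    using fg emb_single_nonzero[OF c(2)] by (auto simp: emb_mult emb_eq_0_iff)
  ultimately show "\<exists>a\<in>ring. \<exists>b\<in>ring. b \<noteq> 0 \<and> x = a / b" by blast
qed

sublocale R: fraction_domain ring
  by unfold_locales (rule ring_quotient_field)

lemma ring_subset_supported: "ring \<subseteq> supported UNIV"
  using graded_subset_supported supported_mono by blast

lemma subring_group_algebra: "subring (supported UNIV)"
  by (rule subring_supported) auto

text \<open>
  As the exponents of a product with a monomial are distinct, the coefficients and the exponents
  of \<open>x\<close> can be checked one by one, and independently of each other.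
\<close>

lemma colon_homogeneous:
  assumes T: "T \<noteq> {}" "\<And>a g. (a, g) \<in> T \<Longrightarrow> a \<noteq> 0"
  shows "R.colon (homogeneous T) = graded (A.colon (fst ` T)) (\<Gamma>.colon (snd ` T))"
proof -
  have key: "emb f * emb (single g a) \<in> ring \<longleftrightarrow> (\<forall>k\<in>keys f. lookup f k * a \<in> A \<and> k + g \<in> \<Gamma>)"
    if "a \<noteq> 0" for f g a
  proof -
    have "emb f * emb (single g a) \<in> ring
        \<longleftrightarrow> (\<forall>k\<in>keys (f * single g a). lookup f (k - g) * a \<in> A \<and> k \<in> \<Gamma>)"
      unfolding emb_mult[symmetric] emb_in_graded lookup_mult_single ..
    also have "keys (f * single g a) = (\<lambda>k. k + g) ` keys f"
    proof -
      have "k \<in> (\<lambda>k. k + g) ` keys f \<longleftrightarrow> k - g \<in> keys f" for k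
        by (auto simp: image_iff intro!: bexI[of _ "k - g"])
      then show ?thesis using that by (auto simp: in_keys_iff lookup_mult_single)
    qed
    finally show ?thesis by simp
  qed
  have "x \<in> R.colon (homogeneous T) \<longleftrightarrow> x \<in> graded (A.colon (fst ` T)) (\<Gamma>.colon (snd ` T))" for x
  proof (cases "x \<in> range emb")
    case True
    then obtain f where f: "x = emb f" by blast
    have "x \<in> R.colon (homogeneous T) \<longleftrightarrow> (\<forall>(a, g)\<in>T. \<forall>k\<in>keys f. lookup f k * a \<in> A \<and> k + g \<in> \<Gamma>)"
      using key T(2) by (auto simp: f R.colon_def homogeneous_def)
    also have "\<dots> \<longleftrightarrow> (\<forall>k\<in>keys f. lookup f k \<in> A.colon (fst ` T) \<and> k \<in> \<Gamma>.colon (snd ` T))"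
      by (force simp: A.colon_def \<Gamma>.colon_def)
    finally show ?thesis by (simp add: f emb_in_graded)
  next
    case False
    obtain a g where ag: "(a, g) \<in> T" using T(1) by auto
    \<comment> \<open>One monomial of \<open>T\<close> suffices to force \<open>x\<close> into the group algebra.\<close>
    have "x \<notin> R.colon (homogeneous T)"
    proof
      assume "x \<in> R.colon (homogeneous T)"
      then have "x * emb (single g a) \<in> ring"
        using ag by (auto simp: homogeneous_def intro: R.colonD)
      then obtain h where h: "x * emb (single g a) = emb h" by (elim gradedE)
      have "x = emb h * inverse (emb (single g a))"
        using emb_single_nonzero[OF T(2)[OF ag]] by (simp flip: h)
      also have "\<dots> = emb (h * single (- g) (inverse a))"
        by (simp add: emb_mult inverse_emb_single[OF T(2)[OF ag]])
      finally show False using False by blast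
    qed
    moreover have "x \<notin> graded (A.colon (fst ` T)) (\<Gamma>.colon (snd ` T))"
      using False unfolding graded_def by blast
    ultimately show ?thesis by blast
  qed
  then show ?thesis by blast
qed

lemma colon_homogeneous_prod:
  assumes "\<not> S \<subseteq> {0}" "E \<noteq> {}"
  shows "R.colon (homogeneous (S \<times> E)) = graded (A.colon S) (\<Gamma>.colon E)"
proof -
  let ?T = "(S - {0}) \<times> E"
  have "R.colon (homogeneous (S \<times> E)) = R.colon (homogeneous ?T)"
  proof
    show "R.colon (homogeneous (S \<times> E)) \<subseteq> R.colon (homogeneous ?T)"
      by (rule R.colon_anti) (auto simp: homogeneous_def)
    show "R.colon (homogeneous ?T) \<subseteq> R.colon (homogeneous (S \<times> E))"
    proof (intro subsetI R.colonI)
      fix x s assume x: "x \<in> R.colon (homogeneous ?T)" and "s \<in> homogeneous (S \<times> E)"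
      then obtain a g where ag: "s = emb (single g a)" "a \<in> S" "g \<in> E"
        by (auto simp: homogeneous_def)
      show "x * s \<in> ring"
      proof (cases "a = 0")
        case True
        then show ?thesis using R.zero_in by (simp add: ag emb_zero)
      next
        case False
        then have "s \<in> homogeneous ?T" using ag by (auto simp: homogeneous_def)
        then show ?thesis using x R.colonD by blast
      qed
    qed
  qed
  also have "\<dots> = graded (A.colon (fst ` ?T)) (\<Gamma>.colon (snd ` ?T))"
    by (rule colon_homogeneous) (use assms in auto)
  also have "fst ` ?T = S - {0}" using assms by auto
  also have "snd ` ?T = E" using assms by auto
  also have "A.colon (S - {0}) = A.colon S" using A.zero_in by (auto simp: A.colon_def)
  finally show ?thesis .
qed

lemma graded_subset_v: "graded J Y \<subseteq> R.v (homogeneous (J \<times> Y))"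
proof
  fix x assume "x \<in> graded J Y"
  then obtain f where f: "x = emb f" "\<forall>g\<in>keys f. lookup f g \<in> J" "keys f \<subseteq> Y" by (rule gradedE)
  have "emb f = (\<Sum>k\<in>keys f. emb (single k (lookup f k)))" by (metis emb_sum sum_single)
  also have "\<dots> \<in> R.v (homogeneous (J \<times> Y))"
  proof -
    have "emb (single k (lookup f k)) \<in> R.v (homogeneous (J \<times> Y))" if "k \<in> keys f" for k
    proof -
      have "emb (single k (lookup f k)) \<in> homogeneous (J \<times> Y)"
        unfolding homogeneous_def
          using that f(2,3) by (intro image_eqI[of _ _ "(lookup f k, k)"]) auto
      then show ?thesis using R.v_extensive by blast
    qed
    then show ?thesis by (intro R.submodule_sum R.submodule_v)
  qed
  finally show "x \<in> R.v (homogeneous (J \<times> Y))" by (simp add: f)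
qed

lemma colon_graded:
  assumes "\<not> J \<subseteq> {0}" "Y \<noteq> {}"
  shows "R.colon (graded J Y) = graded (A.colon J) (\<Gamma>.colon Y)"
proof -
  have "R.v (graded J Y) = R.v (homogeneous (J \<times> Y))"
    by (intro subset_antisym R.v_least graded_subset_v R.v_mono homogeneous_subset_graded)
  then have "R.colon (graded J Y) = R.colon (homogeneous (J \<times> Y))" by (metis R.colon_v)
  then show ?thesis using colon_homogeneous_prod[OF assms] by simp
qed

lemma v_homogeneous_finite:
  assumes "finite S" "\<not> S \<subseteq> {0}" "finite E" "E \<noteq> {}"
  shows "R.v (homogeneous (S \<times> E)) = graded (A.v S) (\<Gamma>.v E)"
proof -
  obtain c where c: "c \<noteq> 0" "\<And>a. a \<in> S \<Longrightarrow> c * a \<in> A" using A.common_denominator[OF assms(1)] by blast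
  then have "c \<in> A.colon S" by (intro A.colonI)
  then have "\<not> A.colon S \<subseteq> {0}" using c(1) by blast
  moreover obtain \<gamma> where "\<And>k. k \<in> E \<Longrightarrow> \<gamma> + k \<in> \<Gamma>"
    using grading_monoid_common_shift[OF \<Gamma>.grading assms(3)] by blast
  then have "\<gamma> \<in> \<Gamma>.colon E" by (intro \<Gamma>.colonI)
  then have "\<Gamma>.colon E \<noteq> {}" by blast
  ultimately show ?thesis
    unfolding R.v_def colon_homogeneous_prod[OF assms(2,4)] A.v_def \<Gamma>.v_def by (rule colon_graded)
qed

lemma finite_homogeneous: "finite T \<Longrightarrow> finite (homogeneous T)"
  by (simp add: homogeneous_def)

lemma homogeneous_null: "homogeneous (S \<times> E) \<subseteq> {0} \<longleftrightarrow> S \<subseteq> {0} \<or> E = {}"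
proof -
  have "emb (single g a) = 0 \<longleftrightarrow> a = 0" for g a
    using emb_single_nonzero emb_zero by (metis single_zero)
  then show ?thesis unfolding homogeneous_def by auto
qed

text \<open>
  Each finite subset of \<open>homogeneous (S \<times> E)\<close> is contained in \<open>homogeneous (S' \<times> E')\<close> for some
  finite \<open>S' \<subseteq> S\<close> and \<open>E' \<subseteq> E\<close>, so that \<open>v_homogeneous_finite\<close> passes to the directed union.
\<close>

lemma t_homogeneous:
  assumes "\<not> S \<subseteq> {0}" "E \<noteq> {}"
  shows "R.t (homogeneous (S \<times> E)) = graded (A.t S) (\<Gamma>.t E)"
proof
  show "graded (A.t S) (\<Gamma>.t E) \<subseteq> R.t (homogeneous (S \<times> E))"
  proof
    fix x assume "x \<in> graded (A.t S) (\<Gamma>.t E)"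
    then obtain f where f: "x = emb f" "\<forall>g\<in>keys f. lookup f g \<in> A.t S" "keys f \<subseteq> \<Gamma>.t E"
      by (rule gradedE)
    obtain S' where S': "finite S'" "S' \<subseteq> S" "\<not> S' \<subseteq> {0}" "lookup f ` keys f \<subseteq> A.v S'"
      by (rule A.finite_subset_t[of "lookup f ` keys f" S]) (use f assms in auto)
    obtain E' where E': "finite E'" "E' \<subseteq> E" "\<not> E' \<subseteq> {}" "keys f \<subseteq> \<Gamma>.v E'"
      by (rule \<Gamma>.finite_subset_t[of "keys f" E]) (use f assms in auto)
    have "x \<in> graded (A.v S') (\<Gamma>.v E')" using S'(4) E'(4) by (auto simp: f emb_in_graded)
    then have "x \<in> R.v (homogeneous (S' \<times> E'))" using v_homogeneous_finite S' E' by auto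
    moreover have "homogeneous (S' \<times> E') \<subseteq> homogeneous (S \<times> E)"
      unfolding homogeneous_def using S' E' by (intro image_mono) auto
    moreover have "\<not> homogeneous (S' \<times> E') \<subseteq> {0}" using S' E' by (auto simp: homogeneous_null)
    ultimately show "x \<in> R.t (homogeneous (S \<times> E))"
      using S'(1) E'(1)
        by (intro R.tI[of x "homogeneous (S' \<times> E')"] finite_homogeneous finite_cartesian_product)
  qed
  show "R.t (homogeneous (S \<times> E)) \<subseteq> graded (A.t S) (\<Gamma>.t E)"
  proof
    fix x assume "x \<in> R.t (homogeneous (S \<times> E))"
    then obtain F where F: "finite F" "F \<subseteq> homogeneous (S \<times> E)" "\<not> F \<subseteq> {0}" "x \<in> R.v F"
      by (rule R.tE)
    obtain T where T: "T \<subseteq> S \<times> E" "finite T" "F = homogeneous T"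
      using F(1,2) unfolding homogeneous_def by (meson finite_subset_image)
    define S' E' where "S' = fst ` T" and "E' = snd ` T"
    have sub: "S' \<subseteq> S" "E' \<subseteq> E" "finite S'" "finite E'" using T by (auto simp: S'_def E'_def)
    have "T \<subseteq> S' \<times> E'" by (force simp: S'_def E'_def)
    then have FS: "F \<subseteq> homogeneous (S' \<times> E')" unfolding T(3) homogeneous_def by (rule image_mono)
    then have nz: "\<not> S' \<subseteq> {0}" "E' \<noteq> {}" using F(3) homogeneous_null[of S' E'] by auto
    have "x \<in> R.v (homogeneous (S' \<times> E'))" using F(4) R.v_mono[OF FS] by blast
    also have "\<dots> = graded (A.v S') (\<Gamma>.v E')" using v_homogeneous_finite sub nz by blast
    also have "\<dots> \<subseteq> graded (A.t S) (\<Gamma>.t E)"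
    proof (rule graded_mono)
      show "A.v S' \<subseteq> A.t S" using A.t_finite[of S'] A.t_mono[of S' S] sub nz by blast
      show "\<Gamma>.v E' \<subseteq> \<Gamma>.t E" using \<Gamma>.t_finite[of E'] \<Gamma>.t_mono[of E' E] sub nz by blast
    qed
    finally show "x \<in> graded (A.t S) (\<Gamma>.t E)" .
  qed
qed

lemma prod_homogeneous:
  "R.prod (homogeneous (S \<times> E)) (homogeneous (S' \<times> E')) = homogeneous (A.prod S S' \<times> \<Gamma>.prod E E')"
proof -
  have "emb (single g a) * emb (single h b) = emb (single (g + h) (a * b))" for g h a b
    by (simp add: mult_single flip: emb_mult)
  then show ?thesis
    unfolding R.prod_def A.prod_def \<Gamma>.prod_def homogeneous_def by (auto simp: image_iff; metis)
qed

lemma graded_eq_t: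
  assumes "A.t J = J" "\<Gamma>.t Y = Y" "\<not> J \<subseteq> {0}" "Y \<noteq> {}"
  shows "graded J Y = R.t (homogeneous (J \<times> Y))"
  using t_homogeneous[OF assms(3,4)] assms(1,2) by simp

lemma t_prod_graded:
  assumes "A.t I = I" "\<Gamma>.t Y = Y" "\<not> I \<subseteq> {0}" "Y \<noteq> {}"
    and "A.t J = J" "\<Gamma>.t W = W" "\<not> J \<subseteq> {0}" "W \<noteq> {}"
  shows "R.t (R.prod (graded I Y) (graded J W)) = graded (A.t (A.prod I J)) (\<Gamma>.t (\<Gamma>.prod Y W))"
proof -
  have "R.t (R.prod (graded I Y) (graded J W)) = R.t (homogeneous (A.prod I J \<times> \<Gamma>.prod Y W))"
    unfolding graded_eq_t[OF assms(1-4)] graded_eq_t[OF assms(5-8)] R.t_prod_t prod_homogeneous ..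
  also have "\<dots> = graded (A.t (A.prod I J)) (\<Gamma>.t (\<Gamma>.prod Y W))"
    using assms A.prod_null[of I J] \<Gamma>.prod_null[of Y W] by (intro t_homogeneous) auto
  finally show ?thesis .
qed

theorem t_invertible_graded:
  assumes J: "A.t_invertible J" and Y: "\<Gamma>.t_invertible Y"
  shows "R.t_invertible (graded J Y)"
proof -
  obtain J' where J': "A.t J = J" "A.t J' = J'" "A.t (A.prod J J') = A"
    using J unfolding A.t_invertible_def by blast
  obtain Y' where Y': "\<Gamma>.t Y = Y" "\<Gamma>.t Y' = Y'" "\<Gamma>.t (\<Gamma>.prod Y Y') = \<Gamma>"
    using Y unfolding \<Gamma>.t_invertible_def by blast
  have "\<not> A.prod J J' \<subseteq> {0}" using J'(3) A.one_in A.t_null[of "A.prod J J'"] by auto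
  then have nJ: "\<not> J \<subseteq> {0}" "\<not> J' \<subseteq> {0}" by (simp_all add: A.prod_null)
  have "\<not> \<Gamma>.prod Y Y' \<subseteq> {}" using Y'(3) \<Gamma>.zero_mem \<Gamma>.t_null[of "\<Gamma>.prod Y Y'"] by auto
  then have nY: "Y \<noteq> {}" "Y' \<noteq> {}" using \<Gamma>.prod_null[of Y Y'] by auto
  have "R.t (R.prod (graded J Y) (graded J' Y')) = ring"
    using t_prod_graded[OF J'(1) Y'(1) nJ(1) nY(1) J'(2) Y'(2) nJ(2) nY(2)] J'(3) Y'(3) by simp
  moreover have "R.t (graded J Y) = graded J Y" "R.t (graded J' Y') = graded J' Y'"
    unfolding graded_eq_t[OF J'(1) Y'(1) nJ(1) nY(1)] graded_eq_t[OF J'(2) Y'(2) nJ(2) nY(2)]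
      R.t_idem by simp_all
  ultimately show ?thesis unfolding R.t_invertible_def by blast
qed

text \<open>
  The inverse is \<open>graded (A.colon J) (\<Gamma>.colon Y)\<close>, and the two components can be read off from the
  membership of the monomial \<open>1\<close> in the \<open>t\<close>-closure of the product.
\<close>

theorem t_invertible_graded_components:
  assumes "R.t_invertible (graded J Y)" "A.t J = J" "\<Gamma>.t Y = Y" "\<not> J \<subseteq> {0}" "Y \<noteq> {}"
  shows "A.t_invertible J" "\<Gamma>.t_invertible Y"
proof -
  have colon: "R.colon (graded J Y) = graded (A.colon J) (\<Gamma>.colon Y)" by (rule colon_graded) fact+
  have inv: "\<not> graded (A.colon J) (\<Gamma>.colon Y) \<subseteq> {0}"
    "R.t (R.prod (graded J Y) (graded (A.colon J) (\<Gamma>.colon Y))) = ring"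
    using R.t_invertible_colon[OF assms(1)] unfolding colon by auto
  obtain f where f: "f \<noteq> 0" "\<forall>g\<in>keys f. lookup f g \<in> A.colon J" "keys f \<subseteq> \<Gamma>.colon Y"
  proof -
    obtain x where x: "x \<in> graded (A.colon J) (\<Gamma>.colon Y)" "x \<noteq> 0" using inv(1) by blast
    from x(1) obtain f where "x = emb f" "\<forall>g\<in>keys f. lookup f g \<in> A.colon J" "keys f \<subseteq> \<Gamma>.colon Y"
      by (rule gradedE)
    then show thesis using that[of f] x(2) emb_zero by auto
  qed
  obtain g where g: "g \<in> keys f" using f(1) by (metis keys_eq_empty all_not_in_conv)
  have nz: "\<not> A.colon J \<subseteq> {0}" "\<Gamma>.colon Y \<noteq> {}" using f(2) f(3) g by (auto simp: in_keys_iff)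
  have closed: "A.t (A.colon J) = A.colon J" "\<Gamma>.t (\<Gamma>.colon Y) = \<Gamma>.colon Y"
    using A.t_v[of "A.colon J"] \<Gamma>.t_v[of "\<Gamma>.colon Y"] nz by (simp_all add: A.v_colon \<Gamma>.v_colon)
  have "emb (single 0 1) \<in> graded (A.t (A.prod J (A.colon J))) (\<Gamma>.t (\<Gamma>.prod Y (\<Gamma>.colon Y)))"
    using t_prod_graded[OF assms(2-5) closed nz] inv(2) R.one_in by (simp add: emb_one)
  then have "1 \<in> A.t (A.prod J (A.colon J))" "0 \<in> \<Gamma>.t (\<Gamma>.prod Y (\<Gamma>.colon Y))"
    by (simp_all only: emb_single_in_graded[OF one_neq_zero])
  then show "A.t_invertible J" "\<Gamma>.t_invertible Y"
    using A.t_invertibleI \<Gamma>.t_invertibleI assms(2,3) nz by auto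
qed

lemma t_invertible_nonzero:
  assumes "A.t_invertible J" obtains a where "a \<in> J" "a \<noteq> 0"
  using A.t_invertible_not_null[OF assms] by blast

lemma t_invertible_zero: "A.t_invertible J \<Longrightarrow> 0 \<in> J"
  by (intro A.submoduleD(1) A.t_invertible_submodule)

text \<open>
  Both ideals contain monomials and lie in \<open>K[G]\<close>, so that \<open>x\<close> is a unit of \<open>K[G]\<close>; the units are
  the monomials.
\<close>

lemma scale_graded_eq_graded:
  assumes J: "A.t_invertible J" and J': "A.t_invertible J'" and "y \<in> Y" "y' \<in> Y'"
    and eq: "graded J' Y' = R.scale x (graded J Y)"
  obtains h u where "u \<noteq> 0" "x = emb (single h u)" "J' = A.scale u J" "Y' = \<Gamma>.scale h Y"
proof -
  obtain a where a: "a \<in> J" "a \<noteq> 0" using J by (rule t_invertible_nonzero)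
  obtain a' where a': "a' \<in> J'" "a' \<noteq> 0" using J' by (rule t_invertible_nonzero)
  have 1: "x * emb (single y a) \<in> graded J' Y'"
    unfolding eq using a assms(3) by (intro imageI single_in_graded)
  have "emb (single y' a') \<in> R.scale x (graded J Y)"
    unfolding eq[symmetric] using a' assms(4) by (intro single_in_graded)
  then obtain f where f: "emb (single y' a') = x * emb f" by (auto elim!: gradedE)
  then have "x \<noteq> 0" using emb_single_nonzero[OF a'(2)] by auto
  obtain f' where f': "x * emb (single y a) = emb f'" using 1 by (rule gradedE)
  have "x = emb f' * inverse (emb (single y a))"
    using emb_single_nonzero[OF a(2)] by (simp flip: f')
  then have "x \<in> range emb" unfolding inverse_emb_single[OF a(2)] emb_mult[symmetric] by blast
  moreover have "inverse x = emb f * inverse (emb (single y' a'))"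
    unfolding f using \<open>x \<noteq> 0\<close> emb_single_nonzero[OF a'(2)] f by (auto simp: field_simps)
  then have "inverse x \<in> range emb"
    unfolding inverse_emb_single[OF a'(2)] emb_mult[symmetric] by blast
  ultimately obtain h u where hu: "u \<noteq> 0" "x = emb (single h u)"
    using group_algebra_unit[of x thesis] \<open>x \<noteq> 0\<close> that by (auto simp: supported_def)
  have "graded J' Y' = graded (A.scale u J) (\<Gamma>.scale h Y)"
    unfolding eq hu(2) by (rule scale_graded[OF hu(1)])
  then have "J' = A.scale u J \<and> Y' = \<Gamma>.scale h Y"
    using graded_eq_iff[of a' J' y' Y' "u * a" "A.scale u J" "h + y" "\<Gamma>.scale h Y"]
      a a' hu assms t_invertible_zero[OF J] t_invertible_zero[OF J'] by auto
  then show thesis using that hu by blast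
qed

section \<open>When every t-invertible t-ideal is extended, up to a factor\<close>

lemma kronecker_semigroup_ring:
  assumes A: "integrally_closed_domain A" and \<Gamma>: "integrally_closed_monoid \<Gamma>"
    and fg: "emb f * emb g \<in> ring" and ij: "i \<in> keys f" "j \<in> keys g"
  shows "lookup f i * lookup g j \<in> A \<and> i + j \<in> \<Gamma>"
proof
  have fg': "\<forall>k\<in>keys (f * g). lookup (f * g) k \<in> A \<and> k \<in> \<Gamma>"
    using fg unfolding emb_mult[symmetric] emb_in_graded .
  then have "lookup (f * g) k \<in> A" for k
    using A.zero_in by (cases "k \<in> keys (f * g)") (auto simp: in_keys_iff)
  then have "integral_over A (lookup f i * lookup g j)"
    by (rule kronecker_group_ring[OF A.subring_D])
  then show "lookup f i * lookup g j \<in> A"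
    using A unfolding integrally_closed_domain_def integral_over_def by blast
  have "keys (f * g) \<subseteq> \<Gamma>" using fg' by blast
  then show "i + j \<in> \<Gamma>"
    using keys_mult_in_integrally_closed[OF \<Gamma>.zero_mem \<Gamma>.add_mem \<Gamma> _ ij] by blast
qed

text \<open>
  The ideal \<open>I\<close> is \<open>F\<^sub>v\<close> for a finite set \<open>F\<close>. After division by a greatest common divisor in
  \<open>K[G]\<close>, the ideal \<open>(R : F)\<close> lies in \<open>K[G]\<close>; then, by Kronecker's theorem, \<open>F\<close> may be replaced by
  the set of all homogeneous components of its elements.
\<close>

theorem t_invertible_eq_scale_graded:
  assumes A: "integrally_closed_domain A" and \<Gamma>: "integrally_closed_monoid \<Gamma>"
    and I: "R.t_invertible I"
  obtains x J Y where "x \<noteq> 0" "A.t_invertible J" "\<Gamma>.t_invertible Y" "I = R.scale x (graded J Y)"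
proof -
  obtain S where S: "finite S" "\<not> S \<subseteq> {0}" "I = R.v S"
    using I by (rule R.t_invertible_finite_type)
  have "S \<subseteq> fractions (supported UNIV)"
  proof
    fix x
    obtain f g where "g \<noteq> 0" "x = emb f / emb g" using emb_quotient by blast
    then show "x \<in> fractions (supported UNIV)"
      by (auto simp: supported_def emb_eq_0_iff intro!: fractionsI)
  qed
  then obtain d where d: "d \<noteq> 0" "\<And>x. (\<forall>s\<in>S. x * s \<in> supported UNIV) \<longleftrightarrow> x * d \<in> supported UNIV"
    using gcd_domain_finite[OF gcd_domain_group_algebra S(1) _ S(2)] by metis
  \<comment> \<open>The elements of \<open>S'\<close> lie in the group algebra, with greatest common divisor \<open>1\<close> there.\<close>
  define S' where "S' = R.scale (inverse d) S"
  have d': "inverse d \<notin> {0}" using d(1) by simp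
  have nz: "\<not> S' \<subseteq> {0}" using R.scale_null[OF d', of S] S(2) by (simp add: S'_def)
  have "inverse d * s \<in> supported UNIV" if "s \<in> S" for s
    using d(2)[of "inverse d"] d(1) that subringD(1)[OF subring_group_algebra] by simp
  then have S'_sub: "S' \<subseteq> range emb" by (auto simp: S'_def supported_def)
  define T where "T = (\<Union>f\<in>{f. emb f \<in> S'}. (\<lambda>k. (lookup f k, k)) ` keys f)"
  have "inj emb" by (simp add: inj_def emb_eq_iff)
  have "finite {f. emb f \<in> S'}"
    using finite_vimageI[OF _ \<open>inj emb\<close>, of S'] S(1) by (simp add: S'_def vimage_def)
  then have finT: "finite T" by (simp add: T_def)
  have T_nz: "a \<noteq> 0" if "(a, g) \<in> T" for a g using that by (auto simp: T_def in_keys_iff)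
  have "T \<noteq> {}"
  proof -
    obtain f where f: "emb f \<in> S'" "emb f \<noteq> 0" using nz S'_sub by blast
    then obtain k where "k \<in> keys f" by (metis emb_zero keys_eq_empty all_not_in_conv)
    then show ?thesis using f unfolding T_def by blast
  qed
  have "R.colon S' = R.colon (homogeneous T)"
  proof (intro subset_antisym subsetI)
    fix x assume x: "x \<in> R.colon S'"
    have "x * inverse d * s \<in> supported UNIV" if "s \<in> S" for s
      using R.colonD[OF x, of "inverse d * s"] that ring_subset_supported
        by (auto simp: S'_def mult.assoc)
    then have "x * inverse d * d \<in> supported UNIV" using d(2) by blast
    moreover have "x * inverse d * d = x" using d(1) by simp
    ultimately obtain u where u: "x = emb u" unfolding supported_def by auto
    show "x \<in> R.colon (homogeneous T)"
    proof (rule R.colonI)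
      fix s assume "s \<in> homogeneous T"
      then obtain f j where fj: "emb f \<in> S'" "j \<in> keys f" "s = emb (single j (lookup f j))"
        by (auto simp: homogeneous_def T_def)
      have "emb u * emb f \<in> ring" using R.colonD[OF x fj(1)] u by simp
      then have "lookup u i * lookup f j \<in> A \<and> i + j \<in> \<Gamma>" if "i \<in> keys u" for i
        using kronecker_semigroup_ring[OF A \<Gamma>] that fj(2) by blast
      moreover have "i \<in> keys (u * single j (lookup f j)) \<Longrightarrow> i - j \<in> keys u" for i
        by (auto simp: in_keys_iff lookup_mult_single)
      moreover have "i - j + j = i" for i by simp
      ultimately show "x * s \<in> ring"
        unfolding u fj(3) emb_mult[symmetric] emb_in_graded lookup_mult_single by metis
    qed
  next
    fix x assume x: "x \<in> R.colon (homogeneous T)"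
    show "x \<in> R.colon S'"
    proof (rule R.colonI)
      fix s assume "s \<in> S'"
      then obtain f where f: "s = emb f" "emb f \<in> S'" using S'_sub by blast
      have "x * s = (\<Sum>k\<in>keys f. x * emb (single k (lookup f k)))"
        unfolding f(1) sum_distrib_left[symmetric] emb_sum[symmetric] sum_single ..
      also have "\<dots> \<in> ring"
      proof (intro subring_sum R.subring_D R.colonD[OF x])
        fix k assume "k \<in> keys f"
        then have "(lookup f k, k) \<in> T" using f(2) by (auto simp: T_def)
        then show "emb (single k (lookup f k)) \<in> homogeneous T" unfolding homogeneous_def by force
      qed
      finally show "x * s \<in> ring" .
    qed
  qed
  define J Y where "J = A.v (fst ` T)" and "Y = \<Gamma>.v (snd ` T)"
  have fst_nz: "\<not> fst ` T \<subseteq> {0}" using \<open>T \<noteq> {}\<close> T_nz by auto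
  have snd_ne: "snd ` T \<noteq> {}" using \<open>T \<noteq> {}\<close> by simp
  have "R.v S' = R.v (homogeneous T)" by (rule R.v_cong) fact
  also have "\<dots> = R.v (homogeneous (fst ` T \<times> snd ` T))"
    by (rule R.v_cong) (simp only: colon_homogeneous[OF \<open>T \<noteq> {}\<close> T_nz]
      colon_homogeneous_prod[OF fst_nz snd_ne])
  also have "\<dots> = graded J Y"
    unfolding J_def Y_def using finT fst_nz snd_ne by (intro v_homogeneous_finite) auto
  finally have vS': "R.v S' = graded J Y" .
  have scaled: "graded J Y = R.scale (inverse d) I"
    unfolding vS'[symmetric] S'_def S(3) by (rule R.scale_v[OF d'])
  have nzJ: "\<not> J \<subseteq> {0}" using fst_nz A.v_extensive[of "fst ` T"] by (auto simp: J_def)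
  have neY: "Y \<noteq> {}" using snd_ne \<Gamma>.v_extensive[of "snd ` T"] by (auto simp: Y_def)
  have closed: "A.t J = J" "\<Gamma>.t Y = Y"
    using A.t_v[of "fst ` T"] \<Gamma>.t_v[of "snd ` T"] nzJ neY by (auto simp: J_def Y_def)
  have "R.t_invertible (graded J Y)" unfolding scaled by (rule R.t_invertible_scale[OF I d'])
  then have "A.t_invertible J" "\<Gamma>.t_invertible Y"
    using t_invertible_graded_components closed nzJ neY by blast+
  moreover have "I = R.scale d (graded J Y)"
    unfolding scaled image_image using d(1) by (simp add: mult.assoc[symmetric])
  ultimately show thesis using that d(1) by blast
qed

text \<open>
  This is the surjectivity of the canonical homomorphism, expressed by ideals instead of classes.
\<close>

definition all_extended :: bool where
  "all_extended \<longleftrightarrow>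
     (\<forall>I. R.t_invertible I \<longrightarrow> (\<exists>x J. x \<noteq> 0 \<and> A.t_invertible J \<and> I = R.scale x (graded J \<Gamma>)))"

theorem all_extended_if:
  assumes A: "integrally_closed_domain A" and \<Gamma>: "integrally_closed_monoid \<Gamma>"
    and Cl: "\<And>Y. \<Gamma>.t_invertible Y \<Longrightarrow> \<exists>\<alpha>. Y = \<Gamma>.scale \<alpha> \<Gamma>"
  shows all_extended
  unfolding all_extended_def
proof (intro allI impI)
  fix I assume "R.t_invertible I"
  then obtain x J Y where x: "x \<noteq> 0" "A.t_invertible J" "\<Gamma>.t_invertible Y"
    "I = R.scale x (graded J Y)"
    by (rule t_invertible_eq_scale_graded[OF A \<Gamma>])
  obtain \<alpha> where \<alpha>: "Y = \<Gamma>.scale \<alpha> \<Gamma>" using Cl[OF x(3)] by blast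
  have "graded J Y = R.scale (emb (single \<alpha> 1)) (graded J \<Gamma>)"
    using scale_graded[of 1 \<alpha> J \<Gamma>] by (simp add: \<alpha>)
  then have "I = R.scale (x * emb (single \<alpha> 1)) (graded J \<Gamma>)"
    by (simp add: x(4) image_image mult.assoc)
  then show "\<exists>x J. x \<noteq> 0 \<and> A.t_invertible J \<and> I = R.scale x (graded J \<Gamma>)"
    using x(1,2) emb_single_nonzero[of 1 \<alpha>]
      by (intro exI[of _ "x * emb (single \<alpha> 1)"] exI[of _ J]) auto
qed

lemma all_extended_monoid_principal:
  assumes all_extended "\<Gamma>.t_invertible Y" shows "\<exists>\<alpha>. Y = \<Gamma>.scale \<alpha> \<Gamma>"
proof -
  have "R.t_invertible (graded A Y)" by (intro t_invertible_graded A.t_invertible_D assms)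
  then obtain x J where x: "x \<noteq> 0" "A.t_invertible J" "graded A Y = R.scale x (graded J \<Gamma>)"
    using assms(1) unfolding all_extended_def by blast
  obtain y where y: "y \<in> Y" using \<Gamma>.t_invertible_not_null[OF assms(2)] by blast
  show ?thesis
    by (rule scale_graded_eq_graded[OF x(2) A.t_invertible_D \<Gamma>.zero_mem y x(3)]) blast
qed

text \<open>
  Consider the ideal \<open>I = {y \<in> R. y s / f \<in> R}\<close>, where \<open>b\<close> and \<open>s\<close> denote the given monomials. It
  contains \<open>p = f q\<close> and \<open>b f\<close>, and \<open>(R : I)\<close> contains \<open>1\<close> and \<open>s / f\<close>; so \<open>p\<close> and \<open>b s\<close> are
  products of elements of \<open>I\<close> and \<open>(R : I)\<close>. The premise \<open>test\<close> says \<open>(R : {p, b s}) = R\<close>, which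
  makes \<open>I\<close> \<open>t\<close>-invertible. Hence \<open>I = x J[\<Gamma>]\<close>, where \<open>x\<close> is \<open>f\<close> up to a monomial, and \<open>p \<in> I\<close>
  says that \<open>q\<close> lies in \<open>J[\<Gamma>]\<close> up to the same monomial. With \<open>q\<close>, each of its homogeneous
  components lies there.
\<close>

lemma all_extended_factor:
  assumes ext: all_extended
    and f: "f \<noteq> 0" "emb f * emb q \<in> ring"
    and b: "b0 \<noteq> 0" "emb (single \<beta> b0) \<in> ring" "emb (single \<beta> b0) * emb f \<in> ring"
    and s: "s0 \<noteq> 0" "emb (single \<sigma> s0) \<in> ring" "emb (single \<sigma> s0) * emb q \<in> ring"
    and test: "\<And>x. x * emb (single (\<beta> + \<sigma>) (b0 * s0)) \<in> ring \<Longrightarrow> x * (emb f * emb q) \<in>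
      ring \<Longrightarrow> x \<in> ring"
    and k: "k \<in> keys q"
  shows "emb (single k (lookup q k)) * emb f \<in> ring"
proof -
  define b s p where "b = emb (single \<beta> b0)" and "s = emb (single \<sigma> s0)" and "p = emb f * emb q"
  have nz: "b \<noteq> 0" "s \<noteq> 0" "emb f \<noteq> 0"
    using emb_single_nonzero b(1) s(1) f(1) by (auto simp: b_def s_def emb_eq_0_iff)
  have bs: "emb (single (\<beta> + \<sigma>) (b0 * s0)) = b * s"
    by (simp add: b_def s_def mult_single flip: emb_mult)
  have bR: "b \<in> ring" "b * emb f \<in> ring" "s \<in> ring" "s * emb q \<in> ring" "p \<in> ring"
    using b s f by (auto simp: b_def s_def p_def)
  define N where "N = {1, s / emb f}"
  define I where "I = R.colon N"
  have I_iff: "y \<in> I \<longleftrightarrow> y \<in> ring \<and> y * (s / emb f) \<in> ring" for y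
    by (simp add: I_def N_def R.colon_def)
  have pI: "p \<in> I" using bR nz by (simp add: I_iff p_def mult.commute)
  have bI: "b * emb f \<in> I" using bR nz R.mult_in[OF bR(1,3)] by (simp add: I_iff)
  have "\<not> I \<subseteq> {0}" using bI nz by auto
  have N: "N \<subseteq> R.colon I" unfolding I_def using R.v_extensive[of N] by (simp add: R.v_def)
  have "R.t_invertible I"
  proof (rule R.t_invertibleI)
    show "R.t I = I" using R.t_v[of "R.colon N"] \<open>\<not> I \<subseteq> {0}\<close> by (simp add: R.v_colon I_def)
    show "\<not> R.colon I \<subseteq> {0}" using N by (auto simp: N_def)
    show "1 \<in> R.t (R.prod I (R.colon I))"
    proof (rule R.tI)
      show "1 \<in> R.v {p, b * s}"
        unfolding R.v_def
      proof (rule R.colonI)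
        fix z assume z: "z \<in> R.colon {p, b * s}"
        show "1 * z \<in> ring" using test[of z] R.colonD[OF z] by (simp add: bs p_def)
      qed
      have "p * 1 \<in> R.prod I (R.colon I)" using N by (intro R.prodI pI) (auto simp: N_def)
      moreover have "(b * emb f) * (s / emb f) \<in> R.prod I (R.colon I)"
        using N by (intro R.prodI bI) (auto simp: N_def)
      ultimately show "{p, b * s} \<subseteq> R.prod I (R.colon I)" using nz by simp
      show "\<not> {p, b * s} \<subseteq> {0}" using nz by simp
    qed simp
  qed
  then obtain x J where x: "x \<noteq> 0" "A.t_invertible J" "I = R.scale x (graded J \<Gamma>)"
    using ext unfolding all_extended_def by blast
  obtain c where c: "c \<in> J" "c \<noteq> 0" using x(2) by (rule t_invertible_nonzero)
  have RG: "y \<in> range emb" if "y \<in> ring" for y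
    using that ring_subset_supported by (auto simp: supported_def)
  have GG: "y * z \<in> range emb" if "y \<in> range emb" "z \<in> range emb" for y z
    using that by (auto simp flip: emb_mult)
  \<comment> \<open>\<open>x\<close> and \<open>f\<close> divide each other in the group algebra, so they differ by a monomial.\<close>
  have "x * emb (single 0 c) \<in> I"
    unfolding x(3) using c \<Gamma>.zero_mem by (intro imageI single_in_graded)
  then have "x * emb (single 0 c) * (s / emb f) \<in> range emb" by (intro RG) (simp add: I_iff)
  moreover have "inverse (emb (single 0 c)) \<in> range emb" "inverse s \<in> range emb"
    "inverse b \<in> range emb"
    unfolding s_def b_def by (simp_all add: inverse_emb_single c s b)
  ultimately have "x * emb (single 0 c) * (s / emb f) * (inverse (emb (single 0 c)) * inverse s)
    \<in> range emb"
    by (intro GG[of "x * emb (single 0 c) * (s / emb f)"] GG[of "inverse (emb (single 0 c))"])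
  then have 1: "x / emb f \<in> supported UNIV"
    using emb_single_nonzero[OF c(2)] nz by (simp add: supported_def field_simps)
  obtain j where j: "b * emb f = x * emb j" using bI unfolding x(3) by (auto elim!: gradedE)
  then have "inverse (x / emb f) = emb j * inverse b" using x(1) nz by (simp add: field_simps)
  also have "\<dots> \<in> range emb" by (intro GG \<open>inverse b \<in> range emb\<close>) simp
  finally have 2: "inverse (x / emb f) \<in> supported UNIV" by (simp add: supported_def)
  obtain h u where hu: "u \<noteq> 0" "x / emb f = emb (single h u)"
    by (rule group_algebra_unit[OF 1 2]) (use x(1) nz in auto)
  then have x_eq: "x = emb f * emb (single h u)" using nz by (simp add: field_simps)
  obtain j' where j': "p = x * emb j'" "\<forall>g\<in>keys j'. lookup j' g \<in> J \<and> g \<in> \<Gamma>"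
    using pI unfolding x(3) by (auto elim!: gradedE)
  have "emb f * emb q = emb f * (emb (j' * single h u))"
    using j'(1) by (simp add: p_def x_eq emb_mult ac_simps)
  then have "emb q = emb (j' * single h u)" using nz by simp
  then have q: "q = j' * single h u" by (simp add: emb_eq_iff)
  have lq: "lookup q k = lookup j' (k - h) * u" unfolding q by (rule lookup_mult_single)
  then have "k - h \<in> keys j'" using k by (auto simp: in_keys_iff)
  then have "emb (single (k - h) (lookup j' (k - h))) \<in> graded J \<Gamma>"
    using j'(2) by (intro single_in_graded) auto
  then have "x * emb (single (k - h) (lookup j' (k - h))) \<in> ring"
    using I_iff unfolding x(3) by blast
  moreover have "x * emb (single (k - h) (lookup j' (k - h))) = emb f * emb (single h u * single
    (k - h) (lookup j' (k - h)))"
    unfolding x_eq emb_mult by (simp add: ac_simps)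
  ultimately show ?thesis by (simp add: lq mult_single mult.commute)
qed

lemma multiple_inj:
  assumes "\<gamma> \<noteq> (0 :: 'g)" shows "multiple i \<gamma> = multiple j \<gamma> \<longleftrightarrow> i = j"
proof
  assume eq: "multiple i \<gamma> = multiple j \<gamma>"
  have *: "j \<le> i" if "multiple i \<gamma> = multiple j \<gamma>" for i j
  proof (rule ccontr)
    assume "\<not> j \<le> i"
    then have "multiple j \<gamma> = multiple (j - i) \<gamma> + multiple i \<gamma>"
      using multiple_add[of \<gamma> "j - i" i] by simp
    then have "multiple (j - i) \<gamma> = 0" using that by simp
    then show False using torsion_free[of "j - i" \<gamma>] \<open>\<not> j \<le> i\<close> assms by simp
  qed
  show "i = j" using *[OF eq] *[OF eq[symmetric]] by simp
qed simp

lemma no_infinite_progression: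
  assumes "\<gamma> \<noteq> (0 :: 'g)" "\<And>m. k + multiple m \<gamma> \<in> keys y" shows False
proof -
  have "inj (\<lambda>m. k + multiple m \<gamma>)" by (simp add: inj_def multiple_inj[OF assms(1)])
  then have "infinite (range (\<lambda>m. k + multiple m \<gamma>))" using finite_imageD by blast
  moreover have "range (\<lambda>m. k + multiple m \<gamma>) \<subseteq> keys y" using assms(2) by blast
  ultimately show False using finite_subset finite_keys by blast
qed

text \<open>
  If \<open>u\<close> is a root of the monic polynomial \<open>p = (X - u) q\<close>, apply \<open>all_extended_factor\<close> to
  \<open>(X\<^sup>\<gamma> - u) q(X\<^sup>\<gamma>)\<close> and to the leading term \<open>X\<^bsup>n \<gamma>\<^esup>\<close> of \<open>q(X\<^sup>\<gamma>)\<close>: the product \<open>X\<^bsup>n \<gamma>\<^esup> (X\<^sup>\<gamma> - u)\<close>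
  can be in \<open>R\<close> only if \<open>u \<in> A\<close>.
\<close>

theorem all_extended_domain:
  assumes ext: all_extended and \<gamma>: "\<gamma> \<in> \<Gamma>" "\<gamma> \<noteq> 0" shows "integrally_closed_domain A"
  unfolding integrally_closed_domain_def
proof (intro allI impI)
  fix u assume "\<exists>p. lead_coeff p = 1 \<and> (\<forall>i. coeff p i \<in> A) \<and> poly p u = 0"
  then obtain p where p: "lead_coeff p = 1" "\<And>i. coeff p i \<in> A" "poly p u = 0" by blast
  obtain q where pq: "p = [:- u, 1:] * q" using p(3) by (auto simp: poly_eq_0_iff_dvd)
  have "p \<noteq> 0" using p(1) by auto
  then have "q \<noteq> 0" using pq by auto
  define n where "n = degree q"
  have dp: "degree p = Suc n" unfolding pq n_def using \<open>q \<noteq> 0\<close> by (subst degree_mult_eq) auto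
  have lq: "coeff q n = 1" using p(1) unfolding pq lead_coeff_mult n_def by simp
  have coeff_p: "coeff p i = (if i = 0 then 0 else coeff q (i - 1)) - u * coeff q i" for i
    unfolding pq by (cases i) (simp_all add: coeff_pCons)
  have \<gamma>_mult: "multiple i \<gamma> \<in> \<Gamma>" for i by (intro multiple_mem \<Gamma>.zero_mem \<Gamma>.add_mem \<gamma>)
  define f where "f = single \<gamma> 1 - single 0 u"
  define Q where "Q = (\<Sum>i\<le>n. single (multiple i \<gamma>) (coeff q i))"
  define P where "P = (\<Sum>i\<le>Suc n. single (multiple i \<gamma>) (coeff p i))"
  have lookup_sum_multiples: "lookup (\<Sum>i\<le>m. single (multiple i \<gamma>) (c i)) (multiple j \<gamma>) = (if j
    \<le> m then c j else 0)"
    for c m j by (simp add: lookup_sum lookup_single when_def multiple_inj[OF \<gamma>(2)])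
  have fQ: "f * Q = P"
  proof -
    have "f * Q = (\<Sum>i\<le>n. single (multiple (Suc i) \<gamma>) (coeff q i)) - (\<Sum>i\<le>n. single (multiple i \<gamma>)
      (u * coeff q i))"
      unfolding f_def Q_def left_diff_distrib sum_distrib_left
        by (simp add: mult_single sum_subtractf add.commute)
    also have "(\<Sum>i\<le>n. single (multiple (Suc i) \<gamma>) (coeff q i))
        = (\<Sum>i\<le>Suc n. single (multiple i \<gamma>) (if i = 0 then 0 else coeff q (i - 1)))"
      by (simp only: sum.atMost_Suc_shift) simp
    also have "(\<Sum>i\<le>n. single (multiple i \<gamma>) (u * coeff q i)) = (\<Sum>i\<le>Suc n. single (multiple i \<gamma>)
      (u * coeff q i))"
      by (simp add: n_def coeff_eq_0)
    finally show ?thesis unfolding P_def coeff_p by (simp only: single_diff sum_subtractf)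
  qed
  have P_ring: "emb f * emb Q \<in> ring"
    unfolding emb_mult[symmetric] fQ P_def emb_sum
    by (intro subring_sum R.subring_D single_in_graded p \<gamma>_mult)
  \<comment> \<open>Constants suffice as the monomials of \<open>all_extended_factor\<close>: \<open>b0\<close> clears the denominator of
    \<open>u\<close>, and \<open>s0\<close> those of \<open>q\<close>.\<close>
  obtain b0 where b0: "b0 \<in> A" "b0 \<noteq> 0" "b0 * u \<in> A"
    by (rule A.common_denominator[of "{u}"]) auto
  obtain s0 where s0: "s0 \<in> A" "s0 \<noteq> 0" "\<And>x. x \<in> coeff q ` {..n} \<Longrightarrow> s0 * x \<in> A"
    by (rule A.common_denominator[of "coeff q ` {..n}"]) auto
  have "emb (single (multiple n \<gamma>) (lookup Q (multiple n \<gamma>))) * emb f \<in> ring"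
  proof (rule all_extended_factor[OF ext _ P_ring b0(2) _ _ s0(2)])
    show "f \<noteq> 0"
    proof
      assume "f = 0"
      then have "lookup f \<gamma> = 0" by simp
      then show False using \<gamma>(2) by (simp add: f_def lookup_minus lookup_single)
    qed
    show "emb (single 0 b0) \<in> ring" "emb (single 0 s0) \<in> ring"
      using b0 s0 by (intro single_in_graded \<Gamma>.zero_mem; simp)+
    have "emb (single \<gamma> b0) - emb (single 0 (b0 * u)) \<in> ring"
      using b0 \<gamma> by (intro R.diff_in single_in_graded \<Gamma>.zero_mem)
    then show "emb (single 0 b0) * emb f \<in> ring"
      by (simp add: f_def right_diff_distrib mult_single flip: emb_mult emb_diff)
    have "emb (single 0 s0 * Q) \<in> ring"
      unfolding Q_def sum_distrib_left emb_sum mult_single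
      by (intro subring_sum R.subring_D single_in_graded s0) (use \<gamma>_mult in auto)
    then show "emb (single 0 s0) * emb Q \<in> ring" by (simp add: emb_mult)
    show "multiple n \<gamma> \<in> keys Q" by (simp add: in_keys_iff Q_def lookup_sum_multiples lq)
  next
    fix x assume x: "x * emb (single (0 + 0) (b0 * s0)) \<in> ring" "x * (emb f * emb Q) \<in> ring"
    have bs: "b0 * s0 \<noteq> 0" using b0 s0 by simp
    from x(1) obtain y' where y': "x * emb (single 0 (b0 * s0)) = emb y'" "keys y' \<subseteq> \<Gamma>"
      by (auto elim!: gradedE)
    define y where "y = y' * single 0 (inverse (b0 * s0))"
    have ly: "lookup y k = lookup y' k * inverse (b0 * s0)" for k
      unfolding y_def lookup_mult_single by simp
    have "x = x * emb (single 0 (b0 * s0)) * inverse (emb (single 0 (b0 * s0)))"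
      using emb_single_nonzero[OF bs] by simp
    then have xy: "x = emb y"
      unfolding y'(1) inverse_emb_single[OF bs] emb_mult[symmetric] y_def by (simp only: minus_zero)
    have keys_y: "keys y \<subseteq> \<Gamma>" using y'(2) ly by (auto simp: in_keys_iff subset_iff)
    have "emb (y * P) \<in> ring" using x(2) unfolding xy emb_mult[symmetric] fQ .
    then have yP: "lookup (y * P) k \<in> A" for k
      unfolding emb_in_graded using A.zero_in by (cases "k \<in> keys (y * P)") (auto simp: in_keys_iff)
    have lyP: "lookup (y * P) k = (\<Sum>i\<le>n. lookup y (k - multiple i \<gamma>) * coeff p i) + lookup y (k
      - multiple (Suc n) \<gamma>)" for k
      using p(1)
        unfolding P_def sum_distrib_left
        by (simp add: lookup_sum lookup_add lookup_mult_single dp del: sum.lessThan_Suc)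
    \<comment> \<open>A coefficient of \<open>y\<close> outside \<open>A\<close> forces another one at one of the next \<open>n + 1\<close>
      exponents along \<open>\<gamma>\<close>.\<close>
    have next_bad: "\<exists>j\<ge>1. lookup y (k + multiple j \<gamma>) \<notin> A" if bad: "lookup y k \<notin> A" for k
    proof (rule ccontr)
      assume good: "\<not> ?thesis"
      have "lookup y (k + multiple (Suc n) \<gamma> - multiple i \<gamma>) \<in> A" if "i \<le> n" for i
      proof -
        have "multiple (Suc n) \<gamma> = multiple (Suc n - i) \<gamma> + multiple i \<gamma>"
          using multiple_add[of \<gamma> "Suc n - i" i] that by simp
        then have "k + multiple (Suc n) \<gamma> - multiple i \<gamma> = k + multiple (Suc n - i) \<gamma>" by simp
        then show ?thesis using good that by (metis Suc_leI Suc_diff_le zero_less_Suc One_nat_def)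
      qed
      then have "(\<Sum>i\<le>n. lookup y (k + multiple (Suc n) \<gamma> - multiple i \<gamma>) * coeff p i) \<in> A"
        using p(2) A.mult_in by (intro subring_sum A.subring_D) auto
      then have "lookup (y * P) (k + multiple (Suc n) \<gamma>)
          - (\<Sum>i\<le>n. lookup y (k + multiple (Suc n) \<gamma> - multiple i \<gamma>) * coeff p i) \<in> A"
        using yP by (intro A.diff_in)
      then show False using bad unfolding lyP by simp
    qed
    have "lookup y k \<in> A" for k
    proof (rule ccontr)
      assume k: "lookup y k \<notin> A"
      define M where "M = {m. lookup y (k + multiple m \<gamma>) \<notin> A}"
      have "0 \<in> M" using k by (simp add: M_def)
      have "inj_on (\<lambda>m. k + multiple m \<gamma>) M" by (simp add: inj_on_def multiple_inj[OF \<gamma>(2)])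
      moreover have "(\<lambda>m. k + multiple m \<gamma>) ` M \<subseteq> keys y"
        using A.zero_in by (auto simp: M_def in_keys_iff)
      ultimately have "finite M" using finite_imageD finite_subset finite_keys by metis
      then have max: "Max M \<in> M" "\<And>m. m \<in> M \<Longrightarrow> m \<le> Max M"
        using \<open>0 \<in> M\<close> Max_in[of M] Max_ge[of M] by blast+
      obtain j where j: "j \<ge> 1" "lookup y (k + multiple (Max M) \<gamma> + multiple j \<gamma>) \<notin> A"
        using next_bad max(1) unfolding M_def by blast
      then have "Max M + j \<in> M" by (simp add: M_def multiple_add add.assoc)
      then show False using max(2) j(1) by fastforce
    qed
    then show "x \<in> ring" unfolding xy emb_in_graded using keys_y by blast
  qed
  then have "emb (single (multiple n \<gamma>) 1 * f) \<in> ring"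
    by (simp add: Q_def lookup_sum_multiples lq emb_mult)
  moreover have "single (multiple n \<gamma>) 1 * f = single (multiple (Suc n) \<gamma>) 1 - single
    (multiple n \<gamma>) u"
    by (simp add: f_def right_diff_distrib mult_single)
  ultimately have *: "\<forall>g\<in>keys (single (multiple (Suc n) \<gamma>) 1 - single (multiple n \<gamma>) u).
      lookup (single (multiple (Suc n) \<gamma>) 1 - single (multiple n \<gamma>) u) g \<in> A"
    unfolding emb_in_graded by simp
  have "lookup (single (multiple (Suc n) \<gamma>) 1 - single (multiple n \<gamma>) u) (multiple n \<gamma>) = - u"
    using multiple_inj[OF \<gamma>(2), of "Suc n" n] by (simp add: lookup_minus lookup_single when_def)
  then have "u = 0 \<or> - u \<in> A" using * by (metis in_keys_iff neg_equal_0_iff_equal)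
  then show "u \<in> A" using A.zero_in A.diff_in[OF A.zero_in, of "- u"] by auto
qed

text \<open>
  If \<open>n g \<in> \<Gamma>\<close>, apply \<open>all_extended_factor\<close> to
  \<open>X\<^bsup>n g\<^esup> - 1 = (X\<^sup>g - 1) (1 + X\<^sup>g + \<dots> + X\<^bsup>(n - 1) g\<^esup>)\<close> and to the constant term of the second
  factor: \<open>X\<^sup>g - 1\<close> can be in \<open>R\<close> only if \<open>g \<in> \<Gamma>\<close>.
\<close>

theorem all_extended_monoid:
  assumes ext: all_extended shows "integrally_closed_monoid \<Gamma>"
  unfolding integrally_closed_monoid_def
proof (intro allI impI)
  fix g :: 'g and n :: nat assume n: "n \<ge> 1" and ng: "multiple n g \<in> \<Gamma>"
  show "g \<in> \<Gamma>"
  proof (cases "g = 0")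
    case True
    then show ?thesis using \<Gamma>.zero_mem by simp
  next
    case False
    define f where "f = single g (1 :: 'k) - single 0 1"
    define q where "q = (\<Sum>i<n. single (multiple i g) (1 :: 'k))"
    define c where "c = multiple n g"
    have "c \<noteq> 0" using torsion_free[of n g] n False by (auto simp: c_def)
    have fq: "f * q = single c 1 - single 0 1"
    proof -
      have "f * q = (\<Sum>i<n. single (multiple (Suc i) g) 1 - single (multiple i g) 1)"
        unfolding f_def q_def sum_distrib_left
          by (simp add: left_diff_distrib mult_single add.commute)
      also have "\<dots> = single c 1 - single 0 1"
        using sum_lessThan_telescope[of "\<lambda>i. single (multiple i g) (1 :: 'k)" n]
          by (simp add: c_def)
      finally show ?thesis .
    qed
    have lf: "lookup f g = 1" using False by (simp add: f_def lookup_minus lookup_single lookup_one)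
    have lq: "lookup q 0 = 1"
    proof -
      have "multiple i g = 0 \<longleftrightarrow> i = 0" for i using multiple_inj[OF False, of i 0] by simp
      then show ?thesis using n by (simp add: q_def lookup_sum lookup_single when_def)
    qed
    have P_ring: "emb f * emb q \<in> ring"
      unfolding emb_mult[symmetric] fq emb_diff c_def using ng
      by (intro R.diff_in single_in_graded A.one_in \<Gamma>.zero_mem)
    obtain \<alpha> \<beta> where \<alpha>\<beta>: "\<alpha> \<in> \<Gamma>" "\<beta> \<in> \<Gamma>" "g = \<alpha> - \<beta>" by (rule \<Gamma>.differenceE)
    \<comment> \<open>The monomials \<open>X\<^sup>\<beta>\<close> and \<open>X\<^sup>\<sigma>\<close> move the exponents of \<open>f\<close> and of \<open>q\<close> into \<open>\<Gamma>\<close>.\<close>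
    obtain \<sigma> where \<sigma>: "\<sigma> \<in> \<Gamma>" "\<And>x. x \<in> (\<lambda>i. multiple i g) ` {..<n} \<Longrightarrow> \<sigma> + x \<in> \<Gamma>"
      using grading_monoid_common_shift[OF \<Gamma>.grading, of "(\<lambda>i. multiple i g) ` {..<n}"] by auto
    have "emb (single 0 (lookup q 0)) * emb f \<in> ring"
    proof (rule all_extended_factor[OF ext _ P_ring one_neq_zero _ _ one_neq_zero])
      show "f \<noteq> 0" using lf by auto
      show "emb (single \<beta> 1) \<in> ring" "emb (single \<sigma> 1) \<in> ring"
        using \<alpha>\<beta> \<sigma> by (intro single_in_graded A.one_in; simp)+
      have "emb (single \<alpha> 1) - emb (single \<beta> 1) \<in> ring"
        using \<alpha>\<beta> by (intro R.diff_in single_in_graded A.one_in)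
      then show "emb (single \<beta> 1) * emb f \<in> ring"
        by (simp add: f_def right_diff_distrib mult_single \<alpha>\<beta>(3) flip: emb_mult emb_diff)
      have "emb (single \<sigma> 1 * q) \<in> ring"
        unfolding q_def sum_distrib_left emb_sum mult_single
        by (intro subring_sum R.subring_D single_in_graded) (use \<sigma> A.one_in in auto)
      then show "emb (single \<sigma> 1) * emb q \<in> ring" by (simp add: emb_mult)
      show "0 \<in> keys q" using lq by (simp add: in_keys_iff)
    next
      fix x assume x: "x * emb (single (\<beta> + \<sigma>) (1 * 1)) \<in> ring" "x * (emb f * emb q) \<in> ring"
      from x(1) obtain y' where y': "x * emb (single (\<beta> + \<sigma>) 1) = emb y'"
        "\<forall>k\<in>keys y'. lookup y' k \<in> A" by (auto elim!: gradedE)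
      define y where "y = y' * single (- (\<beta> + \<sigma>)) 1"
      have ly: "lookup y k = lookup y' (k + (\<beta> + \<sigma>))" for k
        unfolding y_def lookup_mult_single diff_minus_eq_add by (rule mult_1_right)
      have "x = x * emb (single (\<beta> + \<sigma>) 1) * inverse (emb (single (\<beta> + \<sigma>) 1))"
        using emb_single_nonzero[of 1 "\<beta> + \<sigma>"] by simp
      then have xy: "x = emb y"
        unfolding y'(1) inverse_emb_single[OF one_neq_zero] emb_mult[symmetric] y_def
          by (simp only: inverse_1)
      have coeffs_y: "lookup y k \<in> A" if "k \<in> keys y" for k
      proof -
        have "k + (\<beta> + \<sigma>) \<in> keys y'" using that by (simp only: in_keys_iff ly not_False_eq_True)
        then have "lookup y' (k + (\<beta> + \<sigma>)) \<in> A" by (rule bspec[OF y'(2)])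
        then show ?thesis by (simp only: ly)
      qed
      have "emb (y * (single c 1 - single 0 1)) \<in> ring"
        using x(2) unfolding xy emb_mult[symmetric] fq .
      then have prod: "k \<in> \<Gamma>" if "lookup y (k - c) \<noteq> lookup y k" for k
        using that
          unfolding emb_in_graded
          by (auto simp: right_diff_distrib in_keys_iff lookup_minus lookup_mult_single)
      \<comment> \<open>An exponent \<open>k\<close> of \<open>y\<close> outside \<open>\<Gamma>\<close> would entail all exponents \<open>k - m c\<close>.\<close>
      have "k \<in> \<Gamma>" if k: "k \<in> keys y" for k
      proof (rule ccontr)
        assume nk: "k \<notin> \<Gamma>"
        have "k + multiple m (- c) \<in> keys y \<and> k + multiple m (- c) \<notin> \<Gamma>" for m
        proof (induction m)
          case 0
          then show ?case using k nk by simp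
        next
          case (Suc m)
          define l where "l = k + multiple m (- c)"
          have l: "l \<in> keys y" "l \<notin> \<Gamma>" using Suc by (auto simp: l_def)
          have "lookup y (l - c) = lookup y l" using prod l(2) by blast
          then have "l - c \<in> keys y" using l(1) by (simp add: in_keys_iff)
          moreover have "l - c \<notin> \<Gamma>" using \<Gamma>.add_mem[of "l - c" c] ng l(2) by (auto simp: c_def)
          moreover have eq: "k + multiple (Suc m) (- c) = l - c" by (simp add: l_def)
          ultimately show ?case unfolding eq by blast
        qed
        then show False using no_infinite_progression[of "- c" k y] \<open>c \<noteq> 0\<close> by simp
      qed
      then show "x \<in> ring" unfolding xy emb_in_graded using coeffs_y by blast
    qed
    then have "emb f \<in> ring" by (simp add: lq emb_one)
    then show ?thesis using lf unfolding emb_in_graded by (auto simp: in_keys_iff)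
  qed
qed

theorem all_extended_iff:
  assumes "\<Gamma> \<noteq> {0}"
  shows "all_extended \<longleftrightarrow> integrally_closed_domain A \<and> integrally_closed_monoid \<Gamma> \<and>
    (\<forall>Y. \<Gamma>.t_invertible Y \<longrightarrow> (\<exists>\<alpha>. Y = \<Gamma>.scale \<alpha> \<Gamma>))"
proof -
  obtain \<gamma> where "\<gamma> \<in> \<Gamma>" "\<gamma> \<noteq> 0" using assms \<Gamma>.zero_mem by blast
  then show ?thesis
    using all_extended_if all_extended_domain all_extended_monoid all_extended_monoid_principal
      by blast
qed

end

section \<open>The canonical homomorphism\<close>

lemma fract_embed_add: "fract_embed (x + y) = fract_embed x + fract_embed y"
proof -
  have "group_ring_monom a 0 + group_ring_monom b 0 = (group_ring_monom (a + b) 0 :: ('a, 'b)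
    group_ring)" for a b :: 'a
    by transfer (simp add: single_add)
  then show ?thesis
    by (cases x; cases y)
      (simp add: fract_embed_Fract group_ring_monom_0 group_ring_monom_mult)
qed

lemma group_ring_monom_one: "group_ring_monom 1 0 = 1"
  by transfer simp

lemma fract_embed_to_fract: "fract_embed (to_fract a) = to_fract (group_ring_monom a 0)"
  unfolding to_fract_def by (subst fract_embed_Fract) (simp_all add: group_ring_monom_one)

lemma fract_embed_one: "fract_embed 1 = 1"
  using fract_embed_to_fract[of 1] by (simp add: group_ring_monom_one)

lemma group_ring_coeffs_sum: "group_ring_coeffs (sum f I) = (\<Sum>i\<in>I. group_ring_coeffs (f i))"
  by (induction I rule: infinite_finite_induct) (simp_all add: zero_group_ring.rep_eq
    plus_group_ring.rep_eq)

lemma to_fract_sum: "to_fract (sum f I) = (\<Sum>i\<in>I. to_fract (f i))"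
  by (induction I rule: infinite_finite_induct) simp_all

lemma sum_monom:
  "(\<Sum>k\<in>keys (group_ring_coeffs F). group_ring_monom (lookup (group_ring_coeffs F) k) k) = F"
  by (simp add: group_ring_coeffs_inject[symmetric] group_ring_coeffs_sum group_ring_monom.rep_eq
    sum_single)

text \<open>
  The embedding of \<open>K[G]\<close>, for the quotient field \<open>K\<close> of \<open>A\<close>, into the quotient field of \<open>A[G]\<close>.
\<close>

definition embed_algebra ::
    "('g::torsion_free_ab_group_add \<Rightarrow>\<^sub>0 'a::idom fract) \<Rightarrow> ('a, 'g) group_ring fract" where
  "embed_algebra f = (\<Sum>k\<in>keys f. fract_embed (lookup f k) * to_fract (group_ring_monom 1 k))"

lemma embed_algebra_superset:
  assumes "finite S" "keys f \<subseteq> S"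
  shows "embed_algebra f = (\<Sum>k\<in>S. fract_embed (lookup f k) * to_fract (group_ring_monom 1 k))"
  unfolding embed_algebra_def
  by (rule sum.mono_neutral_left) (use assms in \<open>auto simp: in_keys_iff fract_embed_0\<close>)

lemma embed_algebra_single:
  "embed_algebra (single g a) = fract_embed a * to_fract (group_ring_monom 1 g)"
  by (subst embed_algebra_superset[of "{g}"]) auto

lemma embed_algebra_single_to_fract:
  "embed_algebra (single g (to_fract a)) = to_fract (group_ring_monom a g)"
  by (simp add: embed_algebra_single fract_embed_to_fract group_ring_monom_mult flip: to_fract_mult)

lemma embed_algebra_add: "embed_algebra (f + g) = embed_algebra f + embed_algebra g"
proof -
  let ?S = "keys f \<union> keys g"
  have "embed_algebra (f + g) = (\<Sum>k\<in>?S. fract_embed (lookup (f + g) k) * to_fract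
    (group_ring_monom 1 k))"
    by (rule embed_algebra_superset) (use keys_add[of f g] in auto)
  also have "\<dots> = (\<Sum>k\<in>?S. fract_embed (lookup f k) * to_fract (group_ring_monom 1 k))
      + (\<Sum>k\<in>?S. fract_embed (lookup g k) * to_fract (group_ring_monom 1 k))"
    by (simp add: lookup_add fract_embed_add distrib_right sum.distrib)
  also have "\<dots> = embed_algebra f + embed_algebra g"
    using embed_algebra_superset[of ?S f] embed_algebra_superset[of ?S g] by simp
  finally show ?thesis .
qed

lemma embed_algebra_sum: "embed_algebra (sum f I) = (\<Sum>i\<in>I. embed_algebra (f i))"
  by (induction I rule: infinite_finite_induct) (simp_all add: embed_algebra_add
    embed_algebra_def[of 0])

lemma embed_algebra_mult:
  fixes f g :: "'g::torsion_free_ab_group_add \<Rightarrow>\<^sub>0 'a::idom fract"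
  shows "embed_algebra (f * g) = embed_algebra f * embed_algebra g"
proof -
  have single: "embed_algebra (single i a * single j b) = embed_algebra (single i a) *
    embed_algebra (single j b)"
    for i j :: 'g and a b :: "'a fract"
    by (simp add: mult_single embed_algebra_single fract_embed_mult group_ring_monom_mult ac_simps
      flip: to_fract_mult)
  have "f * g = (\<Sum>i\<in>keys f. \<Sum>j\<in>keys g. single i (lookup f i) * single j (lookup g j))"
    by (simp add: sum_single flip: sum_product)
  then have "embed_algebra (f * g)
      = (\<Sum>i\<in>keys f. \<Sum>j\<in>keys g. embed_algebra (single i (lookup f i)) * embed_algebra (single j
        (lookup g j)))"
    by (simp add: embed_algebra_sum single)
  also have "\<dots> = embed_algebra f * embed_algebra g"
    by (simp add: sum_single flip: sum_product embed_algebra_sum)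
  finally show ?thesis .
qed

text \<open>
  A common denominator \<open>c\<close> of the coefficients turns \<open>f\<close> into an element of \<open>A[G]\<close>, for which the
  embedding is the canonical one.
\<close>

lemma embed_algebra_eq_0:
  fixes f :: "'g::torsion_free_ab_group_add \<Rightarrow>\<^sub>0 'a::idom fract"
  assumes "embed_algebra f = 0" shows "f = 0"
proof -
  interpret A: fraction_domain "base_ring :: 'a fract set"
    by unfold_locales (rule base_ring_quotient_field)
  obtain c where c: "c \<in> base_ring" "c \<noteq> 0" "\<And>a. a \<in> lookup f ` keys f \<Longrightarrow> c * a \<in> base_ring"
    by (rule A.common_denominator[of "lookup f ` keys f"]) auto
  then have "\<forall>k\<in>keys f. \<exists>n. c * lookup f k = to_fract n" by (auto simp: base_ring_def)
  then obtain n where "\<forall>k\<in>keys f. c * lookup f k = to_fract (n k)" by (rule bchoice[THEN exE])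
  then have n: "c * lookup f k = to_fract (n k)" if "k \<in> keys f" for k using that by blast
  have "0 = embed_algebra (single 0 c) * embed_algebra f" using assms by simp
  also have "\<dots> = embed_algebra (\<Sum>k\<in>keys f. single 0 c * single k (lookup f k))"
    by (simp add: embed_algebra_mult sum_single flip: sum_distrib_left)
  also have "\<dots> = (\<Sum>k\<in>keys f. to_fract (group_ring_monom (n k) k))"
    by (simp add: embed_algebra_sum mult_single n embed_algebra_single_to_fract)
  finally have "to_fract (\<Sum>k\<in>keys f. group_ring_monom (n k) k) = 0"
    by (simp only: to_fract_sum)
  then have "(\<Sum>k\<in>keys f. group_ring_monom (n k) k) = 0" by (simp only: to_fract_eq_0_iff)
  then have "group_ring_coeffs (\<Sum>k\<in>keys f. group_ring_monom (n k) k) = 0"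
    by (simp only: zero_group_ring.rep_eq)
  then have "(\<Sum>k\<in>keys f. single k (n k)) = 0"
    by (simp add: group_ring_coeffs_sum group_ring_monom.rep_eq)
  then have zero: "lookup (\<Sum>k\<in>keys f. single k (n k)) g = 0" for g by simp
  have "n k = 0" if k: "k \<in> keys f" for k
  proof -
    have "0 = (\<Sum>i\<in>keys f. lookup (single i (n i)) k)" using zero[of k] by (simp only: lookup_sum)
    also have "\<dots> = (\<Sum>i\<in>keys f. if i = k then n k else 0)"
      by (rule sum.cong) (auto simp: lookup_single)
    also have "\<dots> = n k" using k by simp
    finally show ?thesis by simp
  qed
  then have "k \<notin> keys f" for k using n[of k] c(2) by (auto simp: in_keys_iff)
  then have "keys f = {}" by blast
  then show ?thesis by simp
qed

lemma to_fract_eq_embed_algebra: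
  "to_fract F = embed_algebra (\<Sum>k\<in>keys (group_ring_coeffs F). single k (to_fract (lookup
    (group_ring_coeffs F) k)))"
  by (simp add: embed_algebra_sum embed_algebra_single_to_fract sum_monom flip: to_fract_sum)

lemma group_algebra_embed_algebra:
  "group_algebra (embed_algebra :: ('g::torsion_free_ab_group_add \<Rightarrow>\<^sub>0 'a::idom fract) \<Rightarrow> ('a, 'g)
    group_ring fract)"
proof
  fix f g :: "'g \<Rightarrow>\<^sub>0 'a fract"
  show "embed_algebra (f + g) = embed_algebra f + embed_algebra g" by (rule embed_algebra_add)
  show "embed_algebra (f * g) = embed_algebra f * embed_algebra g" by (rule embed_algebra_mult)
  show "embed_algebra f = 0 \<Longrightarrow> f = 0" by (rule embed_algebra_eq_0)
  show "embed_algebra (1 :: 'g \<Rightarrow>\<^sub>0 'a fract) = 1"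
    using embed_algebra_single[of 0 "1 :: 'a fract"]
      by (simp add: fract_embed_one group_ring_monom_one)
next
  fix x :: "('a, 'g) group_ring fract"
  obtain F G where FG: "x = Fract F G" "G \<noteq> 0" by (cases x)
  obtain f g where fg: "to_fract F = embed_algebra f" "to_fract G = embed_algebra g"
    using to_fract_eq_embed_algebra by blast
  have "x = embed_algebra f / embed_algebra g" using FG fg by (simp add: Fract_conv_to_fract)
  moreover have "g \<noteq> 0" using FG(2) fg(2) by (auto simp: embed_algebra_def[of 0])
  ultimately show "\<exists>f g. g \<noteq> 0 \<and> x = embed_algebra f / embed_algebra g" by blast
qed

lemma semigroup_ring_eq_graded:
  fixes \<Gamma> :: "'g::torsion_free_ab_group_add set"
  shows "(semigroup_ring \<Gamma> :: ('a::idom, 'g) group_ring fract set) = group_algebra.graded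
    embed_algebra base_ring \<Gamma>"
proof -
  interpret group_algebra "embed_algebra :: ('g \<Rightarrow>\<^sub>0 'a fract) \<Rightarrow> ('a, 'g) group_ring fract"
    by (rule group_algebra_embed_algebra)
  show ?thesis
  proof (intro subset_antisym subsetI)
    fix x :: "('a, 'g) group_ring fract" assume "x \<in> semigroup_ring \<Gamma>"
    then obtain F where F: "x = to_fract F" "keys (group_ring_coeffs F) \<subseteq> \<Gamma>"
      by (auto simp: semigroup_ring_def)
    show "x \<in> graded base_ring \<Gamma>"
      unfolding F(1) to_fract_eq_embed_algebra emb_in_graded
      using F(2)
        by (auto simp: lookup_sum lookup_single when_def base_ring_def in_keys_iff split: if_splits)
  next
    fix x :: "('a, 'g) group_ring fract" assume "x \<in> graded base_ring \<Gamma>"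
    then obtain f where f: "x = embed_algebra f" "\<forall>k\<in>keys f. lookup f k \<in> base_ring" "keys f \<subseteq> \<Gamma>"
      by (rule gradedE)
    then have "\<forall>k\<in>keys f. \<exists>n. lookup f k = to_fract n" by (auto simp: base_ring_def)
    then obtain n where "\<forall>k\<in>keys f. lookup f k = to_fract (n k)" by (rule bchoice[THEN exE])
    then have n: "lookup f k = to_fract (n k)" if "k \<in> keys f" for k using that by blast
    define F where "F = (\<Sum>k\<in>keys f. group_ring_monom (n k) k)"
    have "x = embed_algebra (\<Sum>k\<in>keys f. single k (lookup f k))" by (simp add: f sum_single)
    also have "\<dots> = to_fract F"
      by (simp add: F_def embed_algebra_sum n embed_algebra_single_to_fract to_fract_sum)
    finally have "x = to_fract F" .
    moreover have "keys (group_ring_coeffs F) \<subseteq> keys f"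
    proof
      fix g assume "g \<in> keys (group_ring_coeffs F)"
      then have "(\<Sum>k\<in>keys f. lookup (single k (n k)) g) \<noteq> 0"
        by (simp add: F_def group_ring_coeffs_sum group_ring_monom.rep_eq in_keys_iff lookup_sum)
      then obtain k where "k \<in> keys f" "lookup (single k (n k)) g \<noteq> 0"
        by (rule sum.not_neutral_contains_not_neutral)
      then show "g \<in> keys f" by (auto simp: lookup_single when_def split: if_splits)
    qed
    ultimately show "x \<in> semigroup_ring \<Gamma>" using f(3) unfolding semigroup_ring_def by blast
  qed
qed

lemma ideal_extension_eq_graded:
  fixes \<Gamma> :: "'g::torsion_free_ab_group_add set" and J :: "'a::idom fract set"
  assumes \<Gamma>: "torsionless_grading_monoid \<Gamma>" and J: "J \<in> carrier (t_ideal_group base_ring)"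
  shows "ideal_extension \<Gamma> J = group_algebra.graded embed_algebra J \<Gamma>"
proof -
  interpret group_algebra "embed_algebra :: ('g \<Rightarrow>\<^sub>0 'a fract) \<Rightarrow> ('a, 'g) group_ring fract"
    by (rule group_algebra_embed_algebra)
  interpret semigroup_algebra "embed_algebra :: ('g \<Rightarrow>\<^sub>0 'a fract) \<Rightarrow> ('a, 'g) group_ring fract"
    base_ring \<Gamma>
    by unfold_locales (rule base_ring_quotient_field, rule \<Gamma>)
  have inv: "A.t_invertible J" using J by (simp add: A.carrier_t_ideal_group)
  then have subJ: "A.submodule J" by (rule A.t_invertible_submodule)
  have "R.t_invertible (graded J \<Gamma>)" by (intro t_invertible_graded inv \<Gamma>.t_invertible_D)
  then have sub: "R.submodule (graded J \<Gamma>)" by (rule R.t_invertible_submodule)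
  have scalar: "fract_embed a = embed_algebra (single 0 a)" for a :: "'a fract"
    by (simp add: embed_algebra_single group_ring_monom_one)
  have "submodule_span ring (fract_embed ` J * ring) = graded J \<Gamma>"
  proof
    show "submodule_span ring (fract_embed ` J * ring) \<subseteq> graded J \<Gamma>"
    proof (intro R.span_least sub subsetI)
      fix x assume "x \<in> fract_embed ` J * ring"
      then obtain a r where ar: "x = fract_embed a * r" "a \<in> J" "r \<in> ring"
        by (auto simp: set_times_def)
      obtain f where f: "r = embed_algebra f" "\<forall>k\<in>keys f. lookup f k \<in> base_ring" "keys f \<subseteq> \<Gamma>"
        using ar(3) by (rule gradedE)
      have "x = embed_algebra (f * single 0 a)"
        by (simp add: ar(1) f(1) scalar embed_algebra_mult mult.commute)
      also have "\<dots> \<in> graded J \<Gamma>"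
        unfolding emb_in_graded lookup_mult_single
      proof
        fix k assume "k \<in> keys (f * single 0 a)"
        then have k: "k \<in> keys f" by (auto simp: in_keys_iff lookup_mult_single)
        then show "lookup f (k - 0) * a \<in> J \<and> k \<in> \<Gamma>"
          using f A.submoduleD(3)[OF subJ _ ar(2)] by auto
      qed
      finally show "x \<in> graded J \<Gamma>" .
    qed
    show "graded J \<Gamma> \<subseteq> submodule_span ring (fract_embed ` J * ring)"
    proof
      fix x assume "x \<in> graded J \<Gamma>"
      then obtain f where f: "x = embed_algebra f" "\<forall>k\<in>keys f. lookup f k \<in> J" "keys f \<subseteq> \<Gamma>"
        by (rule gradedE)
      have "x = (\<Sum>k\<in>keys f. embed_algebra (single k (lookup f k)))"
        by (simp add: f(1) sum_single flip: embed_algebra_sum)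
      also have "\<dots> \<in> submodule_span ring (fract_embed ` J * ring)"
      proof (intro R.submodule_sum R.submodule_span)
        fix k assume k: "k \<in> keys f"
        have "embed_algebra (single k (lookup f k)) = fract_embed (lookup f k) * embed_algebra
          (single k 1)"
          unfolding scalar embed_algebra_mult[symmetric] mult_single by simp
        moreover have "embed_algebra (single k 1) \<in> ring"
          using k f by (intro single_in_graded A.one_in) auto
        ultimately have "embed_algebra (single k (lookup f k)) \<in> fract_embed ` J * ring"
          using k f by (auto intro: set_times_intro)
        then show "embed_algebra (single k (lookup f k)) \<in> submodule_span ring (fract_embed
          ` J * ring)"
          using R.span_superset by blast
      qed
      finally show "x \<in> submodule_span ring (fract_embed ` J * ring)" .
    qed
  qed
  then show ?thesis unfolding ideal_extension_def ideal_mult_def semigroup_ring_eq_graded .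
qed

theorem theorem2p12:
  fixes \<Gamma> :: "'g::torsion_free_ab_group_add set"
  assumes "torsionless_grading_monoid \<Gamma>" and "\<Gamma> \<noteq> {0}"
  shows "canonical_map \<Gamma> \<in> iso (class_group (base_ring :: 'a::idom fract set))
                               (class_group (semigroup_ring \<Gamma> :: ('a, 'g) group_ring fract set))
    \<longleftrightarrow> integrally_closed_domain (base_ring :: 'a fract set) \<and> integrally_closed_monoid \<Gamma> \<and>
        trivial_group (monoid_class_group \<Gamma>)"
proof -
  interpret group_algebra "embed_algebra :: ('g \<Rightarrow>\<^sub>0 'a fract) \<Rightarrow> ('a, 'g) group_ring fract"
    by (rule group_algebra_embed_algebra)
  interpret semigroup_algebra "embed_algebra :: ('g \<Rightarrow>\<^sub>0 'a fract) \<Rightarrow> ('a, 'g) group_ring fract"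
    base_ring \<Gamma>
    by unfold_locales (rule base_ring_quotient_field, rule assms(1))
  let ?A = "class_group (base_ring :: 'a fract set)" and ?R = "class_group ring"
  have ring: "semigroup_ring \<Gamma> = ring" by (rule semigroup_ring_eq_graded)
  have map: "canonical_map \<Gamma> (ideal_class base_ring J) = ideal_class ring (graded J \<Gamma>)"
    if "A.t_invertible J" for J
    using that canonical_map_ideal_class[of J \<Gamma>] ideal_extension_eq_graded[OF assms(1), of J]
    by (simp add: A.carrier_t_ideal_group ring)
  have inv: "R.t_invertible (graded J \<Gamma>)" if "A.t_invertible J" for J
    by (intro t_invertible_graded that \<Gamma>.t_invertible_D)
  have hom: "canonical_map \<Gamma> \<in> hom ?A ?R"
  proof (rule homI)
    fix X assume "X \<in> carrier ?A"
    then show "canonical_map \<Gamma> X \<in> carrier ?R"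
      using map inv by (auto simp: A.carrier_class_group R.carrier_class_group)
  next
    fix X Y assume "X \<in> carrier ?A" "Y \<in> carrier ?A"
    then obtain I J where IJ: "X = ideal_class base_ring I" "Y = ideal_class base_ring J"
      "A.t_invertible I" "A.t_invertible J"
      by (auto simp: A.carrier_class_group)
    have "R.t (R.prod (graded I \<Gamma>) (graded J \<Gamma>)) = graded (A.t (A.prod I J)) (\<Gamma>.t (\<Gamma>.prod \<Gamma> \<Gamma>))"
      using A.t_invertible_closed A.t_invertible_not_null IJ(3,4) \<Gamma>.t_D \<Gamma>.zero_mem
      by (intro t_prod_graded) auto
    then have "R.t (R.prod (graded I \<Gamma>) (graded J \<Gamma>)) = graded (A.t (A.prod I J)) \<Gamma>"
      by (simp add: \<Gamma>.prod_D_D \<Gamma>.t_D)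
    then show "canonical_map \<Gamma> (X \<otimes>\<^bsub>?A\<^esub> Y) = canonical_map \<Gamma> X \<otimes>\<^bsub>?R\<^esub> canonical_map \<Gamma> Y"
      by (simp add: IJ map inv A.mult_class_group R.mult_class_group A.t_invertible_prod)
  qed
  have inj: "inj_on (canonical_map \<Gamma>) (carrier ?A)"
  proof (rule inj_onI)
    fix X Y assume XY: "X \<in> carrier ?A" "Y \<in> carrier ?A" "canonical_map \<Gamma> X = canonical_map \<Gamma> Y"
    obtain I J where IJ: "X = ideal_class base_ring I" "Y = ideal_class base_ring J"
      "A.t_invertible I" "A.t_invertible J"
      using XY(1,2) by (auto simp: A.carrier_class_group)
    have "ideal_class ring (graded I \<Gamma>) = ideal_class ring (graded J \<Gamma>)"
      using XY(3) by (simp add: IJ map)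
    then obtain x where "x \<noteq> 0" "graded I \<Gamma> = R.scale x (graded J \<Gamma>)"
      using R.class_eq_iff[OF inv[OF IJ(3)] inv[OF IJ(4)]] by blast
    from this(2) obtain h u where "u \<noteq> 0" "I = A.scale u J"
      by (rule scale_graded_eq_graded[OF IJ(4,3) \<Gamma>.zero_mem \<Gamma>.zero_mem])
    then show "X = Y" using A.class_eq_iff[OF IJ(3,4)] IJ(1,2) by blast
  qed
  have "canonical_map \<Gamma> ` carrier ?A = carrier ?R \<longleftrightarrow> all_extended"
  proof -
    have im: "canonical_map \<Gamma> ` carrier ?A = (\<lambda>J. ideal_class ring (graded J \<Gamma>)) ` {J.
      A.t_invertible J}"
      unfolding A.carrier_class_group image_image by (rule image_cong) (simp_all add: map)
    have sub: "canonical_map \<Gamma> ` carrier ?A \<subseteq> carrier ?R" using hom by (auto simp: hom_def)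
    have "canonical_map \<Gamma> ` carrier ?A = carrier ?R \<longleftrightarrow> carrier ?R \<subseteq> canonical_map \<Gamma> ` carrier ?A"
      using sub by (simp only: set_eq_subset simp_thms)
    also have "\<dots> \<longleftrightarrow> (\<forall>I\<in>{I. R.t_invertible I}. \<exists>J\<in>{J. A.t_invertible J}. ideal_class ring I =
      ideal_class ring (graded J \<Gamma>))"
      unfolding im R.carrier_class_group by (simp only: image_subset_iff image_iff)
    also have "\<dots> \<longleftrightarrow> (\<forall>I. R.t_invertible I \<longrightarrow>
        (\<exists>J. A.t_invertible J \<and> (\<exists>x. x \<noteq> 0 \<and> I = R.scale x (graded J \<Gamma>))))"
      using R.class_eq_iff[OF _ inv] by (simp cong: conj_cong)
    also have "\<dots> \<longleftrightarrow> all_extended"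
      unfolding all_extended_def
        by (simp only: ex_simps[symmetric] conj_left_commute) (metis (no_types))
    finally show ?thesis .
  qed
  then have "canonical_map \<Gamma> \<in> iso ?A ?R \<longleftrightarrow> all_extended"
    using hom inj by (simp add: iso_def bij_betw_def)
  then show ?thesis
    unfolding ring all_extended_iff[OF assms(2)] \<Gamma>.trivial_class_group_iff .
qed

end
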